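(* Let $\mu_1,\mu_2$ be Borel probability measures on the unit circle $\mathbb{T}$, neither of which is a point mass, and let $\mu=\mu_1\boxtimes\mu_2$ be their free multiplicative convolution. Suppose that $J\subset\mathbb{T}$ is an open arc such that each endpoint $\alpha$ of $J$ satisfies $\eta_\mu(1/\alpha)=1$. If either $\mu_1$ or $\mu_2$ has more than two points in its support, then $\mu(J)>0$.
   Context: $\mathbb{T}=\{z\in\mathbb{C}:|z|=1\}$ and $\mathbb{D}=\{z\in\mathbb{C}:|z|<1\}$. Open arcs are understood to be nonempty. The free multiplicative convolution $\mu_1\boxtimes\mu_2$ of Borel probability measures $\mu_1,\mu_2$ on $\mathbb{T}$ is the distribution of $u_1u_2$, where $u_1,u_2$ are $*$-free unitary elements of a $C^*$-probability space $(\mathcal{A},\tau)$ with $\tau$ a faithful tracial state, and $u_j$ has distribution $\mu_j$, that is, $\tau(u_j^n)=\int_{\mathbb{T}}t^n\,d\mu_j(t)$ for all $n\in\mathbb{N}$. Thus $\mu_1\boxtimes\mu_2$ is the unique Borel probability measure $\mu$ on $\mathbb{T}$ with $\int_{\mathbb{T}}t^n\,d\mu(t)=\tau((u_1u_2)^n)$ for all $n\in\mathbb{N}$. For a Borel probability measure $\mu$ on $\mathbb{T}$, define for $z\in\mathbb{D}$ $$\psi_\mu(z)=\int_{\mathbb{T}}\frac{tz}{1-tz}\,d\mu(t),\qquad \eta_\mu(z)=\frac{\psi_\mu(z)}{1+\psi_\mu(z)}.$$ The function $\eta_\mu$ is analytic from $\mathbb{D}$ to $\mathbb{D}$. When $\mu=\mu_1\boxtimes\mu_2$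 with neither $\mu_1$ nor $\mu_2$ a point mass, it is known that $\eta_\mu$ extends continuously to $\mathbb{D}\cup\mathbb{T}$; for points of $\mathbb{T}$, $\eta_\mu$ denotes this continuous extension. *)

theory Defs
  imports "HOL-Probability.Probability"
begin

section \<open>C*-probability spaces and *-freeness\<close>

text \<open>
  Unital complex C*-algebras. The class \<open>real_normed_algebra_1\<close> contributes the real algebra
  structure, submultiplicativity of the norm and \<open>norm 1 = 1\<close>.
\<close>

class cstar_algebra = real_normed_algebra_1 + banach +
  fixes scaleC :: "complex \<Rightarrow> 'a \<Rightarrow> 'a"
    and star :: "'a \<Rightarrow> 'a"
  assumes scaleC_add_right: "scaleC c (x + y) = scaleC c x + scaleC c y"
    and scaleC_add_left: "scaleC (c + d) x = scaleC c x + scaleC d x"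
    and scaleC_scaleC: "scaleC c (scaleC d x) = scaleC (c * d) x"
    and scaleR_scaleC: "scaleR r x = scaleC (complex_of_real r) x"
    and mult_scaleC_left: "scaleC c x * y = scaleC c (x * y)"
    and mult_scaleC_right: "x * scaleC c y = scaleC c (x * y)"
    and norm_scaleC: "norm (scaleC c x) = cmod c * norm x"
    and star_add: "star (x + y) = star x + star y"
    and star_scaleC: "star (scaleC c x) = scaleC (cnj c) (star x)"
    and star_mult: "star (x * y) = star y * star x"
    and star_star: "star (star x) = x"
    and cstar_identity: "norm (star x * x) = (norm x)\<^sup>2"

instantiation complex :: cstar_algebra
begin

definition "scaleC_complex = ((*) :: complex \<Rightarrow> complex \<Rightarrow> complex)"
definition "star_complex = cnj"

instance
  by standard
    (auto simp: scaleC_complex_def star_complex_def algebra_simps norm_mult scaleR_conv_of_real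
      power2_eq_square)

end

definition faithful_tracial_state :: "('a::cstar_algebra \<Rightarrow> complex) \<Rightarrow> bool" where
  "faithful_tracial_state \<tau> \<longleftrightarrow>
     (\<forall>x y. \<tau> (x + y) = \<tau> x + \<tau> y) \<and>
     (\<forall>c x. \<tau> (scaleC c x) = c * \<tau> x) \<and>
     (\<forall>x. \<tau> (star x * x) \<in> \<real>\<^sub>\<ge>\<^sub>0) \<and>
     \<tau> 1 = 1 \<and>
     (\<forall>x. \<tau> (star x * x) = 0 \<longrightarrow> x = 0) \<and>
     (\<forall>x y. \<tau> (x * y) = \<tau> (y * x))"

definition unitary :: "'a::cstar_algebra \<Rightarrow> bool" where
  "unitary u \<longleftrightarrow> star u * u = 1 \<and> u * star u = 1"

definition star_subalgebra :: "'a::cstar_algebra set \<Rightarrow> bool" where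
  "star_subalgebra A \<longleftrightarrow>
     1 \<in> A \<and>
     (\<forall>x\<in>A. \<forall>y\<in>A. x + y \<in> A) \<and>
     (\<forall>x\<in>A. \<forall>y\<in>A. x * y \<in> A) \<and>
     (\<forall>c. \<forall>x\<in>A. scaleC c x \<in> A) \<and>
     (\<forall>x\<in>A. star x \<in> A)"

text \<open>
  Free independence of a family of subalgebras: a nonempty product of centred elements,
  neighbouring factors coming from different subalgebras, is centred. Each factor is listed
  together with the index of its subalgebra.
\<close>

definition free_subalgebras :: "('a::cstar_algebra \<Rightarrow> complex) \<Rightarrow> ('i \<Rightarrow> 'a set) \<Rightarrow> bool" where
  "free_subalgebras \<tau> A \<longleftrightarrow>
     (\<forall>ps. ps \<noteq> [] \<longrightarrow>
        (\<forall>(i, x) \<in> set ps. x \<in> A i \<and> \<tau> x = 0) \<longrightarrow>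
        successively (\<lambda>p q. fst p \<noteq> fst q) ps \<longrightarrow>
        \<tau> (prod_list (map snd ps)) = 0)"

definition star_free :: "('a::cstar_algebra \<Rightarrow> complex) \<Rightarrow> 'a \<Rightarrow> 'a \<Rightarrow> bool" where
  "star_free \<tau> u v \<longleftrightarrow>
     free_subalgebras \<tau> (\<lambda>i::bool. star_subalgebra hull {if i then u else v})"


section \<open>Measures on the unit circle\<close>

abbreviation circle :: "complex set" where
  "circle \<equiv> sphere 0 1"

definition circle_prob :: "complex measure \<Rightarrow> bool" where
  "circle_prob \<mu> \<longleftrightarrow> prob_space \<mu> \<and> sets \<mu> = sets (restrict_space borel circle)"

definition point_mass :: "complex measure \<Rightarrow> bool" where
  "point_mass \<mu> \<longleftrightarrow> (\<exists>t\<in>circle. \<mu> = return (restrict_space borel circle) t)"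

definition circle_support :: "complex measure \<Rightarrow> complex set" where
  "circle_support \<mu> = {t \<in> circle. \<forall>U. open U \<longrightarrow> t \<in> U \<longrightarrow> measure \<mu> (U \<inter> circle) > 0}"

definition has_distribution ::
    "('a::cstar_algebra \<Rightarrow> complex) \<Rightarrow> 'a \<Rightarrow> complex measure \<Rightarrow> bool" where
  "has_distribution \<tau> u \<mu> \<longleftrightarrow> (\<forall>n::nat. \<tau> (u ^ n) = (LINT t|\<mu>. t ^ n))"

text \<open>
  \<open>is_free_mult_conv TYPE('a) \<mu>\<^sub>1 \<mu>\<^sub>2 \<mu>\<close> says that \<open>\<mu>\<close> is the free multiplicative convolution of
  \<open>\<mu>\<^sub>1\<close> and \<open>\<mu>\<^sub>2\<close>, realized in the C*-algebra \<open>'a\<close>. The algebra is a type parameter because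
  HOL cannot quantify over types inside a formula; \<open>\<mu>\<close> does not depend on it, since freeness
  determines the moments of the product and these determine a measure on the circle.
\<close>

definition is_free_mult_conv ::
    "'a::cstar_algebra itself \<Rightarrow> complex measure \<Rightarrow> complex measure \<Rightarrow> complex measure \<Rightarrow> bool"
  where
  "is_free_mult_conv _ \<mu>\<^sub>1 \<mu>\<^sub>2 \<mu> \<longleftrightarrow>
     circle_prob \<mu> \<and>
     (\<exists>(\<tau> :: 'a \<Rightarrow> complex) u\<^sub>1 u\<^sub>2.
        faithful_tracial_state \<tau> \<and>
        unitary u\<^sub>1 \<and> unitary u\<^sub>2 \<and>
        star_free \<tau> u\<^sub>1 u\<^sub>2 \<and>
        has_distribution \<tau> u\<^sub>1 \<mu>\<^sub>1 \<and>
        has_distribution \<tau> u\<^sub>2 \<mu>\<^sub>2 \<and>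
        has_distribution \<tau> (u\<^sub>1 * u\<^sub>2) \<mu>)"


section \<open>The eta transform\<close>

definition psi_transform :: "complex measure \<Rightarrow> complex \<Rightarrow> complex" where
  "psi_transform \<mu> z = (LINT t|\<mu>. t * z / (1 - t * z))"

definition eta_transform :: "complex measure \<Rightarrow> complex \<Rightarrow> complex" where
  "eta_transform \<mu> z = psi_transform \<mu> z / (1 + psi_transform \<mu> z)"

text \<open>
  The transforms are meaningful on the open disc only. The value at a point \<open>w\<close> of the circle
  of the continuous extension of \<open>eta_transform \<mu>\<close> is expressed as the limit at \<open>w\<close> from
  within the disc; wherever a continuous extension exists the two agree.
\<close>

lemma continuous_extension_eq_iff_tendsto:
  assumes "continuous_on (cball 0 1) H"
    and "\<And>z. z \<in> ball 0 1 \<Longrightarrow> H z = eta_transform \<mu> z"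
    and "w \<in> circle"
  shows "H w = c \<longleftrightarrow> (eta_transform \<mu> \<longlongrightarrow> c) (at w within ball 0 1)"
proof -
  have w: "w islimpt ball 0 (1::real)"
    using assms(3) by (simp add: islimpt_ball)
  have "(H \<longlongrightarrow> H w) (at w within cball 0 1)"
    using assms(1,3) by (auto simp: continuous_on_def)
  then have "(H \<longlongrightarrow> H w) (at w within ball 0 1)"
    by (rule tendsto_within_subset) auto
  then have lim: "(eta_transform \<mu> \<longlongrightarrow> H w) (at w within ball 0 1)"
    by (rule Lim_transform_eventually) (auto simp: eventually_at_filter assms(2))
  have "at w within ball 0 1 \<noteq> bot"
    using w by (simp add: trivial_limit_within)
  with lim show ?thesis
    using tendsto_unique by blast
qed

end

theory Submission
  imports Defs
begin

text \<open>
  For a probability measure \<open>\<nu>\<close> on the circle put \<open>\<gamma>\<^sub>\<nu>(w) = \<integral> 1 / (1 - w t) d\<nu>(t) = 1 + \<psi>\<^sub>\<nu>(w)\<close>, so that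
  \<open>\<eta>\<^sub>\<nu> = 1 - 1 / \<gamma>\<^sub>\<nu>\<close>, and \<open>h\<^sub>\<nu>(w) = \<eta>\<^sub>\<nu>(w) / w\<close>. The point of the proof is that an endpoint of \<open>J\<close> with
  \<open>\<eta>\<^sub>\<mu> = 1\<close> forces atoms of \<open>\<mu>\<^sub>1\<close> and of \<open>\<mu>\<^sub>2\<close> whose masses add up to at least \<open>1\<close>. If \<open>\<mu>(J) = 0\<close>, then the
  two endpoints produce different atoms, the four masses add up to at least \<open>2\<close>, and both
  measures are carried by two points.

  Subordination. For \<open>z\<close> in the disc the equations \<open>w\<^sub>1 = z h\<^sub>2(w\<^sub>2)\<close>, \<open>w\<^sub>2 = z h\<^sub>1(w\<^sub>1)\<close> have a solution by
  Brouwer's theorem, because \<open>h\<^sub>1\<close> and \<open>h\<^sub>2\<close> map the disc into the closed disc. At such a solution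
  \<open>\<gamma>\<^sub>\<mu>(z) = \<gamma>\<^sub>1(w\<^sub>1) = \<gamma>\<^sub>2(w\<^sub>2)\<close> (\<open>free_convolution_subordination\<close>): with the centred elements
  \<open>x = (1 - w\<^sub>1 u\<^sub>1)\<^sup>-\<^sup>1 (u\<^sub>1 - h\<^sub>1(w\<^sub>1))\<close> and \<open>y = (u\<^sub>2 - h\<^sub>2(w\<^sub>2)) (1 - w\<^sub>2 u\<^sub>2)\<^sup>-\<^sup>1\<close> one has
  \<open>1 - z x y = (1 - \<eta>) (1 - w\<^sub>1 u\<^sub>1)\<^sup>-\<^sup>1 (1 - z u\<^sub>1 u\<^sub>2) (1 - w\<^sub>2 u\<^sub>2)\<^sup>-\<^sup>1\<close>, and freeness evaluates the trace of the
  Neumann series of \<open>(1 - z x y)\<^sup>-\<^sup>1\<close>, which converges in the 2-norm of the trace because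
  \<open>\<parallel>(x y)\<^sup>n\<parallel>\<^sub>2 = (\<parallel>x\<parallel>\<^sub>2 \<parallel>y\<parallel>\<^sub>2)\<^sup>n\<close>. The solution depends on \<open>z\<close> as a holomorphic self-map of the disc would:
  it does not increase hyperbolic distances (\<open>solution_contraction\<close>). This comes from the
  Schwarz-Pick inequality for \<open>h\<^sub>1\<close> and \<open>h\<^sub>2\<close>, which is a Cauchy-Schwarz inequality.

  The arc. Let \<open>\<mu>(J) = 0\<close> and let \<open>\<omega>\<^sub>j\<close> be the solution as a function of \<open>z\<close>. Near the arc \<open>1/J\<close> the
  integral of \<open>1 / \<bar>1 - z t\<bar>\<^sup>2\<close> is bounded, hence \<open>1 - \<bar>\<omega>\<^sub>j(z)\<bar>\<^sup>2\<close> is comparable with \<open>1 - \<bar>z\<bar>\<^sup>2\<close>, and the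
  contraction property becomes a Lipschitz bound up to the boundary. The boundary values on \<open>1/J\<close>
  are continuous, of modulus \<open>1\<close> and injective, the latter because \<open>\<gamma>\<^sub>\<mu>\<close> is injective there. The
  discs of radius \<open>\<epsilon>\<close> around their conjugates have \<open>\<mu>\<^sub>j\<close>-mass \<open>O(\<epsilon>\<^sup>2)\<close>, so \<open>\<mu>\<^sub>j\<close> does not charge the
  arc which the conjugates fill. That arc has two limiting endpoints. They are different: if they
  agreed, the arc would be the circle without a point and \<open>\<mu>\<^sub>j\<close> would be a point mass
  (\<open>distinct_ends\<close>).

  The endpoints. At all points of the disc
  \<open>\<bar>z\<bar>\<^sup>2 \<le> \<bar>\<gamma>\<bar>\<^sup>2 / \<integral> \<bar>1 - w\<^sub>1 t\<bar>\<^sup>-\<^sup>2 d\<mu>\<^sub>1 + \<bar>\<gamma>\<bar>\<^sup>2 / \<integral> \<bar>1 - w\<^sub>2 t\<bar>\<^sup>-\<^sup>2 d\<mu>\<^sub>2\<close>. When \<open>\<gamma> \<rightarrow> \<infinity>\<close> and \<open>w\<^sub>j \<rightarrow> v\<^sub>j\<close>, the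
  Cauchy-Schwarz inequality bounds the limit of the \<open>j\<close>-th quotient by the mass of \<open>\<mu>\<^sub>j\<close> at the
  conjugate of \<open>v\<^sub>j\<close>, and the sum of these masses is at least \<open>1\<close> (\<open>end_point_masses\<close>).
\<close>

section \<open>C*-algebras and tracial states\<close>

lemma scaleC_zero_right [simp]: "scaleC c (0::'a::cstar_algebra) = 0"
  using scaleC_add_right[of c 0 "0::'a"] by simp

lemma scaleC_zero_left [simp]: "scaleC 0 (x::'a::cstar_algebra) = 0"
  using scaleC_add_left[of 0 0 x] by simp

lemma scaleC_one [simp]: "scaleC 1 (x::'a::cstar_algebra) = x"
  using scaleR_scaleC[of 1 x] by simp

lemmas mult_scaleC = mult_scaleC_left mult_scaleC_right

lemma scaleC_minus_right: "scaleC c (- x) = - scaleC c (x::'a::cstar_algebra)"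
  using scaleC_add_right[of c x "-x"] by (simp add: eq_neg_iff_add_eq_0 add.commute)

lemma scaleC_minus_left: "scaleC (- c) x = - scaleC c (x::'a::cstar_algebra)"
  using scaleC_add_left[of c "-c" x] by (simp add: eq_neg_iff_add_eq_0 add.commute)

lemma scaleC_diff_right: "scaleC c (x - y) = scaleC c x - scaleC c (y::'a::cstar_algebra)"
  using scaleC_add_right[of c x "-y"] by (simp add: scaleC_minus_right)

lemma scaleC_diff_left: "scaleC (c - d) x = scaleC c x - scaleC d (x::'a::cstar_algebra)"
  using scaleC_add_left[of c "-d" x] by (simp add: scaleC_minus_left)

lemma scaleC_power: "scaleC c x ^ n = scaleC (c ^ n) (x ^ n :: 'a::cstar_algebra)"
  by (induction n) (auto simp: mult_scaleC scaleC_scaleC power_commutes)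

lemma star_zero [simp]: "star (0::'a::cstar_algebra) = 0"
  using star_add[of "0::'a" 0] by simp

lemma star_one [simp]: "star (1::'a::cstar_algebra) = 1"
  by (metis mult.left_neutral mult.right_neutral star_mult star_star)

lemma star_minus: "star (- x) = - star (x::'a::cstar_algebra)"
  using star_add[of x "-x"] by (simp add: eq_neg_iff_add_eq_0 add.commute)

lemma star_diff: "star (x - y) = star x - star (y::'a::cstar_algebra)"
  using star_add[of x "-y"] by (simp add: star_minus)

lemma star_power: "star (x ^ n) = star (x::'a::cstar_algebra) ^ n"
  by (induction n) (auto simp: star_mult power_commutes)

lemma norm_star [simp]: "norm (star (x::'a::cstar_algebra)) = norm x"
proof -
  have le: "norm y \<le> norm (star y)" for y :: 'a
  proof (cases "y = 0")
    case False
    have "norm y * norm y \<le> norm (star y) * norm y"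
      using norm_mult_ineq[of "star y" y] by (simp add: cstar_identity power2_eq_square)
    with False show ?thesis by simp
  qed simp
  from le[of x] le[of "star x"] show ?thesis by (simp add: star_star)
qed

lemma bounded_linear_star: "bounded_linear (star :: 'a::cstar_algebra \<Rightarrow> 'a)"
  by (rule bounded_linear_intro[of _ 1])
    (auto simp: star_add scaleR_scaleC star_scaleC)

lemma bounded_linear_scaleC: "bounded_linear (scaleC c :: 'a::cstar_algebra \<Rightarrow> 'a)"
  by (rule bounded_linear_intro[of _ "cmod c"])
    (auto simp: scaleC_add_right scaleR_scaleC scaleC_scaleC norm_scaleC mult.commute)

lemma norm_unitary:
  assumes "unitary (u::'a::cstar_algebra)"
  shows "norm u = 1"
  using cstar_identity[of u] assms by (auto simp: unitary_def power2_eq_1_iff)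
    (metis norm_ge_zero not_one_le_zero le_minus_one_simps(3))

lemma unitary_mult:
  assumes "unitary (u::'a::cstar_algebra)" "unitary v"
  shows "unitary (u * v)"
proof -
  have "star v * (star u * u) * v = 1" "u * (v * star v) * star u = 1"
    using assms by (simp_all add: unitary_def)
  then show ?thesis by (simp add: unitary_def star_mult mult.assoc)
qed

definition resolvent :: "'a::cstar_algebra \<Rightarrow> 'a" where
  "resolvent x = (\<Sum>n. x ^ n)"

lemma
  assumes "norm (x::'a::cstar_algebra) < 1"
  shows sums_resolvent: "(\<lambda>n. x ^ n) sums resolvent x"
    and resolvent_right: "(1 - x) * resolvent x = 1"
    and resolvent_left: "resolvent x * (1 - x) = 1"
proof -
  have s: "summable (\<lambda>n. x ^ n)"
    by (rule summable_norm_cancel, rule summable_comparison_test'[of "\<lambda>n. norm x ^ n" 0])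
      (auto simp: norm_power_ineq assms intro: summable_geometric)
  then show sm: "(\<lambda>n. x ^ n) sums resolvent x" by (simp add: resolvent_def summable_sums)
  have "(\<lambda>n. x ^ Suc n) sums (resolvent x - 1)"
    using sums_Suc_iff[of "\<lambda>n. x ^ n" "resolvent x - 1"] sm by simp
  moreover have "(\<lambda>n. x ^ Suc n) sums (x * resolvent x)"
    using sums_mult[OF sm, of x] by simp
  moreover have "(\<lambda>n. x ^ Suc n) sums (resolvent x * x)"
    using sums_mult2[OF sm, of x] by (simp add: power_commutes)
  ultimately have "x * resolvent x = resolvent x - 1" "resolvent x * x = resolvent x - 1"
    using sums_unique2 by blast+
  then show "(1 - x) * resolvent x = 1" "resolvent x * (1 - x) = 1"
    by (simp_all add: algebra_simps)
qed

text \<open>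
  Coefficients of modulus at most \<open>1\<close> make the binomial series of \<open>(1 - x)\<^bsup>1/2\<^esup>\<close> converge absolutely
  whenever \<open>\<parallel>x\<parallel> < 1\<close>.
\<close>

lemma abs_gbinomial_half_le: "\<bar>(1/2::real) gchoose n\<bar> \<le> 1"
proof (induction n)
  case (Suc n)
  have "real (Suc n) * ((1/2) gchoose Suc n) = (1/2 - real n) * ((1/2) gchoose n)"
    using gbinomial_mult_1[of "1/2::real" n] by (simp add: algebra_simps)
  then have "real (Suc n) * \<bar>(1/2) gchoose Suc n\<bar> = \<bar>1/2 - real n\<bar> * \<bar>(1/2) gchoose n\<bar>"
    by (metis abs_mult abs_of_nat)
  also have "\<dots> \<le> real (Suc n) * 1"
    by (rule mult_mono) (use Suc in auto)
  finally show ?case by (simp only: mult_le_cancel_left_pos of_nat_0_less_iff zero_less_Suc)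
qed auto

text \<open>
  The root is the binomial series of \<open>(1 - x)\<^bsup>1/2\<^esup>\<close>: its Cauchy square is evaluated by Vandermonde's
  identity, and a real power series in a self-adjoint element is self-adjoint.
\<close>

lemma selfadjoint_square_root:
  fixes x :: "'a::cstar_algebra"
  assumes "star x = x" "norm x < 1"
  shows "\<exists>y. star y = y \<and> y * y = 1 - x"
proof -
  define a where "a = (\<lambda>n. ((1/2::real) gchoose n) *\<^sub>R (- x) ^ n)"
  have na: "norm (a n) \<le> norm x ^ n" for n
    using mult_mono[OF abs_gbinomial_half_le[of n] norm_power_ineq[of "-x" n]]
    by (simp add: a_def)
  have sn: "summable (\<lambda>n. norm (a n))"
    by (rule summable_comparison_test'[of "\<lambda>n. norm x ^ n" 0])
      (use na assms in \<open>auto intro: summable_geometric\<close>)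
  then have sa: "summable a" by (rule summable_norm_cancel)
  have "star (a n) = a n" for n
    by (simp add: a_def scaleR_scaleC star_scaleC star_power star_minus assms)
  then have 1: "star (suminf a) = suminf a"
    using bounded_linear.suminf[OF bounded_linear_star sa] by simp
  \<comment> \<open>Vandermonde: the coefficients of the square are those of the exponent 1/2 + 1/2.\<close>
  have "(\<Sum>i\<le>k. a i * a (k - i)) = ((1::real) gchoose k) *\<^sub>R (- x) ^ k" for k
  proof -
    have "(\<Sum>i\<le>k. a i * a (k - i))
        = (\<Sum>i\<le>k. (((1/2) gchoose i) * ((1/2) gchoose (k - i))) *\<^sub>R (- x) ^ k)"
      by (rule sum.cong) (auto simp: a_def simp flip: power_add)
    also have "\<dots> = (\<Sum>i\<le>k. ((1/2) gchoose i) * ((1/2) gchoose (k - i))) *\<^sub>R (- x) ^ k"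
      by (simp add: scaleR_sum_left)
    also have "(\<Sum>i\<le>k. ((1/2::real) gchoose i) * ((1/2) gchoose (k - i))) = (1 gchoose k)"
      using gbinomial_Vandermonde[of "1/2::real" "1/2" k] by (simp add: atMost_atLeast0)
    finally show ?thesis .
  qed
  then have "(\<lambda>k. ((1::real) gchoose k) *\<^sub>R (- x) ^ k) sums (suminf a * suminf a)"
    using Cauchy_product_sums[OF sn sn] by simp
  moreover have "(\<lambda>k. ((1::real) gchoose k) *\<^sub>R (- x) ^ k) sums (\<Sum>k<2. ((1::real) gchoose k) *\<^sub>R (- x) ^ k)"
  proof (rule sums_finite)
    fix k :: nat assume "k \<notin> {..<2}"
    then have "((1::real) gchoose k) = 0"
      using binomial_gbinomial[of 1 k, where 'a=real] by (simp add: binomial_eq_0)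
    then show "((1::real) gchoose k) *\<^sub>R (- x) ^ k = 0" by simp
  qed simp
  ultimately have "suminf a * suminf a = 1 - x"
    by (auto dest: sums_unique2 simp: numeral_2_eq_2)
  with 1 show ?thesis by blast
qed

text \<open>
  The common core of the Cauchy-Schwarz inequalities for a tracial state and for an integral: \<open>p\<close>, \<open>q\<close>
  and \<open>s\<close> play the roles of \<open>\<langle>x, x\<rangle>\<close>, \<open>\<langle>y, y\<rangle>\<close> and \<open>\<langle>x, y\<rangle>\<close>, and the hypothesis says that \<open>x - c y\<close> has
  nonnegative square norm.
\<close>

lemma Cauchy_Schwarz_abstract:
  fixes p q :: real and s :: complex
  assumes nonneg: "\<And>c. 0 \<le> p - 2 * Re (cnj c * s) + (cmod c)\<^sup>2 * q" and "0 \<le> p" "0 \<le> q"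
  shows "(cmod s)\<^sup>2 \<le> p * q"
proof (cases "q = 0")
  case True
  have "s = 0"
  proof (rule ccontr)
    assume "s \<noteq> 0"
    \<comment> \<open>With \<open>q = 0\<close> the hypothesis is affine in \<open>c\<close>; this multiple of \<open>s\<close> makes it negative.\<close>
    define r where "r = (p + 1) / (cmod s)\<^sup>2"
    have "Re (cnj (of_real r * s) * s) = r * (cmod s)\<^sup>2"
      unfolding cmod_power2 by (simp add: power2_eq_square algebra_simps)
    then have "Re (cnj (of_real r * s) * s) = p + 1"
      using \<open>s \<noteq> 0\<close> by (simp add: r_def)
    with nonneg[of "of_real r * s"] True \<open>0 \<le> p\<close> show False by simp
  qed
  with assms show ?thesis by simp
next
  case False
  with \<open>0 \<le> q\<close> have q: "q > 0" by simp
  have "Re (cnj (s / q) * s) = (cmod s)\<^sup>2 / q"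
    unfolding cmod_power2 by (simp add: power2_eq_square add_divide_distrib)
  moreover have "(cmod (s / q))\<^sup>2 * q = (cmod s)\<^sup>2 / q"
    using q by (simp add: norm_divide power2_eq_square)
  ultimately have "0 \<le> p - (cmod s)\<^sup>2 / q" using nonneg[of "s / q"] by linarith
  then show ?thesis using q by (simp add: field_simps)
qed

locale tracial_state =
  fixes \<tau> :: "'a::cstar_algebra \<Rightarrow> complex"
  assumes state: "faithful_tracial_state \<tau>"
begin

lemma add: "\<tau> (x + y) = \<tau> x + \<tau> y"
  and scale: "\<tau> (scaleC c x) = c * \<tau> x"
  and one [simp]: "\<tau> 1 = 1"
  and trace: "\<tau> (x * y) = \<tau> (y * x)"
  and pos: "\<tau> (star x * x) \<in> \<real>\<^sub>\<ge>\<^sub>0"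
  using state by (auto simp: faithful_tracial_state_def)

lemma zero [simp]: "\<tau> 0 = 0"
  using add[of 0 0] by simp

lemma minus: "\<tau> (- x) = - \<tau> x"
  using add[of x "-x"] by (simp add: eq_neg_iff_add_eq_0 add.commute)

lemma diff: "\<tau> (x - y) = \<tau> x - \<tau> y"
  using add[of x "-y"] by (simp add: minus)

lemma sum: "\<tau> (\<Sum>i\<in>I. f i) = (\<Sum>i\<in>I. \<tau> (f i))"
  by (induction I rule: infinite_finite_induct) (auto simp: add)

lemmas linear = add diff minus scale

definition sq_norm2 :: "'a \<Rightarrow> real" where
  "sq_norm2 x = Re (\<tau> (star x * x))"

lemma sq_norm2_nonneg: "0 \<le> sq_norm2 x"
  and tau_star_self: "\<tau> (star x * x) = complex_of_real (sq_norm2 x)"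
  using pos[of x] by (auto simp: sq_norm2_def complex_nonneg_Reals_iff complex_eq_iff)

text \<open>
  Positivity at \<open>1 + x\<close> and at \<open>1 + \<i> x\<close> forces the imaginary parts of \<open>\<tau> x + \<tau> (star x)\<close> and of
  \<open>\<i> (\<tau> x - \<tau> (star x))\<close> to vanish.
\<close>

lemma star_cnj: "\<tau> (star x) = cnj (\<tau> x)"
proof -
  have "\<tau> (star (1 + x) * (1 + x)) = 1 + \<tau> x + \<tau> (star x) + \<tau> (star x * x)"
    by (simp add: star_add algebra_simps linear)
  then have "1 + \<tau> x + \<tau> (star x) + sq_norm2 x = sq_norm2 (1 + x)" by (simp add: tau_star_self)
  then have 1: "Im (\<tau> x + \<tau> (star x)) = 0" by (simp add: complex_eq_iff)
  have "\<tau> (star (1 + scaleC \<i> x) * (1 + scaleC \<i> x))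
      = 1 + \<i> * \<tau> x - \<i> * \<tau> (star x) + \<tau> (star x * x)"
    by (simp add: star_add star_scaleC algebra_simps linear mult_scaleC
        scaleC_scaleC)
  then have "1 + \<i> * \<tau> x - \<i> * \<tau> (star x) + sq_norm2 x = sq_norm2 (1 + scaleC \<i> x)"
    by (simp add: tau_star_self)
  then have "Im (\<i> * \<tau> x - \<i> * \<tau> (star x)) = 0" by (simp add: complex_eq_iff)
  with 1 show ?thesis by (simp add: complex_eq_iff)
qed

lemma Cauchy_Schwarz: "(cmod (\<tau> (star y * x)))\<^sup>2 \<le> sq_norm2 x * sq_norm2 y"
proof (rule Cauchy_Schwarz_abstract)
  fix c
  define s where "s = \<tau> (star y * x)"
  have s': "\<tau> (star x * y) = cnj s"
    using star_cnj[of "star y * x"] by (simp add: s_def star_mult star_star)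
  have "\<tau> (star (x - scaleC c y) * (x - scaleC c y))
     = \<tau> (star x * x) - cnj c * \<tau> (star y * x) - c * \<tau> (star x * y) + cnj c * c * \<tau> (star y * y)"
    by (simp add: star_diff star_scaleC algebra_simps linear mult_scaleC
        scaleC_scaleC)
  then have "complex_of_real (sq_norm2 (x - scaleC c y)) = sq_norm2 x - cnj c * s - c * cnj s + cnj c * c * sq_norm2 y"
    by (simp add: tau_star_self s' s_def)
  then have "sq_norm2 (x - scaleC c y) = sq_norm2 x - 2 * Re (cnj c * s) + (cmod c)\<^sup>2 * sq_norm2 y"
    unfolding cmod_power2 by (simp add: complex_eq_iff power2_eq_square algebra_simps)
  then show "0 \<le> sq_norm2 x - 2 * Re (cnj c * s) + (cmod c)\<^sup>2 * sq_norm2 y"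
    by (metis sq_norm2_nonneg)
qed (auto simp: sq_norm2_nonneg)

text \<open>
  \<open>1 - x\<close> is a square of a self-adjoint element, so \<open>\<tau> (1 - x)\<close> is nonnegative.
\<close>

lemma tau_le_of_selfadjoint:
  assumes "star x = x" "norm x < 1"
  shows "Re (\<tau> x) \<le> 1"
proof -
  obtain y where "star y = y" "y * y = 1 - x" using selfadjoint_square_root[OF assms] by blast
  then have "complex_of_real (sq_norm2 y) = 1 - \<tau> x"
    using tau_star_self[of y] by (simp add: diff)
  then have "Re (\<tau> x) = 1 - sq_norm2 y" by (simp add: complex_eq_iff)
  then show ?thesis using sq_norm2_nonneg[of y] by simp
qed

text \<open>
  A state is contractive: by Cauchy-Schwarz \<open>\<bar>\<tau> x\<bar>\<^sup>2 \<le> \<tau> (star x * x)\<close>, and the self-adjoint element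
  \<open>star x * x\<close> has norm \<open>\<parallel>x\<parallel>\<^sup>2\<close>. Scaling reduces to \<open>\<parallel>x\<parallel> < 1\<close>.
\<close>

lemma norm_le: "cmod (\<tau> x) \<le> norm x"
proof (rule field_le_epsilon)
  fix e :: real assume e: "0 < e"
  define k where "k = norm x + e"
  have k: "k > 0" "norm x < k" using e norm_ge_zero[of x] unfolding k_def by linarith+
  define y where "y = scaleC (1 / k) x"
  have ny: "norm y < 1" using k by (simp add: y_def norm_scaleC norm_divide)
  have "Re (\<tau> (star y * y)) \<le> 1"
  proof (rule tau_le_of_selfadjoint)
    show "norm (star y * y) < 1"
      using ny by (simp add: cstar_identity power_less_one_iff)
  qed (simp add: star_mult star_star)
  then have "sq_norm2 y \<le> 1" by (simp add: sq_norm2_def)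
  moreover have "(cmod (\<tau> y))\<^sup>2 \<le> sq_norm2 y"
    using Cauchy_Schwarz[of 1 y] by (simp add: sq_norm2_def)
  ultimately have "(cmod (\<tau> y))\<^sup>2 \<le> 1\<^sup>2" by simp
  then have "cmod (\<tau> y) \<le> 1" by (rule power2_le_imp_le) simp
  then have "cmod (\<tau> x) \<le> k"
    using k by (simp add: y_def scale norm_mult norm_divide field_simps)
  then show "cmod (\<tau> x) \<le> norm x + e" by (simp add: k_def)
qed

lemma bounded_linear_tau: "bounded_linear \<tau>"
  by (rule bounded_linear_intro[of _ 1])
    (auto simp: add norm_le scaleR_scaleC[where 'a='a] scale scaleR_conv_of_real)

lemmas tendsto_tau = bounded_linear.tendsto[OF bounded_linear_tau]

end

subsection \<open>Freeness of the closed subalgebras\<close>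

lemma star_subalgebra_hull: "star_subalgebra (star_subalgebra hull S)"
  by (rule hull_in) (auto simp: star_subalgebra_def)

lemma star_subalgebraD:
  assumes "star_subalgebra (A :: 'a::cstar_algebra set)"
  shows "1 \<in> A" and "x \<in> A \<Longrightarrow> y \<in> A \<Longrightarrow> x + y \<in> A" and "x \<in> A \<Longrightarrow> y \<in> A \<Longrightarrow> x * y \<in> A"
    and "x \<in> A \<Longrightarrow> scaleC c x \<in> A" and "x \<in> A \<Longrightarrow> star x \<in> A"
  using assms unfolding star_subalgebra_def by blast+

lemma star_subalgebra_diff:
  assumes "star_subalgebra (A :: 'a::cstar_algebra set)" "x \<in> A" "y \<in> A"
  shows "x - y \<in> A"
  using star_subalgebraD(2)[OF assms(1,2) star_subalgebraD(4)[OF assms(1,3), of "-1"]]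
  by (simp add: scaleC_minus_left)

lemma star_subalgebra_const:
  "star_subalgebra (A :: 'a::cstar_algebra set) \<Longrightarrow> scaleC c 1 \<in> A"
  by (intro star_subalgebraD)

lemma star_subalgebra_power:
  assumes "star_subalgebra (A :: 'a::cstar_algebra set)" "x \<in> A"
  shows "x ^ n \<in> A"
  by (induction n) (simp_all add: star_subalgebraD[OF assms(1)] assms(2))

lemma star_subalgebra_sum_lessThan:
  assumes "star_subalgebra (A :: 'a::cstar_algebra set)" "\<And>i. f i \<in> A"
  shows "(\<Sum>i<(n::nat). f i) \<in> A"
  using star_subalgebra_const[OF assms(1), of 0]
  by (induction n) (simp_all add: star_subalgebraD(2)[OF assms(1)] assms(2))

lemma closure_limitI: "(\<And>n. f n \<in> A) \<Longrightarrow> f \<longlonglongrightarrow> x \<Longrightarrow> x \<in> closure A"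
  for x :: "'a::metric_space"
  unfolding closure_sequential by blast

lemma closure_limitD: "x \<in> closure A \<Longrightarrow> \<exists>f. (\<forall>n. f n \<in> A) \<and> f \<longlonglongrightarrow> x"
  for x :: "'a::metric_space"
  unfolding closure_sequential .

lemma star_subalgebra_closure:
  assumes A: "star_subalgebra (A :: 'a::cstar_algebra set)"
  shows "star_subalgebra (closure A)"
  unfolding star_subalgebra_def
proof (intro conjI ballI allI)
  fix x y assume x: "x \<in> closure A" and y: "y \<in> closure A"
  obtain f where "\<forall>n. f n \<in> A" and f2: "f \<longlonglongrightarrow> x"
    using closure_limitD[OF x] by (elim exE conjE)
  then have f: "f n \<in> A" for n by simp
  obtain g where "\<forall>n. g n \<in> A" and g2: "g \<longlonglongrightarrow> y"
    using closure_limitD[OF y] by (elim exE conjE)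
  then have g: "g n \<in> A" for n by simp
  show "x + y \<in> closure A"
    by (rule closure_limitI[OF star_subalgebraD(2)[OF A f g] tendsto_add[OF f2 g2]])
  show "x * y \<in> closure A"
    by (rule closure_limitI[OF star_subalgebraD(3)[OF A f g] tendsto_mult[OF f2 g2]])
next
  fix x c assume x: "x \<in> closure A"
  obtain f where "\<forall>n. f n \<in> A" and f2: "f \<longlonglongrightarrow> x"
    using closure_limitD[OF x] by (elim exE conjE)
  then have f: "f n \<in> A" for n by simp
  show "scaleC c x \<in> closure A"
    by (rule closure_limitI[OF star_subalgebraD(4)[OF A f]
          bounded_linear.tendsto[OF bounded_linear_scaleC f2]])
  show "star x \<in> closure A"
    by (rule closure_limitI[OF star_subalgebraD(5)[OF A f]
          bounded_linear.tendsto[OF bounded_linear_star f2]])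
next
  show "1 \<in> closure A"
    using star_subalgebraD(1)[OF A] closure_subset by blast
qed

lemma resolvent_in_closure:
  assumes A: "star_subalgebra (A :: 'a::cstar_algebra set)" and "x \<in> A" "norm x < 1"
  shows "resolvent x \<in> closure A"
proof -
  have "(\<lambda>n. \<Sum>k<n. x ^ k) \<longlonglongrightarrow> resolvent x"
    using sums_resolvent[OF assms(3)] by (simp add: sums_def)
  moreover have "(\<Sum>k<n. x ^ k) \<in> A" for n
    by (intro star_subalgebra_sum_lessThan star_subalgebra_power assms)
  ultimately show ?thesis by (rule closure_limitI[rotated])
qed

lemma tendsto_prod_list:
  fixes f :: "'b \<Rightarrow> 'c \<Rightarrow> 'a::cstar_algebra"
  assumes "\<And>x. x \<in> set xs \<Longrightarrow> (f x \<longlongrightarrow> l x) F"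
  shows "((\<lambda>n. prod_list (map (\<lambda>x. f x n) xs)) \<longlongrightarrow> prod_list (map l xs)) F"
  using assms by (induction xs) (simp_all add: tendsto_mult)

text \<open>
  Freeness is a statement about finite products, hence survives norm limits: a centred limit is the
  limit of the centred elements \<open>g n - \<tau> (g n)\<close>. The closure is needed because resolvents lie in the
  closed but not in the algebraic *-subalgebra generated by a unitary.
\<close>

lemma (in tracial_state) free_subalgebras_closure:
  assumes free: "free_subalgebras \<tau> A" and A: "\<And>i. star_subalgebra (A i)"
  shows "free_subalgebras \<tau> (\<lambda>i. closure (A i))"
  unfolding free_subalgebras_def
proof (intro allI impI)
  fix ps :: "('b \<times> 'a) list"
  assume ne: "ps \<noteq> []" and ps: "\<forall>(i, x)\<in>set ps. x \<in> closure (A i) \<and> \<tau> x = 0"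
    and alt: "successively (\<lambda>p q. fst p \<noteq> fst q) ps"

  have "\<exists>f. (\<forall>n. f n \<in> A (fst p) \<and> \<tau> (f n) = 0) \<and> f \<longlonglongrightarrow> snd p" if "p \<in> set ps" for p
  proof -
    have cl: "snd p \<in> closure (A (fst p))" and t0: "\<tau> (snd p) = 0" using ps that by auto
    obtain g where g0: "\<forall>n. g n \<in> A (fst p)" and g2: "g \<longlonglongrightarrow> snd p"
      using closure_limitD[OF cl] by (elim exE conjE)
    from g0 have g: "g n \<in> A (fst p)" for n by simp
    have "(\<lambda>n. scaleC (\<tau> (g n)) 1) \<longlonglongrightarrow> (0 :: 'a)"
    proof (rule Lim_null_comparison)
      show "(\<lambda>n. cmod (\<tau> (g n))) \<longlonglongrightarrow> 0"
        using tendsto_norm[OF tendsto_tau[OF g2]] t0 by simp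
    qed (simp add: norm_scaleC)
    then have "(\<lambda>n. g n - scaleC (\<tau> (g n)) 1) \<longlonglongrightarrow> snd p"
      using tendsto_diff[OF g2, of "\<lambda>n. scaleC (\<tau> (g n)) 1" 0] by simp
    moreover have "g n - scaleC (\<tau> (g n)) 1 \<in> A (fst p)" for n
      by (intro star_subalgebra_diff star_subalgebra_const A g)
    moreover have "\<tau> (g n - scaleC (\<tau> (g n)) 1) = 0" for n by (simp add: linear)
    ultimately show ?thesis by (intro exI[of _ "\<lambda>n. g n - scaleC (\<tau> (g n)) 1"] conjI allI)
  qed
  then have "\<forall>p\<in>set ps. \<exists>f. (\<forall>n. f n \<in> A (fst p) \<and> \<tau> (f n) = 0) \<and> f \<longlonglongrightarrow> snd p"
    by blast
  from bchoice[OF this] obtain f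
    where f: "\<forall>p\<in>set ps. (\<forall>n. f p n \<in> A (fst p) \<and> \<tau> (f p n) = 0) \<and> f p \<longlonglongrightarrow> snd p"
    by (elim exE)
  have "\<tau> (prod_list (map (\<lambda>p. f p n) ps)) = 0" for n
  proof -
    let ?qs = "map (\<lambda>p. (fst p, f p n)) ps"
    have "successively (\<lambda>p q. fst p \<noteq> fst q) ?qs" using alt by (simp add: successively_map)
    moreover have "\<forall>(i, x)\<in>set ?qs. x \<in> A i \<and> \<tau> x = 0" using f by auto
    ultimately have "\<tau> (prod_list (map snd ?qs)) = 0"
      using free[unfolded free_subalgebras_def, THEN spec, of ?qs] ne by simp
    then show ?thesis by (simp add: o_def)
  qed
  moreover have "(\<lambda>n. \<tau> (prod_list (map (\<lambda>p. f p n) ps))) \<longlonglongrightarrow> \<tau> (prod_list (map snd ps))"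
    using f by (intro tendsto_tau tendsto_prod_list) auto
  ultimately show "\<tau> (prod_list (map snd ps)) = 0"
    by (simp add: LIMSEQ_const_iff)
qed

section \<open>Transforms of measures on the circle\<close>

text \<open>
  On the disc this is \<open>1 + \<psi>\<^sub>\<nu>\<close>, the Cauchy transform at \<open>1/w\<close> up to a factor \<open>1/w\<close>.
\<close>

definition cauchy_int :: "complex measure \<Rightarrow> complex \<Rightarrow> complex" where
  "cauchy_int \<nu> w = (LINT t|\<nu>. 1 / (1 - w * t))"

definition shifted_int :: "complex measure \<Rightarrow> complex \<Rightarrow> complex" where
  "shifted_int \<nu> w = (LINT t|\<nu>. t / (1 - w * t))"

text \<open>
  The function \<open>\<eta>\<^sub>\<nu>(w) / w\<close>, written so that it also has the correct value at \<open>w = 0\<close>.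
\<close>

definition eta_quot :: "complex measure \<Rightarrow> complex \<Rightarrow> complex" where
  "eta_quot \<nu> w = shifted_int \<nu> w / cauchy_int \<nu> w"

definition cauchy_sq :: "complex measure \<Rightarrow> complex \<Rightarrow> real" where
  "cauchy_sq \<nu> w = (LINT t|\<nu>. 1 / (cmod (1 - w * t))\<^sup>2)"

text \<open>
  With the pseudohyperbolic distance \<open>\<rho>\<close> this is \<open>1 / (1 - \<rho>(a, b)\<^sup>2)\<close>, an increasing function of the
  hyperbolic distance. The form without \<open>\<rho>\<close> is the one that Cauchy-Schwarz produces.
\<close>

definition hyp_gauge :: "complex \<Rightarrow> complex \<Rightarrow> real" where
  "hyp_gauge a b = (cmod (1 - a * cnj b))\<^sup>2 / ((1 - (cmod a)\<^sup>2) * (1 - (cmod b)\<^sup>2))"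

lemma cmod_diff_kernel:
  "(cmod (1 - a * cnj b))\<^sup>2 = (cmod (a - b))\<^sup>2 + (1 - (cmod a)\<^sup>2) * (1 - (cmod b)\<^sup>2)"
  unfolding cmod_power2 by (simp add: power2_eq_square algebra_simps)

lemma one_minus_sq_pos: "cmod a < 1 \<Longrightarrow> 0 < 1 - (cmod a)\<^sup>2"
  by (simp add: power_less_one_iff)

lemma one_minus_mult_nonzero: "cmod w < 1 \<Longrightarrow> cmod t = 1 \<Longrightarrow> 1 - w * t \<noteq> 0"
  by (metis eq_iff_diff_eq_0 less_irrefl mult.right_neutral norm_mult norm_one)

text \<open>
  Multiplication \<open>(z, h) \<mapsto> z h\<close> from the bidisc to the disc contracts hyperbolic distances, strictly
  when the first factors are the closer ones. The reason is the splitting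
  \<open>1 - z h cnj (z' h') = (1 - z cnj z') + z cnj z' (1 - h cnj h')\<close>, which Cauchy-Schwarz in the plane
  compares with \<open>1 - \<bar>z h\<bar>\<^sup>2 = (1 - \<bar>z\<bar>\<^sup>2) + \<bar>z\<bar>\<^sup>2 (1 - \<bar>h\<bar>\<^sup>2)\<close>.
\<close>

lemma hyp_gauge_mult_less:
  assumes z: "cmod z < 1" "cmod z' < 1" and h: "cmod h < 1" "cmod h' < 1"
    and m: "hyp_gauge z z' < m" "hyp_gauge h h' \<le> m"
  shows "hyp_gauge (z * h) (z' * h') < m"
proof -
  define a a' c c' where "a = 1 - (cmod z)\<^sup>2" and "a' = 1 - (cmod z')\<^sup>2"
    and "c = (cmod z)\<^sup>2 * (1 - (cmod h)\<^sup>2)" and "c' = (cmod z')\<^sup>2 * (1 - (cmod h')\<^sup>2)"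
  have a: "a > 0" "a' > 0" using one_minus_sq_pos[OF z(1)] one_minus_sq_pos[OF z(2)] by (simp_all add: a_def a'_def)
  have hp: "1 - (cmod h)\<^sup>2 > 0" "1 - (cmod h')\<^sup>2 > 0"
    using one_minus_sq_pos[OF h(1)] one_minus_sq_pos[OF h(2)] by simp_all
  have c: "c \<ge> 0" "c' \<ge> 0" using hp by (auto simp: c_def c'_def)
  have m0: "m > 0" using m(1) a unfolding hyp_gauge_def a_def a'_def
    by (smt (verit) divide_nonneg_pos mult_pos_pos zero_le_power2)
  have "(cmod (1 - z * cnj z'))\<^sup>2 < m * (a * a')"
    using m(1) a by (simp add: hyp_gauge_def a_def a'_def pos_divide_less_eq)
  then have 1: "cmod (1 - z * cnj z') < sqrt m * sqrt (a * a')"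
    by (simp add: real_less_rsqrt flip: real_sqrt_mult)
  have "(cmod (1 - h * cnj h'))\<^sup>2 \<le> m * ((1 - (cmod h)\<^sup>2) * (1 - (cmod h')\<^sup>2))"
    using m(2) hp by (simp add: hyp_gauge_def pos_divide_le_eq)
  from mult_left_mono[OF this, of "(cmod z * cmod z')\<^sup>2"]
  have "(cmod z * cmod z' * cmod (1 - h * cnj h'))\<^sup>2 \<le> m * (c * c')"
    by (simp add: c_def c'_def power_mult_distrib algebra_simps)
  then have 2: "cmod z * cmod z' * cmod (1 - h * cnj h') \<le> sqrt m * sqrt (c * c')"
    by (simp add: real_le_rsqrt flip: real_sqrt_mult)
  have "1 - z * h * cnj (z' * h') = (1 - z * cnj z') + z * cnj z' * (1 - h * cnj h')"
    by (simp add: algebra_simps)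
  then have "cmod (1 - z * h * cnj (z' * h'))
      \<le> cmod (1 - z * cnj z') + cmod (z * cnj z' * (1 - h * cnj h'))"
    by (simp only: norm_triangle_ineq)
  also have "cmod (z * cnj z' * (1 - h * cnj h')) = cmod z * cmod z' * cmod (1 - h * cnj h')"
    by (simp add: norm_mult)
  finally have 3: "cmod (1 - z * h * cnj (z' * h')) < sqrt m * (sqrt (a * a') + sqrt (c * c'))"
    using 1 2 by (simp add: algebra_simps)
  have "(sqrt (a * a') + sqrt (c * c'))\<^sup>2 \<le> (a + c) * (a' + c')"
  proof -
    have "sqrt (a * a') * sqrt (c * c') = sqrt (a * c') * sqrt (c * a')"
      by (simp add: real_sqrt_mult)
    then have "(sqrt (a * a') + sqrt (c * c'))\<^sup>2 = a * a' + c * c' + 2 * (sqrt (a * c') * sqrt (c * a'))"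
      using a c by (simp add: power2_sum mult.assoc)
    also have "2 * (sqrt (a * c') * sqrt (c * a')) \<le> a * c' + c * a'"
      using sum_squares_bound[of "sqrt (a * c')" "sqrt (c * a')"] a c by simp
    finally show ?thesis by (simp add: algebra_simps)
  qed
  moreover have "(cmod (1 - z * h * cnj (z' * h')))\<^sup>2 < (sqrt m * (sqrt (a * a') + sqrt (c * c')))\<^sup>2"
    by (rule power_strict_mono[OF 3]) auto
  ultimately have "(cmod (1 - z * h * cnj (z' * h')))\<^sup>2 < m * ((a + c) * (a' + c'))"
    using m0 by (simp add: power_mult_distrib) (smt (verit) mult_left_mono)
  moreover have "a + c = 1 - (cmod (z * h))\<^sup>2" "a' + c' = 1 - (cmod (z' * h'))\<^sup>2"
    by (simp_all add: a_def c_def a'_def c'_def norm_mult power_mult_distrib algebra_simps)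
  moreover have "a + c > 0" "a' + c' > 0" using a c by linarith+
  ultimately show ?thesis by (simp add: hyp_gauge_def pos_divide_less_eq)
qed

locale circle_measure =
  fixes \<nu> :: "complex measure"
  assumes circle: "circle_prob \<nu>"
begin

sublocale prob_space \<nu>
  using circle by (simp add: circle_prob_def)

lemma sets_nu: "sets \<nu> = sets (restrict_space borel circle)"
  using circle by (simp add: circle_prob_def)

lemma space_nu [simp]: "space \<nu> = circle"
  using sets_eq_imp_space_eq[OF sets_nu] by (simp add: space_restrict_space)

lemma borel_Int_sets: "A \<in> sets borel \<Longrightarrow> A \<inter> circle \<in> sets \<nu>"
  by (auto simp: sets_nu sets_restrict_space)

lemma closed_sets: "closed A \<Longrightarrow> A \<subseteq> circle \<Longrightarrow> A \<in> sets \<nu>"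
  using borel_Int_sets[of A] by (simp add: Int_absorb2)

lemma measurable_nu: "continuous_on circle f \<Longrightarrow> f \<in> borel_measurable \<nu>"
  for f :: "complex \<Rightarrow> 'b::{banach, second_countable_topology}"
  using borel_measurable_continuous_on_restrict[of circle f]
  by (simp add: measurable_cong_sets[OF sets_nu refl])

lemma integrable_cont: 
  fixes f :: "complex \<Rightarrow> 'b::{banach, second_countable_topology}"
  assumes "continuous_on circle f"
  shows "integrable \<nu> f"
proof -
  have "compact (f ` circle)" using assms by (intro compact_continuous_image) auto
  then obtain B where "\<And>t. t \<in> circle \<Longrightarrow> norm (f t) \<le> B"
    by (metis bounded_iff compact_imp_bounded imageI)
  then show ?thesis
    using measurable_nu[OF assms] by (intro integrable_const_bound[of _ B]) (auto intro!: AE_I2)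
qed

lemma cont_denominators:
  assumes "cmod w < 1"
  shows "continuous_on circle (\<lambda>t. 1 / (1 - w * t))"
    "continuous_on circle (\<lambda>t. t / (1 - w * t))"
    "continuous_on circle (\<lambda>t. 1 / (cmod (1 - w * t))\<^sup>2)"
  using one_minus_mult_nonzero[OF assms] by (auto intro!: continuous_intros)

lemma cauchy_int_shifted_int:
  assumes "cmod w < 1"
  shows "cauchy_int \<nu> w = 1 + w * shifted_int \<nu> w"
proof -
  have "cauchy_int \<nu> w = (LINT t|\<nu>. 1 + w * (t / (1 - w * t)))"
    unfolding cauchy_int_def
  proof (rule Bochner_Integration.integral_cong)
    fix t assume "t \<in> space \<nu>"
    then have "1 - w * t \<noteq> 0" using one_minus_mult_nonzero[OF assms] by auto
    then show "1 / (1 - w * t) = 1 + w * (t / (1 - w * t))" by (simp add: field_simps)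
  qed auto
  also have "\<dots> = 1 + w * shifted_int \<nu> w"
    using integrable_cont[OF cont_denominators(2)[OF assms]] prob_space
    by (simp add: shifted_int_def del: times_divide_eq_right)
  finally show ?thesis .
qed

text \<open>
  Here \<open>x\<close> and \<open>y\<close> are the inverses of \<open>1 - w t\<close> and \<open>1 - v s\<close>, and \<open>s\<close> is the conjugate of the point \<open>t\<close>
  of the circle. The right-hand side is affine in functions whose integrals are known.
\<close>

lemma kernel_pointwise:
  fixes w v t s :: complex
  assumes "x * (1 - w * t) = 1" "y * (1 - v * s) = 1" "t * s = 1"
  shows "(1 - w * v) * (((t - h) * x) * ((s - k) * y))
    = (1 + h * k) * (x + y - 1) - k * (t * x + v * y) - h * (s * y + w * x)"
  using assms by algebra

text \<open>
  The Poisson kernel: \<open>(1 - \<bar>w\<bar>\<^sup>2) / \<bar>1 - w t\<bar>\<^sup>2 = 2 Re (1 / (1 - w t)) - 1\<close> on the circle.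
\<close>

lemma cauchy_sq_cauchy_int:
  assumes "cmod w < 1"
  shows "(1 - (cmod w)\<^sup>2) * cauchy_sq \<nu> w = 2 * Re (cauchy_int \<nu> w) - 1"
proof -
  have "(1 - (cmod w)\<^sup>2) * cauchy_sq \<nu> w = (LINT t|\<nu>. (1 - (cmod w)\<^sup>2) * (1 / (cmod (1 - w * t))\<^sup>2))"
    by (simp add: cauchy_sq_def del: times_divide_eq_right)
  also have "\<dots> = (LINT t|\<nu>. 2 * Re (1 / (1 - w * t)) - 1)"
  proof (rule Bochner_Integration.integral_cong)
    fix t assume "t \<in> space \<nu>"
    then have t: "cmod t = 1" by simp
    define x where "x = 1 / (1 - w * t)"
    have nz: "1 - w * t \<noteq> 0" using one_minus_mult_nonzero[OF assms t] .
    have x1: "x * (1 - w * t) = 1" using nz by (simp add: x_def)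
    from arg_cong[OF this, of cnj] have x2: "cnj x * (1 - cnj w * cnj t) = 1" by simp
    have ts: "t * cnj t = 1" using t by (simp flip: complex_norm_square)
    have "(1 - w * cnj w) * (x * cnj x) = x + cnj x - 1"
      using x1 x2 ts by algebra
    then have "complex_of_real ((1 - (cmod w)\<^sup>2) * (cmod x)\<^sup>2) = x + cnj x - 1"
      by (simp flip: complex_norm_square)
    then have "(1 - (cmod w)\<^sup>2) * (cmod x)\<^sup>2 = 2 * Re x - 1"
      by (simp add: complex_eq_iff complex_add_cnj)
    then show "(1 - (cmod w)\<^sup>2) * (1 / (cmod (1 - w * t))\<^sup>2) = 2 * Re (1 / (1 - w * t)) - 1"
      by (simp add: x_def norm_divide power_divide)
  qed auto
  also have "\<dots> = 2 * Re (cauchy_int \<nu> w) - 1"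
    using integrable_cont[OF cont_denominators(1)[OF assms]] prob_space
    by (simp add: cauchy_int_def)
  finally show ?thesis .
qed

lemma cauchy_sq_nonneg: "0 \<le> cauchy_sq \<nu> w"
  unfolding cauchy_sq_def by (rule Bochner_Integration.integral_nonneg) simp

lemma Re_cauchy_int: 
  assumes "cmod w < 1"
  shows "1/2 \<le> Re (cauchy_int \<nu> w)" "cauchy_int \<nu> w \<noteq> 0" "1/2 \<le> cmod (cauchy_int \<nu> w)"
proof -
  have "0 \<le> (1 - (cmod w)\<^sup>2) * cauchy_sq \<nu> w"
    using cauchy_sq_nonneg one_minus_sq_pos[OF assms] by (intro mult_nonneg_nonneg) auto
  then show 1: "1/2 \<le> Re (cauchy_int \<nu> w)" using cauchy_sq_cauchy_int[OF assms] by simp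
  then show "cauchy_int \<nu> w \<noteq> 0" by auto
  show "1/2 \<le> cmod (cauchy_int \<nu> w)" using 1 complex_Re_le_cmod[of "cauchy_int \<nu> w"] by linarith
qed

lemma cauchy_int_eta_quot:
  assumes "cmod w < 1"
  shows "shifted_int \<nu> w = eta_quot \<nu> w * cauchy_int \<nu> w" "cauchy_int \<nu> w * (1 - w * eta_quot \<nu> w) = 1"
  using cauchy_int_shifted_int[OF assms] Re_cauchy_int[OF assms] by (auto simp: eta_quot_def field_simps)

lemma eta_eq:
  assumes "cmod w < 1"
  shows "eta_transform \<nu> w = w * eta_quot \<nu> w" "eta_transform \<nu> w = 1 - 1 / cauchy_int \<nu> w"
proof -
  have "psi_transform \<nu> w = (LINT t|\<nu>. w * (t / (1 - w * t)))"
    unfolding psi_transform_def by (simp add: mult_ac)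
  also have "\<dots> = w * shifted_int \<nu> w" by (simp add: shifted_int_def del: times_divide_eq_right)
  finally have "psi_transform \<nu> w = w * shifted_int \<nu> w" .
  then show "eta_transform \<nu> w = w * eta_quot \<nu> w" "eta_transform \<nu> w = 1 - 1 / cauchy_int \<nu> w"
    using cauchy_int_shifted_int[OF assms] Re_cauchy_int[OF assms]
    by (auto simp: eta_transform_def eta_quot_def field_simps)
qed

text \<open>
  A function of mean zero; integrating products of two such functions yields the Pick kernel of
  \<open>eta_quot \<nu>\<close>.
\<close>

definition centred_kernel :: "complex \<Rightarrow> complex \<Rightarrow> complex" where
  "centred_kernel w t = (t - eta_quot \<nu> w) / (1 - w * t)"

lemma cont_centred_kernel: "cmod w < 1 \<Longrightarrow> continuous_on circle (centred_kernel w)"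
  unfolding centred_kernel_def using one_minus_mult_nonzero by (auto intro!: continuous_intros)

text \<open>
  The quotient of \<open>1 - h(w) cnj (h(v))\<close> by \<open>1 - w cnj v\<close> is an inner product, that is, a positive kernel.
  Its positivity is behind all estimates of \<open>eta_quot \<nu>\<close> below.
\<close>

lemma kernel_integral:
  assumes w: "cmod w < 1" and v: "cmod v < 1"
  shows "(1 - w * cnj v) * (LINT t|\<nu>. centred_kernel w t * cnj (centred_kernel v t)) = 1 - eta_quot \<nu> w * cnj (eta_quot \<nu> v)"
proof -
  define h k where "h = eta_quot \<nu> w" and "k = cnj (eta_quot \<nu> v)"
  define x y where "x = (\<lambda>t. 1 / (1 - w * t))" and "y = (\<lambda>t. 1 / (1 - v * t))"
  define x' y' where "x' = (\<lambda>t. t / (1 - w * t))" and "y' = (\<lambda>t. t / (1 - v * t))"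
  have int: "integrable \<nu> x" "integrable \<nu> x'" "integrable \<nu> y" "integrable \<nu> y'"
    using integrable_cont cont_denominators w v by (auto simp: x_def y_def x'_def y'_def)
  have "(1 - w * cnj v) * (LINT t|\<nu>. centred_kernel w t * cnj (centred_kernel v t))
     = (LINT t|\<nu>. (1 - w * cnj v) * (centred_kernel w t * cnj (centred_kernel v t)))"
    by simp
  also have "\<dots> = (LINT t|\<nu>. (1 + h * k) * (x t + cnj (y t) - 1) - k * (x' t + cnj v * cnj (y t))
      - h * (cnj (y' t) + w * x t))"
  proof (rule Bochner_Integration.integral_cong)
    fix t assume "t \<in> space \<nu>"
    then have t: "cmod t = 1" by simp
    have "x t * (1 - w * t) = 1" using one_minus_mult_nonzero[OF w t] by (simp add: x_def)
    moreover have "y t * (1 - v * t) = 1" using one_minus_mult_nonzero[OF v t] by (simp add: y_def)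
    then have "cnj (y t) * (1 - cnj v * cnj t) = 1" by (metis complex_cnj_diff complex_cnj_mult complex_cnj_one)
    moreover have "t * cnj t = 1" using t by (simp flip: complex_norm_square)
    ultimately have "(1 - w * cnj v) * (((t - h) * x t) * ((cnj t - k) * cnj (y t)))
      = (1 + h * k) * (x t + cnj (y t) - 1) - k * (t * x t + cnj v * cnj (y t))
        - h * (cnj t * cnj (y t) + w * x t)"
      by (rule kernel_pointwise)
    moreover have "centred_kernel w t = (t - h) * x t" "cnj (centred_kernel v t) = (cnj t - k) * cnj (y t)"
      "x' t = t * x t" "y' t = t * y t"
      by (simp_all add: centred_kernel_def h_def k_def x_def y_def x'_def y'_def)
    ultimately show "(1 - w * cnj v) * (centred_kernel w t * cnj (centred_kernel v t))
      = (1 + h * k) * (x t + cnj (y t) - 1) - k * (x' t + cnj v * cnj (y t))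
        - h * (cnj (y' t) + w * x t)"
      by simp
  qed auto
  also have "\<dots> = (1 + h * k) * (cauchy_int \<nu> w + cnj (cauchy_int \<nu> v) - 1) - k * (shifted_int \<nu> w + cnj v * cnj (cauchy_int \<nu> v))
      - h * (cnj (shifted_int \<nu> v) + w * cauchy_int \<nu> w)"
  proof -
    have "(LINT t|\<nu>. x t) = cauchy_int \<nu> w" "(LINT t|\<nu>. cnj (y t)) = cnj (cauchy_int \<nu> v)"
      "(LINT t|\<nu>. x' t) = shifted_int \<nu> w" "(LINT t|\<nu>. cnj (y' t)) = cnj (shifted_int \<nu> v)"
      by (simp_all only: cauchy_int_def shifted_int_def x_def y_def x'_def y'_def Bochner_Integration.integral_cnj)
    then show ?thesis using int prob_space by simp
  qed
  also have "\<dots> = 1 - h * k"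
  proof -
    have 1: "shifted_int \<nu> w = h * cauchy_int \<nu> w" "cauchy_int \<nu> w * (1 - w * h) = 1"
      using cauchy_int_eta_quot[OF w] by (auto simp: h_def)
    have 2: "cnj (shifted_int \<nu> v) = k * cnj (cauchy_int \<nu> v)" "cnj (cauchy_int \<nu> v) * (1 - cnj v * k) = 1"
      using cauchy_int_eta_quot[OF v] by (auto simp: k_def) (metis complex_cnj_diff complex_cnj_mult complex_cnj_one)
    show ?thesis using 1 2 by algebra
  qed
  finally show ?thesis by (simp add: h_def k_def)
qed

lemma Cauchy_Schwarz_integral:
  fixes f g :: "complex \<Rightarrow> complex"
  assumes "integrable \<nu> (\<lambda>t. f t * cnj (g t))"
    and "integrable \<nu> (\<lambda>t. (cmod (f t))\<^sup>2)" and "integrable \<nu> (\<lambda>t. (cmod (g t))\<^sup>2)"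
  shows "(cmod (LINT t|\<nu>. f t * cnj (g t)))\<^sup>2 \<le> (LINT t|\<nu>. (cmod (f t))\<^sup>2) * (LINT t|\<nu>. (cmod (g t))\<^sup>2)"
proof (rule Cauchy_Schwarz_abstract)
  fix c
  define R where "R = (\<lambda>t. Re (cnj c * (f t * cnj (g t))))"
  have "0 \<le> (LINT t|\<nu>. (cmod (f t))\<^sup>2 - 2 * R t + (cmod c)\<^sup>2 * (cmod (g t))\<^sup>2)"
  proof (rule Bochner_Integration.integral_nonneg)
    fix t
    have "(cmod (f t))\<^sup>2 - 2 * Re (cnj c * (f t * cnj (g t))) + (cmod c)\<^sup>2 * (cmod (g t))\<^sup>2
       = (cmod (f t - c * g t))\<^sup>2"
      unfolding cmod_power2 by (simp add: power2_eq_square algebra_simps)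
    then show "0 \<le> (cmod (f t))\<^sup>2 - 2 * R t + (cmod c)\<^sup>2 * (cmod (g t))\<^sup>2"
      unfolding R_def by (simp only: zero_le_power2)
  qed
  also have "\<dots> = (LINT t|\<nu>. (cmod (f t))\<^sup>2) - 2 * Re (cnj c * (LINT t|\<nu>. f t * cnj (g t)))
      + (cmod c)\<^sup>2 * (LINT t|\<nu>. (cmod (g t))\<^sup>2)"
  proof -
    have i: "integrable \<nu> (\<lambda>t. cnj c * (f t * cnj (g t)))" using assms(1) by simp
    have "(LINT t|\<nu>. R t) = Re (LINT t|\<nu>. cnj c * (f t * cnj (g t)))"
      unfolding R_def by (rule integral_Re[OF i])
    also have "\<dots> = Re (cnj c * (LINT t|\<nu>. f t * cnj (g t)))"
      by (simp only: integral_mult_right_zero)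
    finally have "(LINT t|\<nu>. R t) = Re (cnj c * (LINT t|\<nu>. f t * cnj (g t)))" .
    moreover have "integrable \<nu> R" unfolding R_def by (rule integrable_Re[OF i])
    ultimately show ?thesis using assms(2,3) by simp
  qed
  finally show "0 \<le> (LINT t|\<nu>. (cmod (f t))\<^sup>2) - 2 * Re (cnj c * (LINT t|\<nu>. f t * cnj (g t)))
      + (cmod c)\<^sup>2 * (LINT t|\<nu>. (cmod (g t))\<^sup>2)" .
qed (auto intro: Bochner_Integration.integral_nonneg)

lemma centred_kernel_sq:
  assumes w: "cmod w < 1"
  shows "(1 - (cmod w)\<^sup>2) * (LINT t|\<nu>. (cmod (centred_kernel w t))\<^sup>2) = 1 - (cmod (eta_quot \<nu> w))\<^sup>2"
proof -
  have "(LINT t|\<nu>. centred_kernel w t * cnj (centred_kernel w t)) = (LINT t|\<nu>. complex_of_real ((cmod (centred_kernel w t))\<^sup>2))"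
    by (simp only: complex_norm_square)
  also have "\<dots> = complex_of_real (LINT t|\<nu>. (cmod (centred_kernel w t))\<^sup>2)"
    by (rule integral_complex_of_real)
  finally have "complex_of_real ((1 - (cmod w)\<^sup>2) * (LINT t|\<nu>. (cmod (centred_kernel w t))\<^sup>2))
    = complex_of_real (1 - (cmod (eta_quot \<nu> w))\<^sup>2)"
    using kernel_integral[OF w w] by (simp flip: complex_norm_square)
  then show ?thesis by (simp only: of_real_eq_iff)
qed

lemma eta_quot_le_1: 
  assumes w: "cmod w < 1"
  shows "cmod (eta_quot \<nu> w) \<le> 1"
proof -
  have "0 \<le> (1 - (cmod w)\<^sup>2) * (LINT t|\<nu>. (cmod (centred_kernel w t))\<^sup>2)"
    using one_minus_sq_pos[OF w]
    by (intro mult_nonneg_nonneg Bochner_Integration.integral_nonneg) auto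
  then show ?thesis using centred_kernel_sq[OF w] by (simp add: abs_square_le_1)
qed

text \<open>
  Cauchy-Schwarz for the kernel of \<open>kernel_integral\<close>. For \<open>eta_quot \<nu>\<close> it is the
  Schwarz-Pick lemma of holomorphic functions.
\<close>

lemma Schwarz_Pick_eta_quot:
  assumes w: "cmod w < 1" and v: "cmod v < 1"
  shows "(cmod (1 - eta_quot \<nu> w * cnj (eta_quot \<nu> v)))\<^sup>2 * ((1 - (cmod w)\<^sup>2) * (1 - (cmod v)\<^sup>2))
    \<le> (cmod (1 - w * cnj v))\<^sup>2 * ((1 - (cmod (eta_quot \<nu> w))\<^sup>2) * (1 - (cmod (eta_quot \<nu> v))\<^sup>2))"
proof -
  let ?I = "LINT t|\<nu>. centred_kernel w t * cnj (centred_kernel v t)"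
  have "(cmod ?I)\<^sup>2 \<le> (LINT t|\<nu>. (cmod (centred_kernel w t))\<^sup>2) * (LINT t|\<nu>. (cmod (centred_kernel v t))\<^sup>2)"
    by (rule Cauchy_Schwarz_integral; rule integrable_cont)
      (auto intro!: continuous_intros cont_centred_kernel w v)
  from mult_right_mono[OF this, of "(1 - (cmod w)\<^sup>2) * (1 - (cmod v)\<^sup>2)"]
  have "(cmod ?I)\<^sup>2 * ((1 - (cmod w)\<^sup>2) * (1 - (cmod v)\<^sup>2)) 
    \<le> ((1 - (cmod w)\<^sup>2) * (LINT t|\<nu>. (cmod (centred_kernel w t))\<^sup>2)) * ((1 - (cmod v)\<^sup>2) * (LINT t|\<nu>. (cmod (centred_kernel v t))\<^sup>2))"
    using one_minus_sq_pos[OF w] one_minus_sq_pos[OF v] by (simp add: mult_ac)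
  also have "\<dots> = (1 - (cmod (eta_quot \<nu> w))\<^sup>2) * (1 - (cmod (eta_quot \<nu> v))\<^sup>2)"
    by (simp only: centred_kernel_sq w v)
  finally have 1: "(cmod ?I)\<^sup>2 * ((1 - (cmod w)\<^sup>2) * (1 - (cmod v)\<^sup>2))
    \<le> (1 - (cmod (eta_quot \<nu> w))\<^sup>2) * (1 - (cmod (eta_quot \<nu> v))\<^sup>2)" .
  have "(cmod (1 - eta_quot \<nu> w * cnj (eta_quot \<nu> v)))\<^sup>2 = (cmod (1 - w * cnj v))\<^sup>2 * (cmod ?I)\<^sup>2"
    by (simp flip: kernel_integral[OF w v] add: norm_mult power_mult_distrib)
  then show ?thesis
    using mult_left_mono[OF 1, of "(cmod (1 - w * cnj v))\<^sup>2"] by (simp add: mult_ac)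
qed

lemma eta_quot_Lipschitz:
  assumes w: "cmod w < 1" and v: "cmod v < 1"
  shows "(cmod (eta_quot \<nu> w - eta_quot \<nu> v))\<^sup>2 * ((1 - (cmod w)\<^sup>2) * (1 - (cmod v)\<^sup>2)) \<le> (cmod (w - v))\<^sup>2"
proof -
  define p q where "p = (1 - (cmod w)\<^sup>2) * (1 - (cmod v)\<^sup>2)"
    and "q = (1 - (cmod (eta_quot \<nu> w))\<^sup>2) * (1 - (cmod (eta_quot \<nu> v))\<^sup>2)"
  have h1: "(cmod (eta_quot \<nu> u))\<^sup>2 \<le> 1" if "cmod u < 1" for u
    using eta_quot_le_1[OF that] by (simp add: abs_square_le_1)
  have "q \<le> 1" unfolding q_def
    using h1[OF w] h1[OF v] by (intro mult_le_one) auto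
  moreover have "((cmod (eta_quot \<nu> w - eta_quot \<nu> v))\<^sup>2 + q) * p \<le> ((cmod (w - v))\<^sup>2 + p) * q"
    using Schwarz_Pick_eta_quot[OF w v] unfolding cmod_diff_kernel p_def q_def .
  ultimately have "(cmod (eta_quot \<nu> w - eta_quot \<nu> v))\<^sup>2 * p \<le> (cmod (w - v))\<^sup>2 * q"
    "(cmod (w - v))\<^sup>2 * q \<le> (cmod (w - v))\<^sup>2 * 1"
    using mult_left_mono[OF \<open>q \<le> 1\<close>, of "(cmod (w - v))\<^sup>2"] by (auto simp: algebra_simps)
  then show ?thesis unfolding p_def by linarith
qed

lemma continuous_eta_quot:
  assumes r: "r < 1"
  shows "continuous_on (cball 0 r) (eta_quot \<nu>)"
proof (cases "r < 0")
  case False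
  then have r0: "0 \<le> r" by simp
  have r2: "1 - r\<^sup>2 > 0" using r r0 by (simp add: power_less_one_iff)
  have "(1 / (1 - r\<^sup>2))-lipschitz_on (cball 0 r) (eta_quot \<nu>)"
  proof (rule lipschitz_onI)
    fix w v :: complex assume "w \<in> cball 0 r" "v \<in> cball 0 r"
    then have *: "cmod w \<le> r" "cmod v \<le> r" by auto
    then have lt: "cmod w < 1" "cmod v < 1" using r by linarith+
    have "1 - r\<^sup>2 \<le> 1 - (cmod w)\<^sup>2" "1 - r\<^sup>2 \<le> 1 - (cmod v)\<^sup>2"
      using * by (auto intro!: power_mono)
    then have "(1 - r\<^sup>2)\<^sup>2 \<le> (1 - (cmod w)\<^sup>2) * (1 - (cmod v)\<^sup>2)"
      unfolding power2_eq_square[of "1 - r\<^sup>2"] using r2 by (intro mult_mono) auto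
    then have "(cmod (eta_quot \<nu> w - eta_quot \<nu> v))\<^sup>2 * (1 - r\<^sup>2)\<^sup>2 \<le> (cmod (w - v))\<^sup>2"
      by (rule order_trans[OF mult_left_mono eta_quot_Lipschitz[OF lt]]) auto
    then have "(cmod (eta_quot \<nu> w - eta_quot \<nu> v) * (1 - r\<^sup>2))\<^sup>2 \<le> (cmod (w - v))\<^sup>2"
      by (simp add: power_mult_distrib)
    then have "cmod (eta_quot \<nu> w - eta_quot \<nu> v) * (1 - r\<^sup>2) \<le> cmod (w - v)"
      by (rule power2_le_imp_le) simp
    then show "dist (eta_quot \<nu> w) (eta_quot \<nu> v) \<le> 1 / (1 - r\<^sup>2) * dist w v"
      using r2 by (simp add: dist_norm field_simps)
  qed (use r2 in simp)
  then show ?thesis by (rule lipschitz_on_continuous_on)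
qed simp

text \<open>
  The difference of the integrands is \<open>(w - v) t / ((1 - w t) (1 - v t))\<close>.
\<close>

lemma cauchy_int_diff_le:
  assumes w: "cmod w < 1" and v: "cmod v < 1"
  shows "cmod (cauchy_int \<nu> w - cauchy_int \<nu> v) \<le> cmod (w - v) * ((cauchy_sq \<nu> w + cauchy_sq \<nu> v) / 2)"
proof -
  have "cauchy_int \<nu> w - cauchy_int \<nu> v = (LINT t|\<nu>. 1 / (1 - w * t) - 1 / (1 - v * t))"
    using integrable_cont[OF cont_denominators(1)] w v by (simp add: cauchy_int_def)
  also have "cmod \<dots> \<le> (LINT t|\<nu>. cmod (w - v) * ((1 / (cmod (1 - w * t))\<^sup>2 + 1 / (cmod (1 - v * t))\<^sup>2) / 2))"
  proof (rule Bochner_Integration.integral_norm_bound_integral)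
    fix t assume "t \<in> space \<nu>"
    then have t: "cmod t = 1" by simp
    define x y where "x = 1 / (1 - w * t)" and "y = 1 / (1 - v * t)"
    have "x - y = (w - v) * t * (x * y)"
      using one_minus_mult_nonzero[OF w t] one_minus_mult_nonzero[OF v t]
      by (simp add: x_def y_def field_simps)
    then have "cmod (x - y) = cmod (w - v) * (cmod x * cmod y)" using t by (simp add: norm_mult)
    also have "\<dots> \<le> cmod (w - v) * (((cmod x)\<^sup>2 + (cmod y)\<^sup>2) / 2)"
      using sum_squares_bound[of "cmod x" "cmod y"] by (intro mult_left_mono) auto
    finally show "cmod (1 / (1 - w * t) - 1 / (1 - v * t))
      \<le> cmod (w - v) * ((1 / (cmod (1 - w * t))\<^sup>2 + 1 / (cmod (1 - v * t))\<^sup>2) / 2)"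
      by (simp add: x_def y_def norm_divide power_divide)
  qed (use integrable_cont[OF cont_denominators(1)] integrable_cont[OF cont_denominators(3)] w v in auto)
  also have "\<dots> = cmod (w - v) * ((cauchy_sq \<nu> w + cauchy_sq \<nu> v) / 2)"
    using integrable_cont[OF cont_denominators(3)] w v by (simp add: cauchy_sq_def)
  finally show ?thesis .
qed

lemma point_massI:
  assumes "c \<in> circle" "AE t in \<nu>. t = c"
  shows "point_mass \<nu>"
  unfolding point_mass_def
proof (intro bexI[of _ c] measure_eqI)
  fix A assume A: "A \<in> sets \<nu>"
  have "emeasure \<nu> A = indicator A c"
  proof (cases "c \<in> A")
    case True
    have "AE t in \<nu>. t \<in> A" using assms(2) by eventually_elim (use True in auto)
    then show ?thesis using True A emeasure_eq_1_AE by simp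
  next
    case False
    have "AE t in \<nu>. t \<notin> A" using assms(2) by eventually_elim (use False in auto)
    then show ?thesis using False A by (simp add: AE_iff_measurable[OF A] AE_iff_null_sets null_setsD1)
  qed
  then show "emeasure \<nu> A = emeasure (return (restrict_space borel circle) c) A"
    using A by (simp add: sets_nu)
qed (use assms in \<open>auto simp: sets_nu\<close>)

text \<open>
  If \<open>\<bar>h(w)\<bar> = 1\<close>, then \<open>(t - h(w)) / (1 - w t)\<close> has vanishing square integral, so \<open>t = h(w)\<close> almost
  everywhere.
\<close>

lemma eta_quot_less_1:
  assumes w: "cmod w < 1" and np: "\<not> point_mass \<nu>"
  shows "cmod (eta_quot \<nu> w) < 1"
proof (rule ccontr)
  assume "\<not> ?thesis"
  with eta_quot_le_1[OF w] have h: "cmod (eta_quot \<nu> w) = 1" by simp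
  then have 0: "(LINT t|\<nu>. (cmod (centred_kernel w t))\<^sup>2) = 0"
    using centred_kernel_sq[OF w] one_minus_sq_pos[OF w] by simp
  have "integrable \<nu> (\<lambda>t. (cmod (centred_kernel w t))\<^sup>2)"
    by (rule integrable_cont) (auto intro!: continuous_intros cont_centred_kernel w)
  from integral_nonneg_eq_0_iff_AE[OF this] 0 have "AE t in \<nu>. (cmod (centred_kernel w t))\<^sup>2 = 0"
    by simp
  moreover have "AE t in \<nu>. t \<in> circle" by (rule AE_I2) simp
  ultimately have "AE t in \<nu>. t = eta_quot \<nu> w"
  proof eventually_elim
    case (elim t)
    then show ?case using one_minus_mult_nonzero[OF w, of t] by (simp add: centred_kernel_def)
  qed
  then show False using np h point_massI[of "eta_quot \<nu> w"] by simp
qed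

lemma hyp_gauge_eta_quot:
  assumes w: "cmod w < 1" and v: "cmod v < 1" and np: "\<not> point_mass \<nu>"
  shows "hyp_gauge (eta_quot \<nu> w) (eta_quot \<nu> v) \<le> hyp_gauge w v"
  using Schwarz_Pick_eta_quot[OF w v] one_minus_sq_pos[OF w] one_minus_sq_pos[OF v]
    one_minus_sq_pos[OF eta_quot_less_1[OF w np]] one_minus_sq_pos[OF eta_quot_less_1[OF v np]]
  unfolding hyp_gauge_def by (simp add: divide_le_eq le_divide_eq)

end

section \<open>Subordination from freeness\<close>

locale free_pair = tracial_state \<tau> for \<tau> :: "'a::cstar_algebra \<Rightarrow> complex" +
  fixes C :: "bool \<Rightarrow> 'a set"
  assumes subalgebra: "\<And>i. star_subalgebra (C i)"
    and free: "free_subalgebras \<tau> C"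
begin

text \<open>
  Products of centred elements taken alternately from \<open>C True\<close> and \<open>C False\<close>; the two indices are those of
  the first and of the last factor, which makes concatenation and adjoints easy to track.
\<close>

inductive alternating :: "bool \<Rightarrow> bool \<Rightarrow> 'a \<Rightarrow> bool" where
  single: "x \<in> C i \<Longrightarrow> \<tau> x = 0 \<Longrightarrow> alternating i i x"
| cons: "x \<in> C i \<Longrightarrow> \<tau> x = 0 \<Longrightarrow> alternating (\<not> i) j y \<Longrightarrow> alternating i j (x * y)"

lemma alternating_word:
  assumes "alternating i j x"
  shows "\<exists>p ps. fst p = i \<and> (\<forall>(k, y)\<in>set (p # ps). y \<in> C k \<and> \<tau> y = 0)
    \<and> successively (\<lambda>p q. fst p \<noteq> fst q) (p # ps) \<and> x = prod_list (map snd (p # ps))"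
  using assms
proof induction
  case (single x i)
  then show ?case by (intro exI[of _ "(i, x)"] exI[of _ "[]"]) auto
next
  case (cons x i j y)
  then obtain p ps where "fst p = (\<not> i)" "\<forall>(k, y)\<in>set (p # ps). y \<in> C k \<and> \<tau> y = 0"
    "successively (\<lambda>p q. fst p \<noteq> fst q) (p # ps)" "y = prod_list (map snd (p # ps))"
    by (elim exE conjE)
  with cons.hyps show ?case by (intro exI[of _ "(i, x)"] exI[of _ "p # ps"]) auto
qed

lemma alternating_centred:
  assumes "alternating i j x"
  shows "\<tau> x = 0"
proof -
  obtain p ps where p: "\<forall>(k, y)\<in>set (p # ps). y \<in> C k \<and> \<tau> y = 0"
    "successively (\<lambda>p q. fst p \<noteq> fst q) (p # ps)" "x = prod_list (map snd (p # ps))"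
    using alternating_word[OF assms] by (elim exE conjE)
  show ?thesis
    unfolding p(3) using free[unfolded free_subalgebras_def, THEN spec, of "p # ps"] p(1,2) by blast
qed

lemma alternating_append:
  "alternating i j x \<Longrightarrow> alternating (\<not> j) k y \<Longrightarrow> alternating i k (x * y)"
  by (induction rule: alternating.induct) (simp_all add: alternating.cons mult.assoc)

lemma alternating_star: "alternating i j x \<Longrightarrow> alternating j i (star x)"
proof (induction rule: alternating.induct)
  case (single x i)
  then show ?case
    by (intro alternating.single) (simp_all add: star_subalgebraD[OF subalgebra] star_cnj)
next
  case (cons x i j y)
  then have "alternating i i (star x)"
    by (intro alternating.single) (simp_all add: star_subalgebraD[OF subalgebra] star_cnj)
  then show ?case using alternating_append[of j "\<not> i" "star y" i] cons.IH by (simp add: star_mult)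
qed

text \<open>
  Replacing \<open>star x * x\<close> by its mean leaves an error which is alternating when put between \<open>star y\<close> and
  \<open>y\<close>.
\<close>

lemma sq_norm2_alternating:
  assumes x: "x \<in> C i" "\<tau> x = 0" and y: "alternating (\<not> i) j y"
  shows "sq_norm2 (x * y) = sq_norm2 x * sq_norm2 y"
proof -
  define c where "c = star x * x - scaleC (\<tau> (star x * x)) 1"
  have c: "alternating i i c"
    unfolding c_def
    by (intro alternating.single star_subalgebra_diff star_subalgebra_const subalgebra)
      (simp_all add: star_subalgebraD[OF subalgebra] x linear)
  have "alternating j j (star y * (c * y))"
    using alternating_append[OF alternating_star[OF y]] alternating_append[OF c y] by simp
  then have "\<tau> (star y * (c * y)) = 0" by (rule alternating_centred)
  moreover have "star (x * y) * (x * y) = star y * (c * y) + scaleC (\<tau> (star x * x)) (star y * y)"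
    by (simp add: c_def star_mult algebra_simps mult_scaleC)
  ultimately have "\<tau> (star (x * y) * (x * y)) = \<tau> (star x * x) * \<tau> (star y * y)"
    by (simp add: linear)
  then have "complex_of_real (sq_norm2 (x * y)) = complex_of_real (sq_norm2 x * sq_norm2 y)"
    by (simp add: tau_star_self)
  then show ?thesis by (simp only: of_real_eq_iff)
qed

lemma alternating_power:
  assumes a: "a \<in> C True" "\<tau> a = 0" and b: "b \<in> C False" "\<tau> b = 0"
  shows "alternating True False ((a * b) ^ Suc n)"
    and "sq_norm2 ((a * b) ^ Suc n) = (sq_norm2 a * sq_norm2 b) ^ Suc n"
proof -
  have b1: "alternating (\<not> True) False b" using alternating.single[OF b] by simp
  have "alternating True False ((a * b) ^ Suc n) \<and> sq_norm2 ((a * b) ^ Suc n) = (sq_norm2 a * sq_norm2 b) ^ Suc n"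
  proof (induction n)
    case 0
    then show ?case using alternating.cons[OF a b1] sq_norm2_alternating[OF a b1] by simp
  next
    case (Suc n)
    have bw: "alternating (\<not> True) False (b * (a * b) ^ Suc n)"
      using alternating.cons[OF b] Suc by simp
    have "alternating True False (a * (b * (a * b) ^ Suc n))"
      by (rule alternating.cons[OF a bw])
    moreover have "sq_norm2 (a * (b * (a * b) ^ Suc n)) = (sq_norm2 a * sq_norm2 b) ^ Suc (Suc n)"
      using sq_norm2_alternating[OF a bw] sq_norm2_alternating[OF b, of False "(a * b) ^ Suc n"] Suc by simp
    ultimately show ?case by (simp add: mult.assoc)
  qed
  then show "alternating True False ((a * b) ^ Suc n)"
    "sq_norm2 ((a * b) ^ Suc n) = (sq_norm2 a * sq_norm2 b) ^ Suc n" by blast+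
qed

text \<open>
  All words in the expansion of \<open>(1 + \<beta> b) (z a b)\<^sup>n (1 + \<alpha> a)\<close> are alternating, so freeness kills every
  term except the \<open>1\<close> from \<open>n = 0\<close>. The remainder after \<open>n\<close> terms of the Neumann series of \<open>S\<close> is estimated
  in the 2-norm of \<open>\<tau>\<close>, where \<open>\<parallel>(a b)\<^sup>n\<parallel>\<^sub>2 = (\<parallel>a\<parallel>\<^sub>2 \<parallel>b\<parallel>\<^sub>2)\<^sup>n\<close>; the operator norm of \<open>z a b\<close> may exceed \<open>1\<close>.
\<close>

lemma trace_sandwiched_inverse:
  assumes a: "a \<in> C True" "\<tau> a = 0" and b: "b \<in> C False" "\<tau> b = 0"
    and small: "(cmod z)\<^sup>2 * (sq_norm2 a * sq_norm2 b) < 1"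
    and S: "S = 1 + scaleC z (a * b) * S"
  shows "\<tau> ((1 + scaleC \<beta> b) * S * (1 + scaleC \<alpha> a)) = 1"
proof -
  define X Y c where "X = 1 + scaleC \<alpha> a" and "Y = 1 + scaleC \<beta> b" and "c = scaleC z (a * b)"
  define q where "q = (cmod z)\<^sup>2 * (sq_norm2 a * sq_norm2 b)"
  have q: "0 \<le> q" "q < 1" using small sq_norm2_nonneg by (auto simp: q_def)
  have cn: "c ^ n = scaleC (z ^ n) ((a * b) ^ n)" for n by (simp add: c_def scaleC_power)
  have a1: "alternating True True a" and b1: "alternating False False b"
    using alternating.single a b by auto
  have t0: "\<tau> (Y * X) = 1"
  proof -
    have "\<tau> (b * a) = 0"
      using alternating_centred[OF alternating_append[OF b1, of True a]] a1 by simp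
    then show ?thesis
      using a b by (simp add: X_def Y_def algebra_simps linear mult_scaleC)
  qed
  have tn: "\<tau> (Y * c ^ Suc n * X) = 0" for n
  proof -
    define w where "w = (a * b) ^ Suc n"
    have w: "alternating True False w" unfolding w_def by (rule alternating_power[OF a b])
    have bw: "alternating False False (b * w)" using alternating_append[OF b1] w by simp
    have wa: "alternating True True (w * a)" using alternating_append[OF w] a1 by simp
    have bwa: "alternating False True (b * w * a)" using alternating_append[OF bw] a1 by simp
    have "Y * c ^ Suc n * X = scaleC (z ^ Suc n) (w + scaleC \<beta> (b * w) + scaleC \<alpha> (w * a)
       + scaleC (\<alpha> * \<beta>) (b * w * a))"
      by (simp only: cn flip: w_def) (simp add: X_def Y_def algebra_simps mult_scaleC
        scaleC_scaleC scaleC_add_right)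
    then show ?thesis
      using alternating_centred[OF w] alternating_centred[OF bw] alternating_centred[OF wa]
        alternating_centred[OF bwa] by (simp add: linear)
  qed
  have Sn: "S = (\<Sum>k<n. c ^ k) + c ^ n * S" for n
  proof (induction n)
    case (Suc n)
    have "c ^ n * S = c ^ n * (1 + c * S)" using S by (simp flip: c_def)
    also have "\<dots> = c ^ n + c ^ Suc n * S" by (simp add: algebra_simps power_commutes flip: mult.assoc)
    finally have "c ^ n * S = c ^ n + c ^ Suc n * S" .
    then show ?case using Suc by (simp add: add.assoc)
  qed simp
  have main: "\<tau> (Y * S * X) = 1 + \<tau> (Y * (c ^ Suc n * S) * X)" for n
  proof -
    have "\<tau> (Y * S * X) = \<tau> (\<Sum>k<Suc n. Y * c ^ k * X) + \<tau> (Y * (c ^ Suc n * S) * X)"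
      by (subst Sn[of "Suc n"]) (simp only: distrib_left distrib_right sum_distrib_left
          sum_distrib_right add)
    also have "\<tau> (\<Sum>k<Suc n. Y * c ^ k * X) = (\<Sum>k<Suc n. \<tau> (Y * c ^ k * X))" by (rule sum)
    also have "\<dots> = (\<Sum>k<Suc n. if k = 0 then 1 else 0)"
    proof (rule sum.cong)
      fix k assume "k \<in> {..<Suc n}"
      then show "\<tau> (Y * c ^ k * X) = (if k = 0 then 1 else 0)"
        using t0 tn by (cases k) (auto simp del: power_Suc)
    qed simp
    also have "\<dots> = 1" by (simp add: sum.lessThan_Suc_shift del: sum.lessThan_Suc)
    finally show ?thesis .
  qed
  define M where "M = sq_norm2 (S * (X * Y))"
  have bound: "(cmod (\<tau> (Y * S * X) - 1))\<^sup>2 \<le> M * q ^ Suc n" for n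
  proof -
    have "\<tau> (Y * S * X) - 1 = \<tau> (Y * (c ^ Suc n * S) * X)" by (simp add: main[of n])
    also have "\<dots> = \<tau> (Y * (c ^ Suc n * S * X))" by (simp add: mult.assoc)
    also have "\<dots> = \<tau> (c ^ Suc n * S * X * Y)" by (rule trace)
    also have "\<dots> = \<tau> (star (star (c ^ Suc n)) * (S * (X * Y)))"
      by (simp only: star_star mult.assoc)
    finally have "(cmod (\<tau> (Y * S * X) - 1))\<^sup>2 \<le> M * sq_norm2 (star (c ^ Suc n))"
      unfolding M_def using Cauchy_Schwarz by simp
    also have "sq_norm2 (star (c ^ Suc n)) = sq_norm2 (c ^ Suc n)"
      unfolding sq_norm2_def star_star by (rule arg_cong[of _ _ Re], rule trace)
    also have "sq_norm2 (c ^ Suc n) = q ^ Suc n"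
    proof -
      have "\<tau> (star (c ^ Suc n) * c ^ Suc n)
        = cnj (z ^ Suc n) * (z ^ Suc n * \<tau> (star ((a * b) ^ Suc n) * (a * b) ^ Suc n))"
        by (simp only: cn star_scaleC mult_scaleC scale mult_ac)
      also have "\<dots> = complex_of_real ((cmod (z ^ Suc n))\<^sup>2 * sq_norm2 ((a * b) ^ Suc n))"
        by (simp only: tau_star_self of_real_mult complex_norm_square mult_ac)
      finally have "sq_norm2 (c ^ Suc n) = (cmod (z ^ Suc n))\<^sup>2 * sq_norm2 ((a * b) ^ Suc n)"
        by (simp only: sq_norm2_def Re_complex_of_real)
      also have "\<dots> = q ^ Suc n"
        unfolding alternating_power[OF a b] q_def
        by (simp only: norm_power power_mult_distrib power_mult[symmetric] mult.commute)
      finally show ?thesis .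
    qed
    finally show ?thesis .
  qed
  have "(\<lambda>n. M * q ^ Suc n) \<longlonglongrightarrow> M * 0"
    using q by (intro tendsto_intros LIMSEQ_Suc LIMSEQ_power_zero) auto
  then have "(cmod (\<tau> (Y * S * X) - 1))\<^sup>2 \<le> M * 0"
    using bound by (intro LIMSEQ_le_const) auto
  then show ?thesis by (simp add: X_def Y_def)
qed

end

context tracial_state
begin

text \<open>
  For \<open>g = (1 - w u)\<^sup>-\<^sup>1\<close> the element \<open>g (u - h)\<close> is centred exactly for \<open>h = \<tau> (g u) / \<tau> g\<close>, and its
  2-norm is then given by the Pick kernel on the diagonal. The computation mirrors \<open>kernel_integral\<close>, with
  \<open>(1 - \<bar>w\<bar>\<^sup>2) (star g * g) = star g + g - 1\<close> as the algebraic form of the Poisson kernel.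
\<close>

lemma
  assumes u: "unitary u" and w: "cmod w < 1"
    and g: "(1 - scaleC w u) * g = 1" "g * (1 - scaleC w u) = 1"
    and h: "\<tau> (g * u) = h * \<tau> g" "\<tau> g * (1 - w * h) = 1"
  shows centred_Moebius: "\<tau> (g * (u - scaleC h 1)) = 0"
    and Moebius_commute: "(u - scaleC h 1) * g = g * (u - scaleC h 1)"
    and sq_norm2_Moebius: "(1 - (cmod w)\<^sup>2) * sq_norm2 (g * (u - scaleC h 1)) = 1 - (cmod h)\<^sup>2"
proof -
  have gu: "scaleC w (g * u) = g - 1" "scaleC w (u * g) = g - 1"
    using g by (auto simp: algebra_simps mult_scaleC)
  show "\<tau> (g * (u - scaleC h 1)) = 0"
    using h by (simp add: algebra_simps linear mult_scaleC_right)
  have uu: "star u * u = 1" "u * star u = 1" using u by (auto simp: unitary_def)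
  have ug: "u * g = g * u"
  proof -
    have "g * (u * (1 - scaleC w u)) * g = g * ((1 - scaleC w u) * u) * g"
      by (simp add: algebra_simps mult_scaleC)
    then show ?thesis using g by (simp add: mult.assoc) (simp flip: mult.assoc)
  qed
  then show comm: "(u - scaleC h 1) * g = g * (u - scaleC h 1)"
    by (simp add: algebra_simps mult_scaleC)
  define k where "k = 1 - scaleC w u"
  define G where "G = star g * g"
  have sg: "star g * star k = 1" "star k * star g = 1"
    using arg_cong[OF g(1), of star] arg_cong[OF g(2), of star] by (simp_all add: star_mult k_def)
  have sk: "star k = 1 - scaleC (cnj w) (star u)" by (simp add: k_def star_diff star_scaleC)
  have norm_w: "cnj w * w = complex_of_real ((cmod w)\<^sup>2)" by (simp add: complex_norm_square mult.commute del: of_real_power)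
  have kk: "k + star k - star k * k = scaleC (1 - (cmod w)\<^sup>2) 1"
    unfolding sk
    by (simp add: k_def algebra_simps mult_scaleC scaleC_scaleC uu
        scaleC_diff_left scaleC_diff_right) (simp add: norm_w mult.commute[of w])
  have "star g * (k + star k - star k * k) * g = star g * (k * g) + (star g * star k) * g - (star g * star k) * (k * g)"
    by (simp add: algebra_simps)
  also have "\<dots> = star g + g - 1" using sg g by (simp add: k_def)
  finally have G: "scaleC (1 - (cmod w)\<^sup>2) G = star g + g - 1"
    by (simp add: kk mult_scaleC G_def)
  have sgu: "star g * u = u + scaleC (cnj w) (star g)"
  proof -
    have "star g = 1 + scaleC (cnj w) (star g * star u)"
      using sg(1) by (simp add: sk algebra_simps mult_scaleC_right)
    then have "star g * u = (1 + scaleC (cnj w) (star g * star u)) * u" by simp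
    also have "\<dots> = u + scaleC (cnj w) (star g)"
      by (simp add: algebra_simps mult_scaleC_left uu mult.assoc)
    finally show ?thesis .
  qed
  define r where "r = complex_of_real (1 - (cmod w)\<^sup>2)"
  define \<gamma> where "\<gamma> = \<tau> g"
  have e1: "r * \<tau> G = cnj \<gamma> + \<gamma> - 1"
    using arg_cong[OF G, of \<tau>] by (simp add: linear star_cnj r_def \<gamma>_def)
  have "scaleC (1 - (cmod w)\<^sup>2) (G * u) = star g * u + g * u - u"
    using arg_cong[OF G, of "\<lambda>x. x * u"] by (simp add: algebra_simps mult_scaleC_left)
  then have "r * \<tau> (G * u) = \<tau> (u + scaleC (cnj w) (star g) + g * u - u)"
    by (simp add: sgu r_def flip: scale)
  then have e2: "r * \<tau> (G * u) = h * \<gamma> + cnj w * cnj \<gamma>"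
    using h by (simp add: linear star_cnj \<gamma>_def)
  have "\<tau> (G * star u) = \<tau> (star u * G)" by (rule trace)
  also have "\<dots> = \<tau> (star (G * u))" by (simp add: G_def star_mult star_star)
  finally have "\<tau> (G * star u) = cnj (\<tau> (G * u))" by (simp add: star_cnj)
  then have "r * \<tau> (G * star u) = cnj (r * \<tau> (G * u))" by (simp add: r_def)
  then have e3: "r * \<tau> (G * star u) = cnj h * cnj \<gamma> + w * \<gamma>" by (simp add: e2)
  have "\<tau> (star (g * (u - scaleC h 1)) * (g * (u - scaleC h 1)))
      = \<tau> (star (u - scaleC h 1) * (G * (u - scaleC h 1)))"
    by (simp only: star_mult G_def mult.assoc)
  also have "\<dots> = \<tau> (G * (u - scaleC h 1) * star (u - scaleC h 1))" by (rule trace)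
  also have "G * (u - scaleC h 1) * star (u - scaleC h 1)
     = G + scaleC (h * cnj h) G - scaleC (cnj h) (G * u) - scaleC h (G * star u)"
    by (simp add: star_diff star_scaleC algebra_simps mult_scaleC scaleC_scaleC uu
        scaleC_diff_right)
  finally have "complex_of_real (sq_norm2 (g * (u - scaleC h 1)))
    = \<tau> G + h * cnj h * \<tau> G - cnj h * \<tau> (G * u) - h * \<tau> (G * star u)"
    by (simp add: tau_star_self linear)
  then have "r * complex_of_real (sq_norm2 (g * (u - scaleC h 1)))
    = r * \<tau> G + h * cnj h * (r * \<tau> G) - cnj h * (r * \<tau> (G * u)) - h * (r * \<tau> (G * star u))"
    by (simp only: right_diff_distrib distrib_left mult_ac)
  also have "\<dots> = (1 + h * cnj h) * (cnj \<gamma> + \<gamma> - 1) - cnj h * (h * \<gamma> + cnj w * cnj \<gamma>) - h * (cnj h * cnj \<gamma> + w * \<gamma>)"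
    unfolding e1 e2 e3 by (simp add: algebra_simps)
  also have "\<dots> = 1 - h * cnj h"
  proof -
    have "\<gamma> * (1 - w * h) = 1" using h by (simp add: \<gamma>_def)
    moreover from arg_cong[OF this, of cnj] have "cnj \<gamma> * (1 - cnj w * cnj h) = 1" by simp
    ultimately show ?thesis by algebra
  qed
  finally have "complex_of_real ((1 - (cmod w)\<^sup>2) * sq_norm2 (g * (u - scaleC h 1)))
    = complex_of_real (1 - (cmod h)\<^sup>2)"
    unfolding r_def by (simp add: complex_norm_square del: of_real_power)
  then show "(1 - (cmod w)\<^sup>2) * sq_norm2 (g * (u - scaleC h 1)) = 1 - (cmod h)\<^sup>2"
    by (simp only: of_real_eq_iff)
qed

text \<open>
  Expand the geometric series on both sides; its terms agree since \<open>\<tau>\<close> and \<open>\<nu>\<close> have the same moments. The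
  case \<open>m = 1\<close> avoids dividing by \<open>w\<close>, which may be \<open>0\<close>.
\<close>

lemma trace_resolvent:
  assumes "circle_prob \<nu>" "has_distribution \<tau> u \<nu>" "unitary u" "cmod w < 1"
  shows "\<tau> (resolvent (scaleC w u) * u ^ m) = (LINT t|\<nu>. t ^ m / (1 - w * t))"
proof -
  interpret circle_measure \<nu> by (rule circle_measure.intro) fact
  note w = assms(4)
  have "norm (scaleC w u) < 1" using w norm_unitary[OF assms(3)] by (simp add: norm_scaleC)
  from sums_mult2[OF sums_resolvent[OF this], of "u ^ m"]
  have "(\<lambda>k. scaleC w u ^ k * u ^ m) sums (resolvent (scaleC w u) * u ^ m)" .
  from bounded_linear.sums[OF bounded_linear_tau this]
  have "(\<lambda>k. \<tau> (scaleC w u ^ k * u ^ m)) sums \<tau> (resolvent (scaleC w u) * u ^ m)" .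
  moreover have "\<tau> (scaleC w u ^ k * u ^ m) = (LINT t|\<nu>. w ^ k * t ^ (k + m))" for k
    using assms(2) unfolding has_distribution_def
    by (simp add: scaleC_power mult_scaleC_left scale flip: power_add)
  ultimately have s: "(\<lambda>k. LINT t|\<nu>. w ^ k * t ^ (k + m)) sums \<tau> (resolvent (scaleC w u) * u ^ m)"
    by simp
  have "(\<lambda>n. (LINT t|\<nu>. t ^ m / (1 - w * t)) - (\<Sum>k<n. LINT t|\<nu>. w ^ k * t ^ (k + m))) \<longlonglongrightarrow> 0"
  proof (rule Lim_null_comparison)
    show "(\<lambda>n. cmod w ^ n / (1 - cmod w)) \<longlonglongrightarrow> 0"
      using w by (intro tendsto_divide_zero LIMSEQ_power_zero) auto
    show "\<forall>\<^sub>F n in sequentially. cmod ((LINT t|\<nu>. t ^ m / (1 - w * t))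
       - (\<Sum>k<n. LINT t|\<nu>. w ^ k * t ^ (k + m))) \<le> cmod w ^ n / (1 - cmod w)"
    proof (rule always_eventually, rule allI)
      fix n
      have c1: "continuous_on circle (\<lambda>t. t ^ m / (1 - w * t))"
        using one_minus_mult_nonzero[OF w] by (auto intro!: continuous_intros)
      have c2: "continuous_on circle (\<lambda>t. w ^ k * t ^ (k + m))" for k
        by (intro continuous_intros)
      have c3: "continuous_on circle (\<lambda>t. \<Sum>k<n. w ^ k * t ^ (k + m))"
        by (intro continuous_intros)
      have "(LINT t|\<nu>. t ^ m / (1 - w * t)) - (\<Sum>k<n. LINT t|\<nu>. w ^ k * t ^ (k + m))
        = (LINT t|\<nu>. t ^ m / (1 - w * t) - (\<Sum>k<n. w ^ k * t ^ (k + m)))"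
        using integrable_cont[OF c1] integrable_cont[OF c2] integrable_cont[OF c3]
        by (simp add: Bochner_Integration.integral_sum)
      also have "cmod \<dots> \<le> (LINT t|\<nu>. cmod w ^ n / (1 - cmod w))"
      proof (rule Bochner_Integration.integral_norm_bound_integral)
        fix t assume "t \<in> space \<nu>"
        then have t: "cmod t = 1" by simp
        note nz = one_minus_mult_nonzero[OF w t]
        have "(\<Sum>k<n. w ^ k * t ^ (k + m)) = t ^ m * (\<Sum>k<n. (w * t) ^ k)"
          by (simp add: sum_distrib_left power_add power_mult_distrib mult_ac)
        also have "(\<Sum>k<n. (w * t) ^ k) = (1 - (w * t) ^ n) / (1 - w * t)"
          using nz one_diff_power_eq[of "w * t" n] by (simp add: field_simps)
        finally have "t ^ m / (1 - w * t) - (\<Sum>k<n. w ^ k * t ^ (k + m))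
          = t ^ m * (w * t) ^ n / (1 - w * t)"
          using nz by (simp add: field_simps)
        then have "cmod (t ^ m / (1 - w * t) - (\<Sum>k<n. w ^ k * t ^ (k + m)))
          = cmod w ^ n / cmod (1 - w * t)"
          using t by (simp add: norm_mult norm_divide norm_power)
        also have "\<dots> \<le> cmod w ^ n / (1 - cmod w)"
        proof (rule divide_left_mono)
          show "1 - cmod w \<le> cmod (1 - w * t)"
            using norm_triangle_ineq2[of 1 "w * t"] t by (simp add: norm_mult)
          then show "0 < cmod (1 - w * t) * (1 - cmod w)" using w nz by simp
        qed simp
        finally show "cmod (t ^ m / (1 - w * t) - (\<Sum>k<n. w ^ k * t ^ (k + m)))
          \<le> cmod w ^ n / (1 - cmod w)" .
      qed (use integrable_cont[OF c1] integrable_cont[OF c3] in auto)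
      finally show "cmod ((LINT t|\<nu>. t ^ m / (1 - w * t)) - (\<Sum>k<n. LINT t|\<nu>. w ^ k * t ^ (k + m)))
        \<le> cmod w ^ n / (1 - cmod w)"
        using prob_space by simp
    qed
  qed
  moreover have "(\<lambda>n. (LINT t|\<nu>. t ^ m / (1 - w * t)) - (\<Sum>k<n. LINT t|\<nu>. w ^ k * t ^ (k + m)))
    \<longlonglongrightarrow> (LINT t|\<nu>. t ^ m / (1 - w * t)) - \<tau> (resolvent (scaleC w u) * u ^ m)"
    using s by (intro tendsto_diff tendsto_const) (simp add: sums_def)
  ultimately have "(LINT t|\<nu>. t ^ m / (1 - w * t)) - \<tau> (resolvent (scaleC w u) * u ^ m) = 0"
    using LIMSEQ_unique by blast
  then show ?thesis by simp
qed

end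

text \<open>
  The factorization \<open>(1 - \<eta>) g\<^sub>1 (1 - z u\<^sub>1 u\<^sub>2) g\<^sub>2 = 1 - z a b\<close>, with \<open>g\<^sub>j\<close> the resolvent of \<open>w\<^sub>j u\<^sub>j\<close> and \<open>a\<close>, \<open>b\<close>
  centred, is the noncommutative heart of the proof. It holds precisely because \<open>w\<^sub>1 = z h\<^sub>2\<close> and
  \<open>w\<^sub>2 = z h\<^sub>1\<close>: then the terms linear in \<open>u\<^sub>1\<close> and in \<open>u\<^sub>2\<close> cancel. Moreover
  \<open>1 + w\<^sub>1 a = (1 - \<eta>) g\<^sub>1\<close> and \<open>1 + w\<^sub>2 b = (1 - \<eta>) g\<^sub>2\<close>, so \<open>trace_sandwiched_inverse\<close> evaluates the trace of the
  resolvent of \<open>z u\<^sub>1 u\<^sub>2\<close>.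
\<close>

theorem free_convolution_subordination:
  assumes conv: "is_free_mult_conv TYPE('a::cstar_algebra) \<mu>1 \<mu>2 \<mu>"
    and "circle_prob \<mu>1" "circle_prob \<mu>2"
    and z: "cmod z < 1" and w1: "w1 = z * eta_quot \<mu>2 w2" and w2: "w2 = z * eta_quot \<mu>1 w1"
    and lt: "cmod w1 < 1" "cmod w2 < 1"
  shows "cauchy_int \<mu> z = cauchy_int \<mu>1 w1"
proof -
  interpret m1: circle_measure \<mu>1 by (rule circle_measure.intro) fact
  interpret m2: circle_measure \<mu>2 by (rule circle_measure.intro) fact
  obtain \<tau> :: "'a \<Rightarrow> complex" and u1 u2 where t: "faithful_tracial_state \<tau>"
    and u: "unitary u1" "unitary u2" and fr: "star_free \<tau> u1 u2"
    and d1: "has_distribution \<tau> u1 \<mu>1" and d2: "has_distribution \<tau> u2 \<mu>2"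
    and d: "has_distribution \<tau> (u1 * u2) \<mu>" and mu: "circle_prob \<mu>"
    using conv unfolding is_free_mult_conv_def by (elim exE conjE)
  interpret tracial_state \<tau> by (rule tracial_state.intro) fact
  define A :: "bool \<Rightarrow> 'a set" where "A = (\<lambda>i. star_subalgebra hull {if i then u1 else u2})"
  define C where "C = (\<lambda>i. closure (A i))"
  have A: "star_subalgebra (A i)" for i unfolding A_def by (rule star_subalgebra_hull)
  have C: "star_subalgebra (C i)" for i unfolding C_def by (rule star_subalgebra_closure[OF A])
  have fr': "free_subalgebras \<tau> C"
    unfolding C_def by (rule free_subalgebras_closure) (use fr A in \<open>simp_all add: star_free_def A_def\<close>)
  interpret free_pair \<tau> C by unfold_locales (fact C, fact fr')
  have uA: "u1 \<in> A True" "u2 \<in> A False" by (simp_all add: A_def hull_inc)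
  then have uC: "u1 \<in> C True" "u2 \<in> C False" using closure_subset unfolding C_def by blast+
  define g1 g2 where "g1 = resolvent (scaleC w1 u1)" and "g2 = resolvent (scaleC w2 u2)"
  define R where "R = resolvent (scaleC z (u1 * u2))"
  have n1: "norm (scaleC w1 u1) < 1" and n2: "norm (scaleC w2 u2) < 1"
    and nz: "norm (scaleC z (u1 * u2)) < 1"
    using lt z norm_unitary[OF u(1)] norm_unitary[OF u(2)] norm_unitary[OF unitary_mult[OF u]]
    by (simp_all add: norm_scaleC)
  have gC: "g1 \<in> C True" "g2 \<in> C False"
    unfolding g1_def g2_def C_def
    by (intro resolvent_in_closure A star_subalgebraD uA n1 n2)+
  define h1 h2 where "h1 = eta_quot \<mu>1 w1" and "h2 = eta_quot \<mu>2 w2"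
  have tg1: "\<tau> g1 = cauchy_int \<mu>1 w1" "\<tau> (g1 * u1) = h1 * \<tau> g1"
    using trace_resolvent[OF _ d1 u(1) lt(1), of 0] trace_resolvent[OF _ d1 u(1) lt(1), of 1]
      m1.cauchy_int_eta_quot(1)[OF lt(1)] assms(2) by (simp_all add: g1_def cauchy_int_def shifted_int_def h1_def)
  have tg2: "\<tau> g2 = cauchy_int \<mu>2 w2" "\<tau> (g2 * u2) = h2 * \<tau> g2"
    using trace_resolvent[OF _ d2 u(2) lt(2), of 0] trace_resolvent[OF _ d2 u(2) lt(2), of 1]
      m2.cauchy_int_eta_quot(1)[OF lt(2)] assms(3) by (simp_all add: g2_def cauchy_int_def shifted_int_def h2_def)
  have g1h: "\<tau> g1 * (1 - w1 * h1) = 1" and g2h: "\<tau> g2 * (1 - w2 * h2) = 1"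
    using m1.cauchy_int_eta_quot(2)[OF lt(1)] m2.cauchy_int_eta_quot(2)[OF lt(2)] by (simp_all add: tg1 tg2 h1_def h2_def)
  define k1 k2 where "k1 = 1 - scaleC w1 u1" and "k2 = 1 - scaleC w2 u2"
  have kg1: "k1 * g1 = 1" "g1 * k1 = 1" and kg2: "k2 * g2 = 1" "g2 * k2 = 1"
    unfolding k1_def k2_def g1_def g2_def
    by (rule resolvent_right[OF n1] resolvent_left[OF n1] resolvent_right[OF n2] resolvent_left[OF n2])+
  note M1 = centred_Moebius[OF u(1) lt(1) kg1[unfolded k1_def] tg1(2) g1h]
    Moebius_commute[OF u(1) lt(1) kg1[unfolded k1_def] tg1(2) g1h]
    sq_norm2_Moebius[OF u(1) lt(1) kg1[unfolded k1_def] tg1(2) g1h]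
  note M2 = centred_Moebius[OF u(2) lt(2) kg2[unfolded k2_def] tg2(2) g2h]
    Moebius_commute[OF u(2) lt(2) kg2[unfolded k2_def] tg2(2) g2h]
    sq_norm2_Moebius[OF u(2) lt(2) kg2[unfolded k2_def] tg2(2) g2h]
  define a b where "a = g1 * (u1 - scaleC h1 1)" and "b = g2 * (u2 - scaleC h2 1)"
  have b': "b = (u2 - scaleC h2 1) * g2" by (simp add: b_def M2)
  have aC: "a \<in> C True" and bC: "b \<in> C False"
    unfolding a_def b_def
    by (intro star_subalgebraD(3)[OF C] gC star_subalgebra_diff[OF C] uC star_subalgebra_const[OF C])+
  define \<eta> where "\<eta> = z * h1 * h2"
  have eta: "w1 * h1 = \<eta>" "w2 * h2 = \<eta>" using w1 w2 by (simp_all add: \<eta>_def h1_def h2_def)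
  have w12: "w1 = z * h2" "w2 = z * h1" using w1 w2 by (simp_all add: h1_def h2_def)
  have tau_g: "\<tau> g1 * (1 - \<eta>) = 1" "\<tau> g2 * (1 - \<eta>) = 1" using g1h g2h by (simp_all add: eta)
  have ne: "1 - \<eta> \<noteq> 0" using tau_g by auto
  \<comment> \<open>The denominators cleared: the factorization as an identity between polynomials in \<open>u1\<close>, \<open>u2\<close>.\<close>
  have key: "scaleC (1 - \<eta>) (1 - scaleC z (u1 * u2))
      = k1 * k2 - scaleC z ((u1 - scaleC h1 1) * (u2 - scaleC h2 1))"
    unfolding k1_def k2_def w12 \<eta>_def
    by (simp add: algebra_simps mult_scaleC scaleC_scaleC scaleC_diff_left
        scaleC_diff_right scaleC_add_right)
  define c where "c = scaleC z (a * b)"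
  have one_c: "1 - c = scaleC (1 - \<eta>) (g1 * (1 - scaleC z (u1 * u2)) * g2)"
  proof -
    have "g1 * (k1 * k2 - scaleC z ((u1 - scaleC h1 1) * (u2 - scaleC h2 1))) * g2
       = (g1 * k1) * (k2 * g2) - scaleC z (a * b)"
      by (simp add: left_diff_distrib right_diff_distrib mult_scaleC a_def b' mult.assoc
          del: scaleC_one)
    then show ?thesis
      unfolding key[symmetric] c_def by (simp add: kg1 kg2 mult_scaleC)
  qed
  define S where "S = scaleC (1 / (1 - \<eta>)) (k2 * R * k1)"
  have RR: "(1 - scaleC z (u1 * u2)) * R = 1" unfolding R_def by (rule resolvent_right[OF nz])
  have "(1 - c) * S = g1 * ((1 - scaleC z (u1 * u2)) * (g2 * k2) * R) * k1"
    using ne unfolding one_c S_def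
    by (simp add: mult_scaleC scaleC_scaleC mult.assoc)
  also have "\<dots> = 1" by (simp add: kg1 kg2 RR)
  finally have S: "S = 1 + scaleC z (a * b) * S" by (simp add: c_def left_diff_distrib algebra_simps)
  \<comment> \<open>Since \<open>\<bar>w1\<bar> \<le> \<bar>h2\<bar>\<close> and \<open>\<bar>w2\<bar> \<le> \<bar>h1\<bar>\<close>, the product of the two Pick kernels is at most 1.\<close>
  have small: "(cmod z)\<^sup>2 * (sq_norm2 a * sq_norm2 b) < 1"
  proof -
    have z2: "(cmod z)\<^sup>2 < 1" using z by (simp add: power_less_one_iff)
    have le: "cmod w1 \<le> cmod h2" "cmod w2 \<le> cmod h1"
      using z unfolding w12 by (simp_all add: norm_mult mult_left_le_one_le)
    have hb: "cmod h1 \<le> 1" "cmod h2 \<le> 1"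
      unfolding h1_def h2_def by (rule m1.eta_quot_le_1[OF lt(1)], rule m2.eta_quot_le_1[OF lt(2)])
    define p q where "p = (1 - (cmod w1)\<^sup>2)" and "q = (1 - (cmod w2)\<^sup>2)"
    have pq: "p > 0" "q > 0" unfolding p_def q_def by (rule one_minus_sq_pos[OF lt(1)], rule one_minus_sq_pos[OF lt(2)])
    have "(p * q) * (sq_norm2 a * sq_norm2 b) = (p * sq_norm2 a) * (q * sq_norm2 b)" by (simp only: mult_ac)
    also have "\<dots> = (1 - (cmod h1)\<^sup>2) * (1 - (cmod h2)\<^sup>2)"
      unfolding p_def q_def a_def b_def by (simp only: M1(3) M2(3))
    also have "\<dots> \<le> q * p"
      unfolding p_def q_def using le hb pq[unfolded p_def q_def]
      by (intro mult_mono) (auto intro!: power_mono simp: abs_square_le_1)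
    also have "\<dots> = (p * q) * 1" by simp
    finally have "sq_norm2 a * sq_norm2 b \<le> 1" using pq by (simp only: mult_le_cancel_left_pos mult_pos_pos)
    then have "(cmod z)\<^sup>2 * (sq_norm2 a * sq_norm2 b) \<le> (cmod z)\<^sup>2 * 1" by (intro mult_left_mono) auto
    then show ?thesis using z2 by simp
  qed
  have "\<tau> ((1 + scaleC w2 b) * S * (1 + scaleC w1 a)) = 1"
    by (rule trace_sandwiched_inverse[OF aC _ bC _ small S]) (simp_all add: a_def b_def M1 M2)
  moreover have "1 + scaleC w1 a = scaleC (1 - \<eta>) g1"
  proof -
    have "g1 - scaleC w1 (g1 * u1) = 1" using kg1(2) by (simp add: k1_def algebra_simps mult_scaleC_right)
    then show ?thesis
      by (simp add: a_def right_diff_distrib mult_scaleC_right scaleC_diff_right scaleC_diff_left scaleC_scaleC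
          algebra_simps flip: eta(1))
  qed
  moreover have "1 + scaleC w2 b = scaleC (1 - \<eta>) g2"
  proof -
    have "g2 - scaleC w2 (g2 * u2) = 1" using kg2(2) by (simp add: k2_def algebra_simps mult_scaleC_right)
    then show ?thesis
      by (simp add: b_def right_diff_distrib mult_scaleC_right scaleC_diff_right scaleC_diff_left scaleC_scaleC
          algebra_simps flip: eta(2))
  qed
  moreover have "scaleC (1 - \<eta>) g2 * S * scaleC (1 - \<eta>) g1 = scaleC (1 - \<eta>) R"
  proof -
    have "scaleC (1 - \<eta>) g2 * S * scaleC (1 - \<eta>) g1 = scaleC (1 - \<eta>) ((g2 * k2) * R * (k1 * g1))"
      using ne unfolding S_def by (simp add: mult_scaleC scaleC_scaleC mult.assoc)
    then show ?thesis by (simp add: kg1 kg2)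
  qed
  ultimately have "\<tau> (scaleC (1 - \<eta>) R) = 1" by simp
  then have "(1 - \<eta>) * \<tau> R = 1" by (simp add: scale)
  moreover have "\<tau> R = cauchy_int \<mu> z"
    using trace_resolvent[OF mu d unitary_mult[OF u] z, of 0] by (simp add: R_def cauchy_int_def)
  ultimately show ?thesis using tau_g(1) ne unfolding tg1(1)
    by (metis mult.commute mult_cancel_left)
qed

section \<open>The subordination functions\<close>

text \<open>
  The properties of a subordination function that control its boundary behaviour. The last clause says that it does not increase
  hyperbolic distances; the bound on \<open>1 - \<bar>\<omega>(z)\<bar>\<^sup>2\<close> keeps \<open>\<omega>(z)\<close> close to the circle wherever the Poisson
  integral of \<open>\<mu>\<close> is small.
\<close>

definition subordination_map :: "complex measure \<Rightarrow> complex measure \<Rightarrow> (complex \<Rightarrow> complex) \<Rightarrow> bool" where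
  "subordination_map \<mu> \<nu> \<omega> \<longleftrightarrow>
     (\<forall>z. 0 < cmod z \<longrightarrow> cmod z < 1 \<longrightarrow>
        cmod (\<omega> z) \<le> cmod z \<and> cauchy_int \<mu> z = cauchy_int \<nu> (\<omega> z) \<and>
        1 - (cmod (\<omega> z))\<^sup>2 \<le> 4 * cauchy_sq \<mu> z * (1 - (cmod z)\<^sup>2)) \<and>
     (\<forall>z z'. 0 < cmod z \<longrightarrow> cmod z < 1 \<longrightarrow> 0 < cmod z' \<longrightarrow> cmod z' < 1 \<longrightarrow>
        hyp_gauge (\<omega> z) (\<omega> z') \<le> hyp_gauge z z')"

context circle_measure
begin

lemma cauchy_sq_ge: "cmod w < 1 \<Longrightarrow> 1/4 \<le> cauchy_sq \<nu> w"
  unfolding cauchy_sq_def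
proof (rule integral_ge_const)
  assume w: "cmod w < 1"
  then show "integrable \<nu> (\<lambda>t. 1 / (cmod (1 - w * t))\<^sup>2)"
    by (intro integrable_cont cont_denominators)
  show "AE t in \<nu>. 1 / 4 \<le> 1 / (cmod (1 - w * t))\<^sup>2"
  proof (rule AE_I2)
    fix t assume "t \<in> space \<nu>"
    then have t: "cmod t = 1" by simp
    have "cmod (1 - w * t) \<le> 2"
      using norm_triangle_ineq4[of 1 "w * t"] t w by (simp add: norm_mult)
    then have "(cmod (1 - w * t))\<^sup>2 \<le> 2\<^sup>2" by (intro power_mono) auto
    then show "1 / 4 \<le> 1 / (cmod (1 - w * t))\<^sup>2"
      using one_minus_mult_nonzero[OF w t] by (simp add: field_simps)
  qed
qed

text \<open>
  Both sides are \<open>2 Re (cauchy_int \<nu> w) - 1\<close>.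
\<close>

lemma eta_defect:
  assumes w: "cmod w < 1"
  shows "(cmod (cauchy_int \<nu> w))\<^sup>2 * (1 - (cmod (w * eta_quot \<nu> w))\<^sup>2) = (1 - (cmod w)\<^sup>2) * cauchy_sq \<nu> w"
proof -
  have "cauchy_int \<nu> w * (w * eta_quot \<nu> w) = cauchy_int \<nu> w - 1"
    using cauchy_int_eta_quot(2)[OF w] by (simp add: algebra_simps)
  then have "(cmod (cauchy_int \<nu> w))\<^sup>2 * (cmod (w * eta_quot \<nu> w))\<^sup>2 = (cmod (cauchy_int \<nu> w - 1))\<^sup>2"
    by (metis norm_mult power_mult_distrib)
  moreover have "(cmod (cauchy_int \<nu> w - 1))\<^sup>2 = (cmod (cauchy_int \<nu> w))\<^sup>2 - 2 * Re (cauchy_int \<nu> w) + 1"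
    unfolding cmod_power2 by (simp add: power2_eq_square algebra_simps)
  ultimately show ?thesis using cauchy_sq_cauchy_int[OF w] by (simp add: algebra_simps)
qed

end

locale subordination =
  m1: circle_measure \<mu>1 + m2: circle_measure \<mu>2 + m: circle_measure \<mu> for \<mu>1 \<mu>2 \<mu> +
  assumes nondegenerate: "\<not> point_mass \<mu>1" "\<not> point_mass \<mu>2"
    and subordinate: "\<And>z w1 w2. cmod z < 1 \<Longrightarrow> w1 = z * eta_quot \<mu>2 w2 \<Longrightarrow> w2 = z * eta_quot \<mu>1 w1 \<Longrightarrow>
      cmod w1 < 1 \<Longrightarrow> cmod w2 < 1 \<Longrightarrow> cauchy_int \<mu> z = cauchy_int \<mu>1 w1"
begin

definition solution :: "complex \<Rightarrow> complex \<Rightarrow> complex \<Rightarrow> bool" where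
  "solution z w1 w2 \<longleftrightarrow> w1 = z * eta_quot \<mu>2 w2 \<and> w2 = z * eta_quot \<mu>1 w1 \<and> cmod w1 \<le> cmod z \<and> cmod w2 \<le> cmod z"

lemma mult_eta_quot_le:
  assumes "circle_prob \<nu>" "cmod w < 1"
  shows "cmod (z * eta_quot \<nu> w) \<le> cmod z"
  using circle_measure.eta_quot_le_1[OF circle_measure.intro[OF assms(1)] assms(2)]
  by (simp add: norm_mult mult_left_le)

lemma solution_exists:
  assumes z: "0 < cmod z" "cmod z < 1"
  shows "\<exists>w1 w2. solution z w1 w2"
proof -
  define F where "F = (\<lambda>w. z * eta_quot \<mu>2 (z * eta_quot \<mu>1 w))"
  let ?B = "cball 0 (cmod z) :: complex set"
  have 1: "z * eta_quot \<mu>1 w \<in> ?B" if "w \<in> ?B" for w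
    using mult_eta_quot_le[OF m1.circle, of w z] that z by simp
  have 2: "F w \<in> ?B" if "w \<in> ?B" for w
    using mult_eta_quot_le[OF m2.circle, of "z * eta_quot \<mu>1 w" z] 1[OF that] z by (simp add: F_def)
  have "continuous_on ?B F"
    unfolding F_def
    by (intro continuous_intros continuous_on_compose2[OF m2.continuous_eta_quot[OF z(2)]]
        m1.continuous_eta_quot[OF z(2)]) (use 1 in auto)
  then obtain w where w: "w \<in> ?B" "F w = w"
    using brouwer_ball[OF z(1), of 0 F] 2 by (auto simp: Pi_def)
  have "solution z w (z * eta_quot \<mu>1 w)"
    unfolding solution_def using w 1[OF w(1)] by (simp add: F_def)
  then show ?thesis by blast
qed

lemma
  assumes "solution z w1 w2" and z: "0 < cmod z" "cmod z < 1"
  shows solution_less: "cmod w1 < 1" "cmod w2 < 1"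
    and solution_cauchy_int: "cauchy_int \<mu> z = cauchy_int \<mu>1 w1" "cauchy_int \<mu> z = cauchy_int \<mu>2 w2"
    and solution_product: "w1 * w2 = z * (z * eta_quot \<mu> z)"
proof -
  have w1: "w1 = z * eta_quot \<mu>2 w2" and w2: "w2 = z * eta_quot \<mu>1 w1"
    and le: "cmod w1 \<le> cmod z" "cmod w2 \<le> cmod z"
    using assms(1) unfolding solution_def by blast+
  show lt: "cmod w1 < 1" "cmod w2 < 1" using le z by linarith+
  show g1: "cauchy_int \<mu> z = cauchy_int \<mu>1 w1" by (rule subordinate[OF z(2) w1 w2 lt])
  have e: "w1 * eta_quot \<mu>1 w1 = w2 * eta_quot \<mu>2 w2"
    by (subst w1, subst (2) w2) simp
  have 1: "cauchy_int \<mu>1 w1 * (1 - w1 * eta_quot \<mu>1 w1) = 1" by (rule m1.cauchy_int_eta_quot(2)[OF lt(1)])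
  have 2: "cauchy_int \<mu>2 w2 * (1 - w1 * eta_quot \<mu>1 w1) = 1" unfolding e by (rule m2.cauchy_int_eta_quot(2)[OF lt(2)])
  have "1 - w1 * eta_quot \<mu>1 w1 \<noteq> 0" using 1 by auto
  then show "cauchy_int \<mu> z = cauchy_int \<mu>2 w2" unfolding g1 using 1 2 by (metis mult_cancel_right)
  have 3: "cauchy_int \<mu>1 w1 * (1 - z * eta_quot \<mu> z) = 1"
    unfolding g1[symmetric] by (rule m.cauchy_int_eta_quot(2)[OF z(2)])
  have "1 - z * eta_quot \<mu> z = 1 - w1 * eta_quot \<mu>1 w1"
    using 1 3 m1.Re_cauchy_int(2)[OF lt(1)] by (metis mult_cancel_left)
  then have "w1 * eta_quot \<mu>1 w1 = z * eta_quot \<mu> z" by simp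
  moreover have "w1 * w2 = z * (w1 * eta_quot \<mu>1 w1)" by (subst w2) simp
  ultimately show "w1 * w2 = z * (z * eta_quot \<mu> z)" by (simp only:)
qed

text \<open>
  Let \<open>m\<close> be the larger of the two gauges on the left and suppose that it exceeds the gauge of \<open>z\<close>, \<open>z'\<close>.
  Each of \<open>w\<^sub>1\<close>, \<open>w\<^sub>2\<close> is \<open>z\<close> times the image of the other one under a contraction, so strictness in
  \<open>hyp_gauge_mult_less\<close> makes both gauges smaller than \<open>m\<close>. Taking \<open>z = z'\<close> shows that solutions are
  unique.
\<close>

lemma solution_contraction:
  assumes s: "solution z w1 w2" and s': "solution z' w1' w2'"
    and z: "0 < cmod z" "cmod z < 1" and z': "0 < cmod z'" "cmod z' < 1"
  shows "hyp_gauge w1 w1' \<le> hyp_gauge z z'" "hyp_gauge w2 w2' \<le> hyp_gauge z z'"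
proof -
  define m where "m = max (hyp_gauge w1 w1') (hyp_gauge w2 w2')"
  note lt = solution_less[OF s z] solution_less[OF s' z']
  note h1 = m1.eta_quot_less_1[OF lt(1) nondegenerate(1)] m1.eta_quot_less_1[OF lt(3) nondegenerate(1)]
  note h2 = m2.eta_quot_less_1[OF lt(2) nondegenerate(2)] m2.eta_quot_less_1[OF lt(4) nondegenerate(2)]
  have "m \<le> hyp_gauge z z'"
  proof (rule ccontr)
    assume "\<not> m \<le> hyp_gauge z z'"
    then have m: "hyp_gauge z z' < m" by simp
    have "hyp_gauge (eta_quot \<mu>1 w1) (eta_quot \<mu>1 w1') \<le> m"
      using m1.hyp_gauge_eta_quot[OF lt(1,3) nondegenerate(1)] by (simp add: m_def)
    from hyp_gauge_mult_less[OF z(2) z'(2) h1 m this] have 2: "hyp_gauge w2 w2' < m"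
      using s s' unfolding solution_def by metis
    have "hyp_gauge (eta_quot \<mu>2 w2) (eta_quot \<mu>2 w2') \<le> m"
      using m2.hyp_gauge_eta_quot[OF lt(2,4) nondegenerate(2)] by (simp add: m_def)
    from hyp_gauge_mult_less[OF z(2) z'(2) h2 m this] have "hyp_gauge w1 w1' < m"
      using s s' unfolding solution_def by metis
    with 2 show False by (simp add: m_def)
  qed
  then show "hyp_gauge w1 w1' \<le> hyp_gauge z z'" "hyp_gauge w2 w2' \<le> hyp_gauge z z'" by (simp_all add: m_def)
qed

lemma eta_defect_le:
  assumes z: "cmod z < 1"
  shows "1 - (cmod (z * eta_quot \<mu> z))\<^sup>2 \<le> 4 * cauchy_sq \<mu> z * (1 - (cmod z)\<^sup>2)"
proof -
  have "0 \<le> 1 - (cmod (z * eta_quot \<mu> z))\<^sup>2"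
    using mult_eta_quot_le[OF m.circle z, of z] z by (simp add: abs_square_le_1)
  moreover have "(1/2)\<^sup>2 \<le> (cmod (cauchy_int \<mu> z))\<^sup>2"
    using m.Re_cauchy_int(3)[OF z] by (intro power_mono) auto
  ultimately have "(1/2)\<^sup>2 * (1 - (cmod (z * eta_quot \<mu> z))\<^sup>2) \<le> (cmod (cauchy_int \<mu> z))\<^sup>2 * (1 - (cmod (z * eta_quot \<mu> z))\<^sup>2)"
    by (rule mult_right_mono[rotated])
  also have "\<dots> = (1 - (cmod z)\<^sup>2) * cauchy_sq \<mu> z" by (rule m.eta_defect[OF z])
  finally show ?thesis by (simp add: power2_eq_square mult_ac)
qed

text \<open>
  Everything follows from \<open>\<bar>w\<^sub>1\<bar> \<bar>w\<^sub>2\<bar> = \<bar>z\<bar> \<bar>\<eta>\<^sub>\<mu>(z)\<bar>\<close> and \<open>\<bar>w\<^sub>j\<bar> \<le> \<bar>z\<bar>\<close>: the latter gives \<open>\<bar>\<eta>\<^sub>\<mu>(z)\<bar> \<le> \<bar>w\<^sub>j\<bar>\<close>, and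
  with \<open>p = 1 - \<bar>w\<^sub>1\<bar>\<^sup>2\<close>, \<open>q = 1 - \<bar>w\<^sub>2\<bar>\<^sup>2\<close> the former gives \<open>p + q \<ge> 1 - \<bar>z\<bar>\<^sup>2 \<bar>\<eta>\<^sub>\<mu>(z)\<bar>\<^sup>2\<close>.
\<close>

lemma solution_defect:
  assumes s: "solution z w1 w2" and z: "0 < cmod z" "cmod z < 1"
  shows "1 - (cmod w1)\<^sup>2 \<le> 4 * cauchy_sq \<mu> z * (1 - (cmod z)\<^sup>2)"
    and "1 - (cmod w2)\<^sup>2 \<le> 4 * cauchy_sq \<mu> z * (1 - (cmod z)\<^sup>2)"
    and "(cmod z)\<^sup>2 * ((1 - (cmod z)\<^sup>2) * cauchy_sq \<mu> z)
      \<le> (cmod (cauchy_int \<mu> z))\<^sup>2 * ((1 - (cmod w1)\<^sup>2) + (1 - (cmod w2)\<^sup>2))"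
proof -
  define e where "e = z * eta_quot \<mu> z"
  have prod: "cmod w1 * cmod w2 = cmod z * cmod e"
    using arg_cong[OF solution_product[OF s z], of cmod] by (simp add: e_def norm_mult)
  have le: "cmod w1 \<le> cmod z" "cmod w2 \<le> cmod z"
    using s unfolding solution_def by blast+
  have "cmod z * cmod e \<le> cmod z * cmod w1"
    unfolding prod[symmetric] using mult_left_mono[OF le(2), of "cmod w1"] by (simp add: mult.commute)
  then have "cmod e \<le> cmod w1" using z by simp
  moreover have "cmod z * cmod e \<le> cmod z * cmod w2"
    unfolding prod[symmetric] using mult_right_mono[OF le(1), of "cmod w2"] by simp
  then have "cmod e \<le> cmod w2" using z by simp
  ultimately have e2: "(cmod e)\<^sup>2 \<le> (cmod w1)\<^sup>2" "(cmod e)\<^sup>2 \<le> (cmod w2)\<^sup>2"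
    by (auto intro: power_mono)
  show "1 - (cmod w1)\<^sup>2 \<le> 4 * cauchy_sq \<mu> z * (1 - (cmod z)\<^sup>2)"
    "1 - (cmod w2)\<^sup>2 \<le> 4 * cauchy_sq \<mu> z * (1 - (cmod z)\<^sup>2)"
    using eta_defect_le[OF z(2)] e2 unfolding e_def by linarith+
  define p q where "p = 1 - (cmod w1)\<^sup>2" and "q = 1 - (cmod w2)\<^sup>2"
  have pq: "0 \<le> p" "0 \<le> q" unfolding p_def q_def
    using one_minus_sq_pos[OF solution_less(1)[OF s z]] one_minus_sq_pos[OF solution_less(2)[OF s z]] by auto
  have z2: "(cmod z)\<^sup>2 \<le> 1" using z by (simp add: abs_square_le_1)
  have "(1 - p) * (1 - q) = (cmod z)\<^sup>2 * (cmod e)\<^sup>2"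
    using prod by (simp add: p_def q_def flip: power_mult_distrib)
  then have "p + q = p * q + 1 - (cmod z)\<^sup>2 * (cmod e)\<^sup>2" by (simp add: algebra_simps)
  moreover have "0 \<le> p * q" using pq by simp
  ultimately have "(cmod z)\<^sup>2 * (1 - (cmod e)\<^sup>2) \<le> p + q" using z2 by (simp add: algebra_simps)
  from mult_left_mono[OF this, of "(cmod (cauchy_int \<mu> z))\<^sup>2"]
  have "(cmod z)\<^sup>2 * ((cmod (cauchy_int \<mu> z))\<^sup>2 * (1 - (cmod e)\<^sup>2)) \<le> (cmod (cauchy_int \<mu> z))\<^sup>2 * (p + q)"
    by (simp add: mult_ac)
  then show "(cmod z)\<^sup>2 * ((1 - (cmod z)\<^sup>2) * cauchy_sq \<mu> z)
      \<le> (cmod (cauchy_int \<mu> z))\<^sup>2 * ((1 - (cmod w1)\<^sup>2) + (1 - (cmod w2)\<^sup>2))"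
    unfolding e_def m.eta_defect[OF z(2)] p_def q_def .
qed

text \<open>
  The last inequality is \<open>solution_defect\<close> rewritten with
  \<open>(1 - \<bar>\<omega>\<^sub>j(z)\<bar>\<^sup>2) \<integral> \<bar>1 - \<omega>\<^sub>j(z) t\<bar>\<^sup>-\<^sup>2 d\<mu>\<^sub>j = 2 Re \<gamma> - 1\<close>, which takes the same value for \<open>\<mu>\<^sub>1\<close>, \<open>\<mu>\<^sub>2\<close> and \<open>\<mu>\<close>.
\<close>

theorem subordination_maps_exist:
  "\<exists>\<omega>1 \<omega>2. subordination_map \<mu> \<mu>1 \<omega>1 \<and> subordination_map \<mu> \<mu>2 \<omega>2 \<and>
    (\<forall>z. 0 < cmod z \<longrightarrow> cmod z < 1 \<longrightarrow>
      (cmod z)\<^sup>2 \<le> (cmod (cauchy_int \<mu> z))\<^sup>2 / cauchy_sq \<mu>1 (\<omega>1 z) + (cmod (cauchy_int \<mu> z))\<^sup>2 / cauchy_sq \<mu>2 (\<omega>2 z))"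
proof -
  have "\<forall>z. \<exists>p. 0 < cmod z \<longrightarrow> cmod z < 1 \<longrightarrow> solution z (fst p) (snd p)"
    using solution_exists by (metis fst_conv snd_conv)
  from choice[OF this] obtain P
    where P: "\<forall>z. 0 < cmod z \<longrightarrow> cmod z < 1 \<longrightarrow> solution z (fst (P z)) (snd (P z))"
    by (elim exE)
  define \<omega>1 \<omega>2 where "\<omega>1 = (\<lambda>z. fst (P z))" and "\<omega>2 = (\<lambda>z. snd (P z))"
  have s: "solution z (\<omega>1 z) (\<omega>2 z)" if "0 < cmod z" "cmod z < 1" for z
    unfolding \<omega>1_def \<omega>2_def using P that by simp
  have le: "cmod (\<omega>1 z) \<le> cmod z" "cmod (\<omega>2 z) \<le> cmod z" if "0 < cmod z" "cmod z < 1" for z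
    using s[OF that] unfolding solution_def by blast+
  have "subordination_map \<mu> \<mu>1 \<omega>1"
    unfolding subordination_map_def
    using le(1) solution_cauchy_int(1)[OF s] solution_defect(1)[OF s] solution_contraction(1)[OF s s] by simp
  moreover have "subordination_map \<mu> \<mu>2 \<omega>2"
    unfolding subordination_map_def
    using le(2) solution_cauchy_int(2)[OF s] solution_defect(2)[OF s] solution_contraction(2)[OF s s] by simp
  moreover have "(cmod z)\<^sup>2 \<le> (cmod (cauchy_int \<mu> z))\<^sup>2 / cauchy_sq \<mu>1 (\<omega>1 z) + (cmod (cauchy_int \<mu> z))\<^sup>2 / cauchy_sq \<mu>2 (\<omega>2 z)"
    if z: "0 < cmod z" "cmod z < 1" for z
  proof -
    note lt = solution_less[OF s[OF z] z]
    define S where "S = (1 - (cmod z)\<^sup>2) * cauchy_sq \<mu> z"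
    have S: "S > 0" unfolding S_def
      using one_minus_sq_pos[OF z(2)] m.cauchy_sq_ge[OF z(2)] by (intro mult_pos_pos) auto
    have q: "cauchy_sq \<mu>1 (\<omega>1 z) > 0" "cauchy_sq \<mu>2 (\<omega>2 z) > 0"
      using m1.cauchy_sq_ge[OF lt(1)] m2.cauchy_sq_ge[OF lt(2)] by auto
    have "(1 - (cmod (\<omega>1 z))\<^sup>2) * cauchy_sq \<mu>1 (\<omega>1 z) = S" "(1 - (cmod (\<omega>2 z))\<^sup>2) * cauchy_sq \<mu>2 (\<omega>2 z) = S"
      using m1.cauchy_sq_cauchy_int[OF lt(1)] m2.cauchy_sq_cauchy_int[OF lt(2)] m.cauchy_sq_cauchy_int[OF z(2)] solution_cauchy_int[OF s[OF z] z]
      by (simp_all add: S_def)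
    then have "1 - (cmod (\<omega>1 z))\<^sup>2 = S / cauchy_sq \<mu>1 (\<omega>1 z)" "1 - (cmod (\<omega>2 z))\<^sup>2 = S / cauchy_sq \<mu>2 (\<omega>2 z)"
      using q by (simp_all only: eq_divide_eq) auto
    then have "(cmod z)\<^sup>2 * S \<le> (cmod (cauchy_int \<mu> z))\<^sup>2 * (S / cauchy_sq \<mu>1 (\<omega>1 z) + S / cauchy_sq \<mu>2 (\<omega>2 z))"
      using solution_defect(3)[OF s[OF z] z] by (simp only: S_def)
    also have "\<dots> = ((cmod (cauchy_int \<mu> z))\<^sup>2 / cauchy_sq \<mu>1 (\<omega>1 z) + (cmod (cauchy_int \<mu> z))\<^sup>2 / cauchy_sq \<mu>2 (\<omega>2 z)) * S"
      by (simp add: algebra_simps)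
    finally show ?thesis using S by (simp only: mult_le_cancel_right_pos)
  qed
  ultimately show ?thesis by blast
qed

end

section \<open>Arcs of the circle\<close>

lemma circle_cis_range:
  assumes "cmod t = 1"
  shows "\<exists>s. c < s \<and> s \<le> c + 2 * pi \<and> t = cis s"
proof -
  define x where "x = (Arg t - c) / (2 * pi)"
  define k where "k = real_of_int (\<lceil>x\<rceil> - 1)"
  define s where "s = Arg t - 2 * pi * k"
  have "k < x" "x \<le> k + 1" unfolding k_def by linarith+
  moreover have "2 * pi * x = Arg t - c" by (simp add: x_def)
  then have "s = c + 2 * pi * (x - k)" by (simp add: s_def right_diff_distrib)
  ultimately have "c < s \<and> s \<le> c + 2 * pi"
    using mult_left_mono[of "x - k" 1 "2 * pi"] by simp
  moreover have "t = cis s"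
  proof -
    have "cis (2 * pi * k) = 1" by (rule cis_multiple_2pi) (simp add: k_def)
    then have "cis s = cis (Arg t)" by (simp add: s_def flip: cis_divide)
    also have "\<dots> = t" using rcis_cmod_Arg[of t] assms by (simp add: rcis_def)
    finally show ?thesis by simp
  qed
  ultimately show ?thesis by blast
qed

lemma cmod_one_minus_cis: "cmod (1 - cis \<theta>) = 2 * \<bar>sin (\<theta> / 2)\<bar>"
proof -
  have c: "cos \<theta> = 1 - 2 * (sin (\<theta> / 2))\<^sup>2" using cos_double_sin[of "\<theta> / 2"] by simp
  have "(cmod (1 - cis \<theta>))\<^sup>2 = 2 - 2 * cos \<theta>"
    unfolding cmod_power2 using sin_cos_squared_add[of \<theta>]
    by (simp add: power2_eq_square algebra_simps)
  also have "\<dots> = (2 * \<bar>sin (\<theta> / 2)\<bar>)\<^sup>2" by (simp add: c power_mult_distrib)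
  finally show ?thesis by (rule power2_eq_imp_eq) auto
qed

lemma cmod_one_minus_cis_le: "cmod (1 - cis \<theta>) \<le> \<bar>\<theta>\<bar>"
  using abs_sin_x_le_abs_x[of "\<theta> / 2"] by (simp add: cmod_one_minus_cis)

lemma cis_neq_one: "0 < \<theta> \<Longrightarrow> \<theta> < 2 * pi \<Longrightarrow> cis \<theta> \<noteq> 1"
  using cmod_one_minus_cis[of \<theta>] sin_gt_zero[of "\<theta> / 2"] by auto

lemma cis_neq: "x < y \<Longrightarrow> y < x + 2 * pi \<Longrightarrow> cis x \<noteq> cis y"
  using cis_neq_one[of "y - x"] cis_divide[of y x] by (auto simp: cis_neq_zero)

lemma strict_mono_limits:
  fixes \<phi> :: "real \<Rightarrow> real"
  assumes "p < q" and mono: "strict_mono_on {p<..<q} \<phi>" and cont: "continuous_on {p<..<q} \<phi>"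
    and bound: "\<And>x y. x \<in> {p<..<q} \<Longrightarrow> y \<in> {p<..<q} \<Longrightarrow> \<phi> y - \<phi> x \<le> B"
  shows "\<exists>L R. L < R \<and> R - L \<le> B \<and> (\<phi> \<longlongrightarrow> L) (at_right p) \<and> (\<phi> \<longlongrightarrow> R) (at_left q)
    \<and> {L<..<R} \<subseteq> \<phi> ` {p<..<q}"
proof -
  let ?X = "{p<..<q}"
  define L R where "L = Inf (\<phi> ` ?X)" and "R = Sup (\<phi> ` ?X)"
  obtain x1 x2 where x12: "x1 \<in> ?X" "x2 \<in> ?X" "x1 < x2"
    using dense[OF \<open>p < q\<close>] dense by (metis greaterThanLessThan_iff less_trans)
  have lt: "\<phi> x < \<phi> y" if "x \<in> ?X" "y \<in> ?X" "x < y" for x y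
    using mono that by (simp add: strict_mono_on_def)
  have bb: "bdd_below (\<phi> ` ?X)"
    by (rule bdd_belowI2[of _ "\<phi> x1 - B"]) (use bound x12(1) in \<open>auto simp: algebra_simps\<close>)
  have ba: "bdd_above (\<phi> ` ?X)"
    by (rule bdd_aboveI2[of _ _ "\<phi> x1 + B"]) (use bound[OF x12(1)] in \<open>auto simp: algebra_simps\<close>)
  have L: "L \<le> \<phi> x" and R: "\<phi> x \<le> R" if "x \<in> ?X" for x
    unfolding L_def R_def using that bb ba by (auto intro: cINF_lower cSUP_upper)
  have ne: "\<phi> ` ?X \<noteq> {}" using x12 by blast
  have L': "\<exists>x\<in>?X. \<phi> x < e" if "L < e" for e
    using that cInf_less_iff[OF ne bb, of e] by (auto simp: L_def)
  have R': "\<exists>x\<in>?X. e < \<phi> x" if "e < R" for e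
    using that less_cSup_iff[OF ne ba, of e] by (auto simp: R_def)
  have "L < R" using L[OF x12(1)] R[OF x12(2)] lt[OF x12] by linarith
  moreover have "R - L \<le> B"
  proof -
    have "R \<le> \<phi> x + B" if "x \<in> ?X" for x
      unfolding R_def using bound[OF that] x12 by (intro cSUP_least) (auto simp: algebra_simps)
    then have "R - B \<le> L" unfolding L_def using x12 by (intro cINF_greatest) (auto simp: algebra_simps)
    then show ?thesis by simp
  qed
  moreover have "(\<phi> \<longlongrightarrow> L) (at_right p)"
  proof (rule order_tendstoI)
    fix e assume "e < L"
    then show "\<forall>\<^sub>F x in at_right p. e < \<phi> x"
      unfolding eventually_at_right[OF \<open>p < q\<close>]
      using L \<open>p < q\<close> by (intro exI[of _ q]) (auto intro: less_le_trans)
  next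
    fix e assume "L < e"
    then obtain x0 where x0: "x0 \<in> ?X" "\<phi> x0 < e" using L' by blast
    then have "\<phi> x < e" if "p < x" "x < x0" for x using lt[of x x0] that by auto
    then show "\<forall>\<^sub>F x in at_right p. \<phi> x < e"
      using eventually_at_right[of p x0] x0 by auto
  qed
  moreover have "(\<phi> \<longlongrightarrow> R) (at_left q)"
  proof (rule order_tendstoI)
    fix e assume "R < e"
    then show "\<forall>\<^sub>F x in at_left q. \<phi> x < e"
      unfolding eventually_at_left[OF \<open>p < q\<close>]
      using R \<open>p < q\<close> by (intro exI[of _ p]) (auto intro: le_less_trans)
  next
    fix e assume "e < R"
    then obtain x0 where x0: "x0 \<in> ?X" "e < \<phi> x0" using R' by blast
    then have "e < \<phi> x" if "x0 < x" "x < q" for x using lt[of x0 x] that by auto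
    then show "\<forall>\<^sub>F x in at_left q. e < \<phi> x"
      using eventually_at_left[of x0 q] x0 by auto
  qed
  moreover have "{L<..<R} \<subseteq> \<phi> ` ?X"
  proof
    fix y assume y: "y \<in> {L<..<R}"
    then have "L < y" "y < R" by auto
    then obtain u v where uv: "u \<in> ?X" "\<phi> u < y" "v \<in> ?X" "y < \<phi> v"
      using L'[of y] R'[of y] by blast
    then have "u < v" by (cases u v rule: linorder_cases) (use lt[of v u] in auto)
    moreover have "continuous_on {u..v} \<phi>"
      by (rule continuous_on_subset[OF cont]) (use uv in auto)
    ultimately obtain x where "u \<le> x" "x \<le> v" "\<phi> x = y"
      using IVT'[of \<phi> u y v] uv by auto
    then show "y \<in> \<phi> ` ?X" using uv by auto
  qed
  ultimately show ?thesis by blast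
qed

text \<open>
  Lifted to the line, the curve is monotone of total variation at most \<open>2 \<pi>\<close>, so it has limits at both ends.
  If these limits agree on the circle, then the variation is exactly \<open>2 \<pi>\<close> and only one point is missed.
\<close>

lemma injective_circle_arc_ends:
  fixes \<gamma> :: "real \<Rightarrow> complex"
  assumes "p < q" and cont: "continuous_on {p<..<q} \<gamma>" and inj: "inj_on \<gamma> {p<..<q}"
    and circ: "\<And>x. x \<in> {p<..<q} \<Longrightarrow> cmod (\<gamma> x) = 1"
  shows "\<exists>v v'. cmod v = 1 \<and> cmod v' = 1 \<and> (\<gamma> \<longlongrightarrow> v) (at_right p) \<and> (\<gamma> \<longlongrightarrow> v') (at_left q) \<and>
    (v = v' \<longrightarrow> (\<exists>l. v = cis l \<and> cis ` {l<..<l + 2 * pi} \<subseteq> \<gamma> ` {p<..<q}))"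
proof -
  let ?X = "{p<..<q}"
  have "contractible ?X" by (intro convex_imp_contractible) simp
  moreover have "\<gamma> x \<noteq> 0" if "x \<in> ?X" for x using circ[OF that] by auto
  ultimately obtain g where g: "continuous_on ?X g" "\<And>x. x \<in> ?X \<Longrightarrow> \<gamma> x = exp (g x)"
    using continuous_logarithm_on_contractible[OF cont] by blast
  define \<phi> where "\<phi> = (\<lambda>x. Im (g x))"
  have \<gamma>: "\<gamma> x = cis (\<phi> x)" if "x \<in> ?X" for x
  proof -
    have "exp (Re (g x)) = 1" using circ[OF that] g(2)[OF that] by simp
    then show ?thesis using g(2)[OF that] by (simp add: exp_eq_polar \<phi>_def)
  qed
  have c\<phi>: "continuous_on ?X \<phi>" unfolding \<phi>_def by (intro continuous_intros g(1))
  have i\<phi>: "inj_on \<phi> ?X" using inj \<gamma> unfolding inj_on_def by metis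
  have bd: "\<bar>\<phi> y - \<phi> x\<bar> \<le> 2 * pi" if xy: "x \<in> ?X" "y \<in> ?X" for x y
  proof (rule ccontr)
    assume *: "\<not> ?thesis"
    have "connected (\<phi> ` ?X)" by (intro connected_continuous_image c\<phi>) simp
    then have iv: "is_interval (\<phi> ` ?X)" by (simp add: is_interval_connected_1)
    obtain s where s: "s = 1 \<or> s = - 1" "2 * pi < s * (\<phi> y - \<phi> x)"
      using * that by (metis abs_if mult_1 mult_minus1 not_le)
    have "s = 1 \<and> 2 * pi < \<phi> y - \<phi> x \<or> s = - 1 \<and> 2 * pi < \<phi> x - \<phi> y" using s by auto
    then have sgn: "s = 1 \<and> \<phi> x \<le> \<phi> y \<and> \<phi> x + 2 * pi \<le> \<phi> y
        \<or> s = - 1 \<and> \<phi> y \<le> \<phi> x \<and> \<phi> y \<le> \<phi> x - 2 * pi"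
      using pi_gt_zero by linarith
    \<comment> \<open>As an interval, the range contains a value exactly one turn away, against injectivity on the circle.\<close>
    have "\<phi> x + s * (2 * pi) \<in> \<phi> ` ?X"
    proof (rule iv[unfolded is_interval_1, rule_format])
      show "min (\<phi> x) (\<phi> y) \<in> \<phi> ` ?X" "max (\<phi> x) (\<phi> y) \<in> \<phi> ` ?X" using xy by (auto simp: min_def max_def)
      show "min (\<phi> x) (\<phi> y) \<le> \<phi> x + s * (2 * pi) \<and> \<phi> x + s * (2 * pi) \<le> max (\<phi> x) (\<phi> y)"
        using sgn by (auto simp: min_def max_def)
    qed
    then obtain w where w: "w \<in> ?X" "\<phi> w = \<phi> x + s * (2 * pi)" by auto
    have "cis (s * (2 * pi)) = 1" using s(1) by (auto simp flip: cis_cnj)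
    then have "cis (\<phi> w) = cis (\<phi> x)" unfolding w(2) by (simp flip: cis_mult)
    then have "w = x" using \<gamma> inj w(1) xy(1) by (auto simp: inj_on_def)
    then show False using w(2) s(1) by auto
  qed
  have key: "cis L = cis R \<Longrightarrow> L < R \<Longrightarrow> R - L \<le> 2 * pi \<Longrightarrow> R = L + 2 * pi" for L R
    using cis_neq[of L R] by (cases "R < L + 2 * pi") auto
  have lim: "(\<gamma> \<longlongrightarrow> cis e) F"
    if "(\<phi> \<longlongrightarrow> e) F" "\<forall>\<^sub>F x in F. x \<in> ?X" for e F
  proof (rule Lim_transform_eventually)
    show "((\<lambda>x. cis (\<phi> x)) \<longlongrightarrow> cis e) F" by (intro tendsto_intros that)
    show "\<forall>\<^sub>F x in F. cis (\<phi> x) = \<gamma> x" using that(2) by eventually_elim (simp add: \<gamma>)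
  qed
  have ev: "\<forall>\<^sub>F x in at_right p. x \<in> ?X" "\<forall>\<^sub>F x in at_left q. x \<in> ?X"
    using \<open>p < q\<close> by (auto simp: eventually_at_right eventually_at_left)
  have im: "cis ` {l<..<l + 2 * pi} \<subseteq> \<gamma> ` ?X" if "{l<..<l + 2 * pi} \<subseteq> \<phi> ` ?X" for l
    using that \<gamma> by force
  from i\<phi> consider "strict_mono_on ?X \<phi>" | "strict_antimono_on ?X \<phi>"
    using injective_eq_monotone_map[of ?X \<phi>] c\<phi> by (auto simp: is_interval_oo)
  then show ?thesis
  proof cases
    case 1
    then obtain L R where LR: "L < R" "R - L \<le> 2 * pi" "(\<phi> \<longlongrightarrow> L) (at_right p)" "(\<phi> \<longlongrightarrow> R) (at_left q)"
      "{L<..<R} \<subseteq> \<phi> ` ?X"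
      using strict_mono_limits[OF \<open>p < q\<close> 1 c\<phi>, of "2 * pi"] bd by (smt (verit))
    show ?thesis
    proof (rule exI[of _ "cis L"], rule exI[of _ "cis R"], intro conjI impI)
      assume "cis L = cis R"
      then have "R = L + 2 * pi" by (rule key[OF _ LR(1,2)])
      then show "\<exists>l. cis L = cis l \<and> cis ` {l<..<l + 2 * pi} \<subseteq> \<gamma> ` ?X"
        using im[of L] LR(5) by blast
    qed (use lim[OF LR(3) ev(1)] lim[OF LR(4) ev(2)] in simp_all)
  next
    case 2
    then have "strict_mono_on ?X (\<lambda>x. - \<phi> x)" by (auto simp: monotone_on_def)
    moreover have "continuous_on ?X (\<lambda>x. - \<phi> x)" by (intro continuous_intros c\<phi>)
    ultimately obtain L R where LR: "L < R" "R - L \<le> 2 * pi" "((\<lambda>x. - \<phi> x) \<longlongrightarrow> L) (at_right p)"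
      "((\<lambda>x. - \<phi> x) \<longlongrightarrow> R) (at_left q)" "{L<..<R} \<subseteq> (\<lambda>x. - \<phi> x) ` ?X"
      using strict_mono_limits[OF \<open>p < q\<close>, of "\<lambda>x. - \<phi> x" "2 * pi"] bd by (smt (verit))
    have l: "(\<phi> \<longlongrightarrow> - L) (at_right p)" "(\<phi> \<longlongrightarrow> - R) (at_left q)"
      using tendsto_minus[OF LR(3)] tendsto_minus[OF LR(4)] by simp_all
    have "{- R<..<- L} \<subseteq> \<phi> ` ?X"
    proof
      fix y assume "y \<in> {- R<..<- L}"
      then have "- y \<in> {L<..<R}" by auto
      then obtain x where "x \<in> ?X" "- y = - \<phi> x" using LR(5) by blast
      then show "y \<in> \<phi> ` ?X" by auto
    qed
    note sub = this
    show ?thesis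
    proof (rule exI[of _ "cis (- L)"], rule exI[of _ "cis (- R)"], intro conjI impI)
      assume eq: "cis (- L) = cis (- R)"
      then have "- L = - R + 2 * pi" using key[of "- R" "- L"] LR(1,2) by simp
      then show "\<exists>l. cis (- L) = cis l \<and> cis ` {l<..<l + 2 * pi} \<subseteq> \<gamma> ` ?X"
        using im[of "- R"] sub eq by (intro exI[of _ "- R"]) simp
    qed (use lim[OF l(1) ev(1)] lim[OF l(2) ev(2)] in simp_all)
  qed
qed

section \<open>Flat points\<close>

context circle_measure
begin

lemma closed_arc: "cis ` {c..d} \<in> sets \<nu>"
  by (intro closed_sets compact_imp_closed compact_continuous_image continuous_intros) auto

lemma flat_set: "{t \<in> circle. cmod (1 - w * t) \<le> e} \<in> sets \<nu>"
proof (intro closed_sets)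
  have "closed (circle \<inter> {t. cmod (1 - w * t) \<le> e})"
    by (intro closed_Int closed_sphere closed_Collect_le continuous_intros)
  moreover have "{t \<in> circle. cmod (1 - w * t) \<le> e} = circle \<inter> {t. cmod (1 - w * t) \<le> e}"
    by blast
  ultimately show "closed {t \<in> circle. cmod (1 - w * t) \<le> e}" by simp
qed auto

text \<open>
  The distribution function of \<open>\<nu>\<close> along the arc has derivative \<open>0\<close> at every point, hence is constant.
  The constant \<open>K\<close> may depend on the point, as it does for boundary values near the ends of the gap.
\<close>

lemma flat_arc_null:
  assumes flat: "\<And>y. l < y \<Longrightarrow> y < u \<Longrightarrow>
    \<exists>K. \<forall>e>0. measure \<nu> {t \<in> circle. cmod (1 - cis y * t) \<le> e} \<le> K * e\<^sup>2"
  shows "cis ` {- u<..<- l} \<in> null_sets \<nu>"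
proof -
  have closed: "measure \<nu> (cis ` {- d..- c}) = 0" if cd: "l < c" "c \<le> d" "d < u" for c d
  proof -
    define F where "F = (\<lambda>y. measure \<nu> (cis ` {- y..- c}))"
    have arc: "\<exists>K. \<forall>y'. measure \<nu> (cis ` {- max y y'..- min y y'}) \<le> K * (y' - y)\<^sup>2"
      if y: "y \<in> {c..d}" for y
    proof -
      obtain K where K: "\<And>e. e > 0 \<Longrightarrow> measure \<nu> {t \<in> circle. cmod (1 - cis y * t) \<le> e} \<le> K * e\<^sup>2"
        using flat[of y] y cd by auto
      have sub: "measure \<nu> (cis ` {- max y y'..- min y y'}) \<le> K * e\<^sup>2" if e: "\<bar>y' - y\<bar> \<le> e" "0 < e" for y' e
      proof -
        have "cis ` {- max y y'..- min y y'} \<subseteq> {t \<in> circle. cmod (1 - cis y * t) \<le> e}"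
        proof safe
          fix s assume s: "s \<in> {- max y y'..- min y y'}"
          have "cmod (1 - cis y * cis s) \<le> \<bar>y + s\<bar>"
            using cmod_one_minus_cis_le[of "y + s"] by (simp add: cis_mult)
          also have "\<dots> \<le> e" using s e by (auto simp: max_def min_def split: if_splits)
          finally show "cmod (1 - cis y * cis s) \<le> e" .
        qed auto
        then show ?thesis
          using K[OF e(2)] finite_measure_mono[OF _ flat_set] by (meson order_trans)
      qed
      show ?thesis
      proof (intro exI[of _ K] allI)
        fix y'
        show "measure \<nu> (cis ` {- max y y'..- min y y'}) \<le> K * (y' - y)\<^sup>2"
        proof (cases "y' = y")
          case False
          then show ?thesis using sub[of y' "\<bar>y' - y\<bar>"] by simp
        next
          case True
          have "(\<lambda>n. K * (inverse (real (Suc n)))\<^sup>2) \<longlonglongrightarrow> K * 0\<^sup>2"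
            by (intro tendsto_intros LIMSEQ_inverse_real_of_nat)
          then show ?thesis
            using sub[of y'] True by (intro LIMSEQ_le_const) auto
        qed
      qed
    qed
    have diff: "\<bar>F y' - F y\<bar> \<le> measure \<nu> (cis ` {- max y y'..- min y y'})"
      if "y \<in> {c..d}" "y' \<in> {c..d}" for y y'
    proof -
      have *: "F q \<le> F p + measure \<nu> (cis ` {- q..- p})" "F p \<le> F q" if "c \<le> p" "p \<le> q" for p q
      proof -
        have "cis ` {- q..- c} \<subseteq> cis ` {- p..- c} \<union> cis ` {- q..- p}"
          unfolding image_Un[symmetric] using that by (intro image_mono) auto
        then have "F q \<le> measure \<nu> (cis ` {- p..- c} \<union> cis ` {- q..- p})"
          unfolding F_def by (intro finite_measure_mono sets.Un closed_arc)
        also have "\<dots> \<le> F p + measure \<nu> (cis ` {- q..- p})"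
          unfolding F_def by (intro measure_Un_le closed_arc)
        finally show "F q \<le> F p + measure \<nu> (cis ` {- q..- p})" .
        show "F p \<le> F q"
          unfolding F_def using that by (intro finite_measure_mono closed_arc image_mono) auto
      qed
      show ?thesis
        using *[of y y'] *[of y' y] that by (cases "y \<le> y'") (auto simp: max_def min_def)
    qed
    have "(F has_field_derivative 0) (at y within {c..d})" if y: "y \<in> {c..d}" for y
    proof -
      obtain K where K: "\<And>y'. measure \<nu> (cis ` {- max y y'..- min y y'}) \<le> K * (y' - y)\<^sup>2"
        using arc[OF y] by blast
      have "\<forall>\<^sub>F y' in at y within {c..d}. norm ((F y' - F y) / (y' - y)) \<le> K * \<bar>y' - y\<bar>"
        unfolding eventually_at_filter
      proof (intro always_eventually allI impI)
        fix y' assume y': "y' \<noteq> y" "y' \<in> {c..d}"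
        have "\<bar>F y' - F y\<bar> \<le> K * \<bar>y' - y\<bar> * \<bar>y' - y\<bar>"
          using diff[OF y y'(2)] K[of y'] by (simp add: power2_eq_square mult.assoc)
        then show "norm ((F y' - F y) / (y' - y)) \<le> K * \<bar>y' - y\<bar>"
          using y'(1) by (simp add: pos_divide_le_eq)
      qed
      moreover have "((\<lambda>y'. K * \<bar>y' - y\<bar>) \<longlongrightarrow> K * \<bar>y - y\<bar>) (at y within {c..d})"
        by (intro tendsto_intros)
      then have "((\<lambda>y'. K * \<bar>y' - y\<bar>) \<longlongrightarrow> 0) (at y within {c..d})" by simp
      ultimately have "((\<lambda>y'. (F y' - F y) / (y' - y)) \<longlongrightarrow> 0) (at y within {c..d})"
        by (rule Lim_null_comparison)
      then show ?thesis by (simp add: has_field_derivative_iff)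
    qed
    then have "\<exists>k. \<forall>y\<in>{c..d}. F y = k" by (intro has_field_derivative_zero_constant) auto
    then have "F d = F c" using cd by fastforce
    moreover have "F c \<le> 0"
    proof -
      have "c \<in> {c..d}" using cd by simp
      from arc[OF this] obtain K where "\<forall>y'. measure \<nu> (cis ` {- max c y'..- min c y'}) \<le> K * (y' - c)\<^sup>2"
        by (elim exE)
      from spec[OF this, of c] show ?thesis by (simp add: F_def)
    qed
    ultimately show ?thesis
      using measure_nonneg[of \<nu> "cis ` {- d..- c}"] unfolding F_def by linarith
  qed
  show ?thesis
  proof (cases "l < u")
    case True
    \<comment> \<open>The denominator \<open>n + 2\<close> keeps these closed arcs nonempty from the start.\<close>
    define A where "A = (\<lambda>n::nat. cis ` {- (u - (u - l) / (real n + 2))..- (l + (u - l) / (real n + 2))})"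
    have "A n \<in> null_sets \<nu>" for n
    proof -
      define h where "h = (u - l) / (real n + 2)"
      have "h > 0" unfolding h_def using True by simp
      moreover have "h \<le> (u - l) / 2"
        unfolding h_def using True by (intro divide_left_mono) auto
      ultimately have "h > 0" "h \<le> (u - l) / 2" by blast+
      then have "measure \<nu> (A n) = 0" unfolding A_def h_def[symmetric] by (intro closed) auto
      then show ?thesis
        by (intro null_setsI) (auto simp: A_def emeasure_eq_measure closed_arc)
    qed
    then have "(\<Union>n. A n) \<in> null_sets \<nu>" by (intro null_sets_UN') auto
    moreover have "cis ` {- u<..<- l} \<subseteq> (\<Union>n. A n)"
    proof safe
      fix s assume s: "s \<in> {- u<..<- l}"
      define m where "m = min (u + s) (- l - s)"
      have m: "m > 0" using s by (simp add: m_def)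
      obtain n where n: "(u - l) / m < real n" using reals_Archimedean2 by blast
      then have "(u - l) / (real n + 2) \<le> m" using m True by (simp add: field_simps)
      then have "s \<in> {- (u - (u - l) / (real n + 2))..- (l + (u - l) / (real n + 2))}"
        by (auto simp: m_def)
      then show "cis s \<in> (\<Union>n. A n)" unfolding A_def by blast
    qed
    moreover have "(\<Union>n. A n) \<subseteq> cis ` {- u<..<- l}"
    proof -
      have "A n \<subseteq> cis ` {- u<..<- l}" for n
      proof -
        have "(u - l) / (real n + 2) > 0" using True by simp
        then show ?thesis unfolding A_def by (intro image_mono) auto
      qed
      then show ?thesis by blast
    qed
    ultimately show ?thesis by (metis subset_antisym)
  qed auto
qed

lemma flat_off_point:
  assumes "\<And>y. l < y \<Longrightarrow> y < l + 2 * pi \<Longrightarrow>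
    \<exists>K. \<forall>e>0. measure \<nu> {t \<in> circle. cmod (1 - cis y * t) \<le> e} \<le> K * e\<^sup>2"
  shows "point_mass \<nu>"
proof (rule point_massI)
  have "cis ` {- (l + 2 * pi)<..<- l} \<in> null_sets \<nu>" by (rule flat_arc_null) (fact assms)
  then have "AE t in \<nu>. t \<notin> cis ` {- (l + 2 * pi)<..<- l}" by (rule AE_not_in)
  moreover have "AE t in \<nu>. cmod t = 1" by (rule AE_I2) simp
  ultimately show "AE t in \<nu>. t = cis (- l)"
  proof eventually_elim
    case (elim t)
    obtain s where s: "- (l + 2 * pi) < s" "s \<le> - (l + 2 * pi) + 2 * pi" "t = cis s"
      using circle_cis_range[OF elim(2)] by blast
    then have "s = - l" using elim(1) by (cases "s < - l") auto
    then show ?case using s by simp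
  qed
qed simp

end

section \<open>Boundary behaviour over a null arc\<close>

text \<open>
  The points of \<open>1/J\<close> are parametrized as \<open>cis x\<close> with \<open>- b < x < - a\<close>, the points of the complement of \<open>J\<close> as
  \<open>cis s\<close> with \<open>b \<le> s \<le> a + 2 \<pi>\<close>.
\<close>

locale null_arc =
  m: circle_measure \<mu> + n: circle_measure \<nu> for \<mu> \<nu> +
  fixes \<omega> :: "complex \<Rightarrow> complex" and a b :: real
  assumes map: "subordination_map \<mu> \<nu> \<omega>"
    and ab: "a < b" "b \<le> a + 2 * pi"
    and null: "measure \<mu> (cis ` {a<..<b}) = 0"
begin

definition far_arc :: "complex set" where "far_arc = cis ` {b..a + 2 * pi}"
definition gap :: "real set" where "gap = {- b<..<- a}"
text \<open>
  The distance from the conjugate of \<open>cis x\<close> to the complement of \<open>J\<close>, which carries \<open>\<mu>\<close>. The factor \<open>16\<close> below is \<open>4\<close> from the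
  halving in \<open>dist_far_arc_radial\<close> times \<open>4\<close> from the definition of \<open>subordination_map\<close>.
\<close>

definition gap_dist :: "real \<Rightarrow> real" where "gap_dist x = infdist (cis (- x)) far_arc"
definition gap_bound :: "real \<Rightarrow> real" where "gap_bound x = 16 / (gap_dist x)\<^sup>2"

lemma map_props:
  assumes "0 < cmod z" "cmod z < 1"
  shows "cmod (\<omega> z) \<le> cmod z" "cmod (\<omega> z) < 1" "cauchy_int \<mu> z = cauchy_int \<nu> (\<omega> z)"
    "1 - (cmod (\<omega> z))\<^sup>2 \<le> 4 * cauchy_sq \<mu> z * (1 - (cmod z)\<^sup>2)"
proof -
  show "cmod (\<omega> z) \<le> cmod z" and "cauchy_int \<mu> z = cauchy_int \<nu> (\<omega> z)"
    and "1 - (cmod (\<omega> z))\<^sup>2 \<le> 4 * cauchy_sq \<mu> z * (1 - (cmod z)\<^sup>2)"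
    using map assms unfolding subordination_map_def by blast+
  then show "cmod (\<omega> z) < 1" using assms by linarith
qed

lemma far_arc_disjoint: "far_arc \<inter> cis ` {a<..<b} = {}"
proof -
  have "cis s \<noteq> cis s'" if "s \<in> {b..a + 2 * pi}" "s' \<in> {a<..<b}" for s s'
    using cis_neq[of s' s] that by auto
  then show ?thesis by (auto simp: far_arc_def)
qed

lemma AE_far_arc: "AE t in \<mu>. t \<in> far_arc"
proof -
  have cov: "t \<in> far_arc \<union> cis ` {a<..<b}" if t: "cmod t = 1" for t
  proof -
    obtain s where "a < s" "s \<le> a + 2 * pi" "t = cis s" using circle_cis_range[OF t] by blast
    then show ?thesis by (cases "s < b") (auto simp: far_arc_def)
  qed
  have "cis ` {a<..<b} = space \<mu> - far_arc"
  proof -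
    define J where "J = cis ` {a<..<b}"
    have "J \<subseteq> circle" by (auto simp: J_def)
    moreover have "far_arc \<inter> J = {}" unfolding J_def by (rule far_arc_disjoint)
    moreover have "t \<in> far_arc \<or> t \<in> J" if "t \<in> circle" for t using cov[of t] that by (simp add: J_def)
    ultimately have "J = circle - far_arc" by blast
    then show ?thesis by (simp add: J_def)
  qed
  moreover have "space \<mu> - far_arc \<in> sets \<mu>" unfolding far_arc_def by (rule sets.compl_sets[OF m.closed_arc])
  ultimately have "cis ` {a<..<b} \<in> sets \<mu>" by (simp only:)
  then have "cis ` {a<..<b} \<in> null_sets \<mu>"
    using null by (intro null_setsI) (simp_all add: m.emeasure_eq_measure)
  then have "AE t in \<mu>. t \<notin> cis ` {a<..<b}" by (rule AE_not_in)
  moreover have "AE t in \<mu>. cmod t = 1" by (rule AE_I2) simp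
  ultimately show ?thesis by eventually_elim (use cov in blast)
qed

lemma far_arc_closed: "closed far_arc" "far_arc \<noteq> {}"
proof -
  show "closed far_arc" unfolding far_arc_def
    by (intro compact_imp_closed compact_continuous_image continuous_intros) auto
  show "far_arc \<noteq> {}" using ab by (auto simp: far_arc_def)
qed

lemma gap_dist_pos: "x \<in> gap \<Longrightarrow> 0 < gap_dist x"
proof -
  assume "x \<in> gap"
  then have "cis (- x) \<in> cis ` {a<..<b}" unfolding gap_def by (intro imageI) auto
  then have "cis (- x) \<notin> far_arc" using far_arc_disjoint by blast
  then show ?thesis
    unfolding gap_dist_def using far_arc_closed in_closed_iff_infdist_zero[of far_arc] infdist_nonneg by (metis less_eq_real_def)
qed

lemma gap_bound_pos: "x \<in> gap \<Longrightarrow> 0 < gap_bound x"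
  using gap_dist_pos[of x] by (simp add: gap_bound_def)

lemma dist_far_arc:
  assumes "t \<in> far_arc"
  shows "gap_dist x \<le> cmod (1 - cis x * t)"
proof -
  have "gap_dist x \<le> dist (cis (- x)) t" unfolding gap_dist_def by (rule infdist_le[OF assms])
  also have "\<dots> = cmod (cis x * (cis (- x) - t))" by (simp add: dist_norm norm_mult)
  also have "cis x * (cis (- x) - t) = 1 - cis x * t" by (simp add: right_diff_distrib cis_mult)
  finally show ?thesis .
qed

lemma far_arc_circle: "t \<in> far_arc \<Longrightarrow> cmod t = 1" by (auto simp: far_arc_def)

lemma dist_far_arc_radial:
  assumes "t \<in> far_arc" "0 \<le> r" "r \<le> 1"
  shows "gap_dist x / 2 \<le> cmod (1 - of_real r * cis x * t)"
proof -
  let ?y = "cis x * t"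
  have y: "cmod ?y = 1" using far_arc_circle[OF assms(1)] by (simp add: norm_mult)
  have 1: "1 - r \<le> cmod (1 - of_real r * ?y)"
    using norm_triangle_ineq2[of 1 "of_real r * ?y"] y assms by (simp add: norm_mult)
  have "cmod (1 - ?y) \<le> cmod (1 - of_real r * ?y) + cmod (of_real (1 - r) * ?y)"
    by (rule order_trans[OF _ norm_triangle_ineq4]) (simp add: algebra_simps)
  moreover have "cmod (of_real (1 - r) * ?y) = \<bar>1 - r\<bar> * cmod ?y"
    by (simp only: norm_mult norm_of_real)
  ultimately have "cmod (1 - ?y) \<le> cmod (1 - of_real r * ?y) + (1 - r)"
    using y assms by simp
  then show ?thesis using 1 dist_far_arc[OF assms(1), of x] by (simp add: mult.assoc)
qed

lemma cauchy_sq_radial: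
  assumes x: "x \<in> gap" and r: "0 < r" "r < 1"
  shows "cauchy_sq \<mu> (of_real r * cis x) \<le> gap_bound x / 4"
  unfolding cauchy_sq_def
proof (rule m.integral_le_const)
  show "integrable \<mu> (\<lambda>t. 1 / (cmod (1 - of_real r * cis x * t))\<^sup>2)"
    using r by (intro m.integrable_cont m.cont_denominators) (simp add: norm_mult)
  show "AE t in \<mu>. 1 / (cmod (1 - of_real r * cis x * t))\<^sup>2 \<le> gap_bound x / 4"
    using AE_far_arc
  proof eventually_elim
    case (elim t)
    have "(gap_dist x / 2)\<^sup>2 \<le> (cmod (1 - of_real r * cis x * t))\<^sup>2"
      using dist_far_arc_radial[OF elim, of r x] r gap_dist_pos[OF x] by (intro power_mono) auto
    then have "1 / (cmod (1 - of_real r * cis x * t))\<^sup>2 \<le> 1 / (gap_dist x / 2)\<^sup>2"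
      using gap_dist_pos[OF x] by (intro divide_left_mono mult_pos_pos) auto
    then show ?case by (simp add: gap_bound_def power_divide)
  qed
qed

lemma norm_radial: "0 < r \<Longrightarrow> cmod (of_real r * cis x) = r"
  by (simp add: norm_mult)

lemma defect_radial:
  assumes x: "x \<in> gap" and r: "0 < r" "r < 1"
  shows "1 - (cmod (\<omega> (of_real r * cis x)))\<^sup>2 \<le> gap_bound x * (1 - r\<^sup>2)"
proof -
  have r2: "0 \<le> 1 - r\<^sup>2" using r by (simp add: abs_square_le_1)
  have "1 - (cmod (\<omega> (of_real r * cis x)))\<^sup>2 \<le> 4 * cauchy_sq \<mu> (of_real r * cis x) * (1 - r\<^sup>2)"
    using map_props(4)[of "of_real r * cis x"] r by (simp only: norm_radial)
  also have "\<dots> \<le> gap_bound x * (1 - r\<^sup>2)"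
    using cauchy_sq_radial[OF x r] r2 by (intro mult_right_mono) auto
  finally show ?thesis .
qed

text \<open>
  The contraction property multiplied out: the factors \<open>1 - \<bar>\<omega>\<bar>\<^sup>2\<close> are at most \<open>gap_bound\<close> times the factors
  \<open>1 - r\<^sup>2\<close>, and these cancel. The resulting bound has no singularity at the circle.
\<close>

lemma Lipschitz_radial:
  assumes x: "x \<in> gap" and r: "0 < r" "r < 1" and y: "y \<in> gap" and s: "0 < s" "s < 1"
  shows "(cmod (\<omega> (of_real r * cis x) - \<omega> (of_real s * cis y)))\<^sup>2
    \<le> gap_bound x * gap_bound y * (cmod (1 - of_real r * cis x * cnj (of_real s * cis y)))\<^sup>2"
proof -
  define z z' where "z = of_real r * cis x" and "z' = of_real s * cis y"
  have n: "cmod z = r" "cmod z' = s" using r s by (simp_all add: z_def z'_def norm_mult)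
  define P where "P = (cmod (1 - z * cnj z'))\<^sup>2"
  define A A' where "A = 1 - (cmod (\<omega> z))\<^sup>2" and "A' = 1 - (cmod (\<omega> z'))\<^sup>2"
  have A: "0 < A" "0 < A'"
    unfolding A_def A'_def
    using one_minus_sq_pos[OF map_props(2)[of z]] one_minus_sq_pos[OF map_props(2)[of z']] n r s
    by simp_all
  have rs: "0 < 1 - r\<^sup>2" "0 < 1 - s\<^sup>2" using r s by (auto simp: power_less_one_iff)
  have "hyp_gauge (\<omega> z) (\<omega> z') \<le> hyp_gauge z z'"
    using map n r s unfolding subordination_map_def by blast
  then have "(cmod (1 - \<omega> z * cnj (\<omega> z')))\<^sup>2 \<le> P / ((1 - r\<^sup>2) * (1 - s\<^sup>2)) * (A * A')"
    using A unfolding hyp_gauge_def A_def[symmetric] A'_def[symmetric] P_def n by (simp add: pos_divide_le_eq)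
  also have "\<dots> \<le> P / ((1 - r\<^sup>2) * (1 - s\<^sup>2)) * ((gap_bound x * (1 - r\<^sup>2)) * (gap_bound y * (1 - s\<^sup>2)))"
  proof (intro mult_left_mono mult_mono)
    show "A \<le> gap_bound x * (1 - r\<^sup>2)" "A' \<le> gap_bound y * (1 - s\<^sup>2)"
      unfolding A_def A'_def z_def z'_def by (rule defect_radial[OF x r], rule defect_radial[OF y s])
  qed (use A rs gap_bound_pos[OF x] gap_bound_pos[OF y] in \<open>auto simp: P_def\<close>)
  also have "\<dots> = gap_bound x * gap_bound y * P"
  proof -
    define p q where "p = 1 - r\<^sup>2" and "q = 1 - s\<^sup>2"
    have "p \<noteq> 0" "q \<noteq> 0" using rs by (auto simp: p_def q_def)
    then show ?thesis unfolding p_def[symmetric] q_def[symmetric] by (simp add: field_simps)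
  qed
  finally have "(cmod (1 - \<omega> z * cnj (\<omega> z')))\<^sup>2 \<le> gap_bound x * gap_bound y * P" .
  moreover have "(cmod (\<omega> z - \<omega> z'))\<^sup>2 \<le> (cmod (1 - \<omega> z * cnj (\<omega> z')))\<^sup>2"
    using mult_pos_pos[OF A] unfolding cmod_diff_kernel A_def A'_def by simp
  ultimately show ?thesis unfolding P_def z_def z'_def by linarith
qed

definition radius :: "nat \<Rightarrow> real" where "radius k = 1 - inverse (real (Suc (Suc k)))"

lemma radius: "0 < radius k" "radius k < 1" "radius \<longlonglongrightarrow> 1"
proof -
  show "0 < radius k" "radius k < 1" by (auto simp: radius_def field_simps)
  have "(\<lambda>k. 1 - inverse (real (Suc (Suc k)))) \<longlonglongrightarrow> 1 - 0"
    by (intro tendsto_intros LIMSEQ_Suc[OF LIMSEQ_inverse_real_of_nat])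
  then show "radius \<longlonglongrightarrow> 1" by (simp add: radius_def[abs_def])
qed

text \<open>
  Any limit point along one sequence of radii inherits the Lipschitz bound, and the case \<open>y = x\<close> of this bound
  forces convergence along the whole radius.
\<close>

lemma bd_value_exists:
  assumes x: "x \<in> gap"
  shows "\<exists>l. \<forall>y\<in>gap. \<forall>s. 0 < s \<longrightarrow> s < 1 \<longrightarrow>
    (cmod (l - \<omega> (of_real s * cis y)))\<^sup>2 \<le> gap_bound x * gap_bound y * (cmod (1 - cis x * cnj (of_real s * cis y)))\<^sup>2"
proof -
  define f where "f = (\<lambda>k. \<omega> (of_real (radius k) * cis x))"
  have "f k \<in> cball 0 1" for k
    using map_props(2)[of "of_real (radius k) * cis x"] radius(1,2)[of k] by (simp add: f_def norm_mult)
  then obtain l \<sigma> where l: "strict_mono \<sigma>" "(f \<circ> \<sigma>) \<longlonglongrightarrow> l"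
    using compact_cball[of "0::complex" 1] unfolding compact_def by meson
  have r\<sigma>: "(\<lambda>k. radius (\<sigma> k)) \<longlonglongrightarrow> 1"
    using LIMSEQ_subseq_LIMSEQ[OF radius(3) l(1)] by (simp add: o_def)
  show ?thesis
  proof (intro exI[of _ l] ballI allI impI)
    fix y s assume y: "y \<in> gap" and s: "0 < s" "s < (1::real)"
    let ?z' = "of_real s * cis y"
    have "(\<lambda>k. (cmod (f (\<sigma> k) - \<omega> ?z'))\<^sup>2) \<longlonglongrightarrow> (cmod (l - \<omega> ?z'))\<^sup>2"
      using l(2) by (intro tendsto_intros) (simp add: o_def)
    moreover have "(\<lambda>k. gap_bound x * gap_bound y * (cmod (1 - of_real (radius (\<sigma> k)) * cis x * cnj ?z'))\<^sup>2)
      \<longlonglongrightarrow> gap_bound x * gap_bound y * (cmod (1 - of_real 1 * cis x * cnj ?z'))\<^sup>2"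
      by (intro tendsto_intros r\<sigma>)
    ultimately have "(cmod (l - \<omega> ?z'))\<^sup>2 \<le> gap_bound x * gap_bound y * (cmod (1 - of_real 1 * cis x * cnj ?z'))\<^sup>2"
      by (rule LIMSEQ_le) (use Lipschitz_radial[OF x radius(1,2) y s] in \<open>auto simp: f_def\<close>)
    then show "(cmod (l - \<omega> ?z'))\<^sup>2 \<le> gap_bound x * gap_bound y * (cmod (1 - cis x * cnj ?z'))\<^sup>2" by simp
  qed
qed

definition bd_value :: "real \<Rightarrow> complex" where
  "bd_value x = (SOME l. \<forall>y\<in>gap. \<forall>s. 0 < s \<longrightarrow> s < 1 \<longrightarrow>
    (cmod (l - \<omega> (of_real s * cis y)))\<^sup>2 \<le> gap_bound x * gap_bound y * (cmod (1 - cis x * cnj (of_real s * cis y)))\<^sup>2)"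

lemma bd_value_Lipschitz_radial:
  assumes "x \<in> gap" "y \<in> gap" "0 < s" "s < 1"
  shows "(cmod (bd_value x - \<omega> (of_real s * cis y)))\<^sup>2
    \<le> gap_bound x * gap_bound y * (cmod (1 - cis x * cnj (of_real s * cis y)))\<^sup>2"
  using someI_ex[OF bd_value_exists[OF assms(1)]] assms(2-4) unfolding bd_value_def by blast

lemma bd_value_radial:
  assumes x: "x \<in> gap" and s: "0 < s" "s < 1"
  shows "cmod (\<omega> (of_real s * cis x) - bd_value x) \<le> gap_bound x * (1 - s)"
proof (rule power2_le_imp_le)
  have "1 - cis x * cnj (of_real s * cis x) = of_real (1 - s)"
    by (simp add: cis_cnj cis_mult)
  then have "cmod (1 - cis x * cnj (of_real s * cis x)) = 1 - s"
    using s by (simp only: norm_of_real)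
  then show "(cmod (\<omega> (of_real s * cis x) - bd_value x))\<^sup>2 \<le> (gap_bound x * (1 - s))\<^sup>2"
    using bd_value_Lipschitz_radial[OF x x s] by (simp add: norm_minus_commute power_mult_distrib power2_eq_square mult_ac)
  show "0 \<le> gap_bound x * (1 - s)" using gap_bound_pos[OF x] s by simp
qed

lemma bd_value_limit:
  assumes x: "x \<in> gap"
  shows "(\<lambda>k. \<omega> (of_real (radius k) * cis x)) \<longlonglongrightarrow> bd_value x"
proof (rule LIM_zero_cancel, rule Lim_null_comparison)
  show "\<forall>\<^sub>F k in sequentially. norm (\<omega> (of_real (radius k) * cis x) - bd_value x) \<le> gap_bound x * (1 - radius k)"
    using bd_value_radial[OF x radius(1,2)] by simp
  have "(\<lambda>k. gap_bound x * (1 - radius k)) \<longlonglongrightarrow> gap_bound x * (1 - 1)" by (intro tendsto_intros radius)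
  then show "(\<lambda>k. gap_bound x * (1 - radius k)) \<longlonglongrightarrow> 0" by simp
qed

lemma bd_value_Lipschitz:
  assumes x: "x \<in> gap" and y: "y \<in> gap"
  shows "(cmod (bd_value x - bd_value y))\<^sup>2 \<le> gap_bound x * gap_bound y * (cmod (1 - cis (x - y)))\<^sup>2"
proof -
  have "(\<lambda>k. (cmod (bd_value x - \<omega> (of_real (radius k) * cis y)))\<^sup>2) \<longlonglongrightarrow> (cmod (bd_value x - bd_value y))\<^sup>2"
    by (intro tendsto_intros bd_value_limit y)
  moreover have "(\<lambda>k. gap_bound x * gap_bound y * (cmod (1 - cis x * cnj (of_real (radius k) * cis y)))\<^sup>2)
    \<longlonglongrightarrow> gap_bound x * gap_bound y * (cmod (1 - cis x * cnj (of_real 1 * cis y)))\<^sup>2"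
    by (intro tendsto_intros radius)
  ultimately have "(cmod (bd_value x - bd_value y))\<^sup>2 \<le> gap_bound x * gap_bound y * (cmod (1 - cis x * cnj (of_real 1 * cis y)))\<^sup>2"
    by (rule LIMSEQ_le) (use bd_value_Lipschitz_radial[OF x y radius(1,2)] in auto)
  then show ?thesis by (simp add: cis_cnj cis_mult)
qed

lemma bd_value_continuous: "continuous_on gap bd_value"
  unfolding continuous_on_def
proof
  fix x assume x: "x \<in> gap"
  have dx: "gap_dist x \<noteq> 0" using gap_dist_pos[OF x] by simp
  show "(bd_value \<longlongrightarrow> bd_value x) (at x within gap)"
  proof (rule LIM_zero_cancel, rule Lim_null_comparison)
    show "\<forall>\<^sub>F y in at x within gap. norm (bd_value y - bd_value x) \<le> sqrt (gap_bound y * gap_bound x * (cmod (1 - cis (y - x)))\<^sup>2)"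
      unfolding eventually_at_filter
      using bd_value_Lipschitz[OF _ x] by (auto intro!: always_eventually real_le_rsqrt)
    have "((\<lambda>y. gap_bound y) \<longlongrightarrow> gap_bound x) (at x within gap)"
      unfolding gap_bound_def gap_dist_def using dx unfolding gap_dist_def
      by (intro tendsto_intros tendsto_infdist) auto
    then have "((\<lambda>y. sqrt (gap_bound y * gap_bound x * (cmod (1 - cis (y - x)))\<^sup>2))
      \<longlongrightarrow> sqrt (gap_bound x * gap_bound x * (cmod (1 - cis (x - x)))\<^sup>2)) (at x within gap)"
      by (intro tendsto_intros)
    then show "((\<lambda>y. sqrt (gap_bound y * gap_bound x * (cmod (1 - cis (y - x)))\<^sup>2)) \<longlongrightarrow> 0) (at x within gap)" by simp
  qed
qed

text \<open>
  \<open>1 - \<bar>\<omega>\<bar>\<^sup>2\<close> tends to \<open>0\<close> by \<open>defect_radial\<close>.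
\<close>

lemma bd_value_circle:
  assumes x: "x \<in> gap"
  shows "cmod (bd_value x) = 1"
proof -
  have "(\<lambda>k. 1 - (cmod (\<omega> (of_real (radius k) * cis x)))\<^sup>2) \<longlonglongrightarrow> 1 - (cmod (bd_value x))\<^sup>2"
    by (intro tendsto_intros bd_value_limit x)
  moreover have "(\<lambda>k. gap_bound x * (1 - (radius k)\<^sup>2)) \<longlonglongrightarrow> gap_bound x * (1 - 1\<^sup>2)"
    by (intro tendsto_intros radius)
  ultimately have "1 - (cmod (bd_value x))\<^sup>2 \<le> gap_bound x * (1 - 1\<^sup>2)"
    by (rule LIMSEQ_le) (use defect_radial[OF x radius(1,2)] in auto)
  then have 1: "1\<^sup>2 \<le> (cmod (bd_value x))\<^sup>2" by simp
  have "(\<lambda>k. cmod (\<omega> (of_real (radius k) * cis x))) \<longlonglongrightarrow> cmod (bd_value x)"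
    by (intro tendsto_intros bd_value_limit x)
  then have "cmod (bd_value x) \<le> 1"
  proof (rule LIMSEQ_le_const2)
    show "\<exists>N. \<forall>k\<ge>N. cmod (\<omega> (of_real (radius k) * cis x)) \<le> 1"
      using map_props(2)[of "of_real (radius _) * cis x"] radius(1,2) by (auto simp: norm_mult less_imp_le)
  qed
  moreover have "1 \<le> cmod (bd_value x)" using 1 by (rule power2_le_imp_le) simp
  ultimately show ?thesis by simp
qed

text \<open>
  \<open>(1 - \<bar>w\<bar>\<^sup>2)\<close> times the square integral is the same for \<open>(\<nu>, \<omega>(z))\<close> and \<open>(\<mu>, z)\<close>, and \<open>\<bar>\<omega>(z)\<bar> \<le> \<bar>z\<bar>\<close>.
\<close>

lemma cauchy_sq_map_radial:
  assumes x: "x \<in> gap" and r: "0 < r" "r < 1"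
  shows "cauchy_sq \<nu> (\<omega> (of_real r * cis x)) \<le> gap_bound x / 4"
proof -
  define z where "z = of_real r * cis x"
  have z: "0 < cmod z" "cmod z < 1" using r by (simp_all add: z_def norm_mult)
  note w = map_props[OF z]
  have p: "1 - (cmod (\<omega> z))\<^sup>2 > 0" using one_minus_sq_pos[OF w(2)] .
  have "(1 - (cmod (\<omega> z))\<^sup>2) * cauchy_sq \<nu> (\<omega> z) = (1 - (cmod z)\<^sup>2) * cauchy_sq \<mu> z"
    using n.cauchy_sq_cauchy_int[OF w(2)] m.cauchy_sq_cauchy_int[OF z(2)] w(3) by simp
  also have "\<dots> \<le> (1 - (cmod (\<omega> z))\<^sup>2) * cauchy_sq \<mu> z"
    using w(1) by (intro mult_right_mono m.cauchy_sq_nonneg) (auto intro: power_mono)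
  finally have "cauchy_sq \<nu> (\<omega> z) \<le> cauchy_sq \<mu> z" using p by (simp only: mult_le_cancel_left_pos)
  also have "\<dots> \<le> gap_bound x / 4" unfolding z_def by (rule cauchy_sq_radial[OF x r])
  finally show ?thesis by (simp add: z_def)
qed

text \<open>
  Markov's inequality at a point \<open>\<omega>(r cis x)\<close> within \<open>e\<close> of the boundary value: on the set in question
  \<open>\<bar>1 - \<omega> t\<bar> \<le> 2 e\<close>.
\<close>

lemma bd_value_flat:
  assumes x: "x \<in> gap" and e: "e > 0"
  shows "measure \<nu> {t \<in> circle. cmod (1 - bd_value x * t) \<le> e} \<le> gap_bound x * e\<^sup>2"
proof -
  define S where "S = {t \<in> circle. cmod (1 - bd_value x * t) \<le> e}"
  have S: "S \<in> sets \<nu>" unfolding S_def by (rule n.flat_set)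
  have Sc: "S \<inter> circle = S" by (auto simp: S_def)
  have "(\<lambda>k. gap_bound x * (1 - radius k)) \<longlonglongrightarrow> gap_bound x * (1 - 1)" by (intro tendsto_intros radius)
  then have "\<forall>\<^sub>F k in sequentially. gap_bound x * (1 - radius k) < e"
    using e by (intro order_tendstoD) auto
  then obtain k where k: "gap_bound x * (1 - radius k) < e" by (auto simp: eventually_sequentially)
  define w where "w = \<omega> (of_real (radius k) * cis x)"
  have w: "cmod w < 1"
    unfolding w_def by (rule map_props(2)) (use radius(1,2)[of k] in \<open>simp_all add: norm_mult\<close>)
  have wb: "cmod (w - bd_value x) \<le> e" using bd_value_radial[OF x radius(1,2)[of k]] k by (simp add: w_def)
  have i: "integrable \<nu> (\<lambda>t. indicator S t * (1 / (4 * e\<^sup>2)))"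
    using S Sc by (intro integrable_mult_left) (simp add: n.emeasure_eq_measure integrable_indicator_iff)
  have "measure \<nu> S * (1 / (4 * e\<^sup>2)) = (LINT t|\<nu>. indicator S t * (1 / (4 * e\<^sup>2)))"
    using Sc by simp
  also have "\<dots> \<le> cauchy_sq \<nu> w"
    unfolding cauchy_sq_def
  proof (rule integral_mono[OF i])
    show "integrable \<nu> (\<lambda>t. 1 / (cmod (1 - w * t))\<^sup>2)"
      by (intro n.integrable_cont n.cont_denominators w)
    fix t assume "t \<in> space \<nu>"
    then have t: "cmod t = 1" by simp
    show "indicator S t * (1 / (4 * e\<^sup>2)) \<le> 1 / (cmod (1 - w * t))\<^sup>2"
    proof (cases "t \<in> S")
      case True
      have "1 - w * t = (1 - bd_value x * t) - (w - bd_value x) * t" by (simp add: algebra_simps)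
      then have "cmod (1 - w * t) \<le> cmod (1 - bd_value x * t) + cmod ((w - bd_value x) * t)"
        using norm_triangle_ineq4 by metis
      also have "\<dots> \<le> 2 * e" using True wb t by (simp add: S_def norm_mult)
      finally have "(cmod (1 - w * t))\<^sup>2 \<le> (2 * e)\<^sup>2" by (intro power_mono) auto
      then have "1 / (2 * e)\<^sup>2 \<le> 1 / (cmod (1 - w * t))\<^sup>2"
        using one_minus_mult_nonzero[OF w t] e by (intro divide_left_mono mult_pos_pos) auto
      then show ?thesis using True by (simp add: power_mult_distrib)
    qed simp
  qed
  also have "\<dots> \<le> gap_bound x / 4" unfolding w_def by (rule cauchy_sq_map_radial[OF x radius(1,2)])
  finally show ?thesis using e unfolding S_def[symmetric] by (simp add: field_simps)
qed


lemma boundary_integrable: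
  assumes x: "x \<in> gap"
  shows "integrable \<mu> (\<lambda>t. 1 / (1 - cis x * t))"
proof (rule m.integrable_const_bound[of _ "1 / gap_dist x"])
  show "AE t in \<mu>. cmod (1 / (1 - cis x * t)) \<le> 1 / gap_dist x"
    using AE_far_arc
  proof eventually_elim
    case (elim t)
    then show ?case using dist_far_arc[OF elim, of x] gap_dist_pos[OF x]
      by (auto simp: norm_divide intro!: divide_left_mono mult_pos_pos)
  qed
  have "(\<lambda>t. 1 / (1 - cis x * t)) \<in> borel_measurable (restrict_space borel circle)"
    by (rule measurable_restrict_space1) simp
  then show "(\<lambda>t. 1 / (1 - cis x * t)) \<in> borel_measurable \<mu>"
    by (simp add: measurable_cong_sets[OF m.sets_nu refl])
qed

lemma cauchy_int_boundary_limit: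
  assumes x: "x \<in> gap"
  shows "(\<lambda>k. cauchy_int \<mu> (of_real (radius k) * cis x)) \<longlonglongrightarrow> cauchy_int \<mu> (cis x)"
proof (rule LIM_zero_cancel, rule Lim_null_comparison)
  have "(\<lambda>k. (1 - radius k) * (2 / (gap_dist x)\<^sup>2)) \<longlonglongrightarrow> (1 - 1) * (2 / (gap_dist x)\<^sup>2)" by (intro tendsto_intros radius)
  then show "(\<lambda>k. (1 - radius k) * (2 / (gap_dist x)\<^sup>2)) \<longlonglongrightarrow> 0" by simp
  show "\<forall>\<^sub>F k in sequentially. norm (cauchy_int \<mu> (of_real (radius k) * cis x) - cauchy_int \<mu> (cis x)) \<le> (1 - radius k) * (2 / (gap_dist x)\<^sup>2)"
  proof (rule always_eventually, rule allI)
    fix k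
    define r where "r = radius k"
    have r: "0 < r" "r < 1" using radius by (auto simp: r_def)
    have i: "integrable \<mu> (\<lambda>t. 1 / (1 - of_real r * cis x * t))"
      using r by (intro m.integrable_cont m.cont_denominators) (simp add: norm_mult)
    note i' = boundary_integrable[OF x]
    have "cauchy_int \<mu> (of_real r * cis x) - cauchy_int \<mu> (cis x)
      = (LINT t|\<mu>. 1 / (1 - of_real r * cis x * t) - 1 / (1 - cis x * t))"
      using i i' by (simp add: cauchy_int_def)
    also have "cmod \<dots> \<le> (LINT t|\<mu>. cmod (1 / (1 - of_real r * cis x * t) - 1 / (1 - cis x * t)))"
      by (rule integral_norm_bound)
    also have "\<dots> \<le> (LINT t|\<mu>. (1 - r) * (2 / (gap_dist x)\<^sup>2))"
    proof (rule integral_mono_AE)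
      show "integrable \<mu> (\<lambda>t. cmod (1 / (1 - of_real r * cis x * t) - 1 / (1 - cis x * t)))"
        using i i' by simp
      show "AE t in \<mu>. cmod (1 / (1 - of_real r * cis x * t) - 1 / (1 - cis x * t)) \<le> (1 - r) * (2 / (gap_dist x)\<^sup>2)"
        using AE_far_arc
      proof eventually_elim
        case (elim t)
        define p q where "p = 1 - of_real r * cis x * t" and "q = 1 - cis x * t"
        have p: "gap_dist x / 2 \<le> cmod p" unfolding p_def using dist_far_arc_radial[OF elim] r by simp
        have q: "gap_dist x \<le> cmod q" unfolding q_def by (rule dist_far_arc[OF elim])
        have nz: "p \<noteq> 0" "q \<noteq> 0" using p q gap_dist_pos[OF x] by auto
        have "1 / p - 1 / q = (q - p) / (p * q)" using nz by (simp add: field_simps)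
        moreover have "q - p = - (of_real (1 - r) * (cis x * t))" by (simp add: p_def q_def algebra_simps)
        then have "cmod (q - p) = 1 - r" using r far_arc_circle[OF elim] by (simp add: norm_mult del: of_real_diff)
        ultimately have "cmod (1 / p - 1 / q) = (1 - r) / (cmod p * cmod q)"
          by (simp add: norm_divide norm_mult)
        also have "\<dots> \<le> (1 - r) / (gap_dist x / 2 * gap_dist x)"
          using p q gap_dist_pos[OF x] r nz by (intro divide_left_mono mult_mono mult_pos_pos) auto
        finally show ?case by (simp add: p_def q_def power2_eq_square)
      qed
    qed simp
    finally show "norm (cauchy_int \<mu> (of_real (radius k) * cis x) - cauchy_int \<mu> (cis x)) \<le> (1 - radius k) * (2 / (gap_dist x)\<^sup>2)"
      using m.prob_space by (simp add: r_def)
  qed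
qed

text \<open>
  With \<open>t = cis s\<close> the imaginary part of \<open>1 / (1 - cis x t)\<close> is \<open>cot ((x + s) / 2) / 2\<close>. Off \<open>J\<close> the angles
  \<open>(x + s) / 2\<close> stay in \<open>(0, \<pi>)\<close>, where the cotangent decreases; so the imaginary part of the integral is
  strictly decreasing along the gap.
\<close>

lemma cauchy_int_boundary_inj:
  assumes x: "x \<in> gap" and y: "y \<in> gap" and xy: "x < y"
  shows "cauchy_int \<mu> (cis x) \<noteq> cauchy_int \<mu> (cis y)"
proof
  assume eq: "cauchy_int \<mu> (cis x) = cauchy_int \<mu> (cis y)"
  define f where "f = (\<lambda>t. 1 / (1 - cis x * t) - 1 / (1 - cis y * t))"
  have f: "integrable \<mu> f" unfolding f_def using boundary_integrable x y by simp
  have f0: "(LINT t|\<mu>. f t) = 0"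
    unfolding f_def using boundary_integrable x y eq by (simp add: cauchy_int_def)
  define c where "c = sin ((y - x) / 2)"
  have c: "c > 0"
    unfolding c_def by (rule sin_gt_zero) (use x y xy ab in \<open>auto simp: gap_def\<close>)
  have Im: "AE t in \<mu>. c / 2 \<le> Im (f t)"
    using AE_far_arc
  proof eventually_elim
    case (elim t)
    then obtain s where s: "b \<le> s" "s \<le> a + 2 * pi" "t = cis s" by (auto simp: far_arc_def)
    have half: "1 / (1 - cis \<theta>) = Complex (1/2) (cos (\<theta> / 2) / (2 * sin (\<theta> / 2)))" if "sin (\<theta> / 2) \<noteq> 0" for \<theta>
    proof -
      define S C where "S = sin (\<theta> / 2)" and "C = cos (\<theta> / 2)"
      have "cis \<theta> = cis (\<theta> / 2) * cis (\<theta> / 2)" by (simp add: cis_mult)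
      then have "cis \<theta> = Complex (C * C - S * S) (2 * S * C)" by (simp add: complex_eq_iff S_def C_def)
      moreover have "S * S + C * C = 1" by (simp add: S_def C_def flip: power2_eq_square)
      moreover have "S \<noteq> 0" using that by (simp add: S_def)
      ultimately have "Complex (1/2) (C / (2 * S)) * (1 - cis \<theta>) = 1"
        by (simp add: complex_eq_iff field_simps) (algebra | simp)+
      then show ?thesis
        by (metis S_def C_def mult_zero_right nonzero_eq_divide_eq zero_neq_one)
    qed
    define \<alpha> \<beta> where "\<alpha> = (x + s) / 2" and "\<beta> = (y + s) / 2"
    have r: "0 < \<alpha>" "\<alpha> < pi" "0 < \<beta>" "\<beta> < pi" using s x y by (auto simp: \<alpha>_def \<beta>_def gap_def)
    have sp: "sin \<alpha> > 0" "sin \<beta> > 0" using r by (auto intro: sin_gt_zero)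
    have "Im (f t) = cos \<alpha> / (2 * sin \<alpha>) - cos \<beta> / (2 * sin \<beta>)"
      using half[of "x + s"] half[of "y + s"] sp by (simp add: f_def s(3) cis_mult \<alpha>_def \<beta>_def)
    also have "\<dots> = (sin \<beta> * cos \<alpha> - cos \<beta> * sin \<alpha>) / (2 * (sin \<alpha> * sin \<beta>))"
      using sp by (simp add: field_simps)
    also have "sin \<beta> * cos \<alpha> - cos \<beta> * sin \<alpha> = c"
    proof -
      have "\<beta> - \<alpha> = (y - x) / 2" by (simp add: \<alpha>_def \<beta>_def field_simps)
      then show ?thesis unfolding c_def sin_diff[symmetric] by (simp only:)
    qed
    also have "c / 2 \<le> c / (2 * (sin \<alpha> * sin \<beta>))"
    proof (rule divide_left_mono)
      have "sin \<alpha> * sin \<beta> \<le> 1" using sp by (intro mult_le_one) auto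
      then show "2 * (sin \<alpha> * sin \<beta>) \<le> 2" by simp
    qed (use c sp in auto)
    finally show ?case .
  qed
  have "c / 2 \<le> (LINT t|\<mu>. Im (f t))"
    using m.integral_ge_const[OF integrable_Im[OF f] Im] .
  also have "\<dots> = 0" using integral_Im[OF f] f0 by simp
  finally show False using c by simp
qed

text \<open>
  If two boundary values agree, then the values of \<open>cauchy_int \<mu>\<close> near the two points, which are values of
  \<open>cauchy_int \<nu>\<close> at nearby points with bounded square integrals, agree in the limit.
\<close>

lemma bd_value_inj: "inj_on bd_value gap"
proof -
  have False if x: "x \<in> gap" and y: "y \<in> gap" and xy: "x < y" and eq: "bd_value x = bd_value y" for x y
  proof -
    let ?w = "\<lambda>x k. \<omega> (of_real (radius k) * cis x)"
    have "(\<lambda>k. cauchy_int \<mu> (of_real (radius k) * cis x) - cauchy_int \<mu> (of_real (radius k) * cis y)) \<longlonglongrightarrow> 0"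
    proof (rule Lim_null_comparison)
      have "(\<lambda>k. cmod (?w x k - ?w y k) * ((gap_bound x / 4 + gap_bound y / 4) / 2))
        \<longlonglongrightarrow> cmod (bd_value x - bd_value y) * ((gap_bound x / 4 + gap_bound y / 4) / 2)"
        by (intro tendsto_intros bd_value_limit x y)
      then show "(\<lambda>k. cmod (?w x k - ?w y k) * ((gap_bound x / 4 + gap_bound y / 4) / 2)) \<longlonglongrightarrow> 0" by (simp add: eq)
      show "\<forall>\<^sub>F k in sequentially. norm (cauchy_int \<mu> (of_real (radius k) * cis x) - cauchy_int \<mu> (of_real (radius k) * cis y))
        \<le> cmod (?w x k - ?w y k) * ((gap_bound x / 4 + gap_bound y / 4) / 2)"
      proof (rule always_eventually, rule allI)
        fix k
        have z: "0 < cmod (of_real (radius k) * cis u)" "cmod (of_real (radius k) * cis u) < 1" for u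
          using radius(1,2)[of k] by (simp_all add: norm_mult)
        have "norm (cauchy_int \<mu> (of_real (radius k) * cis x) - cauchy_int \<mu> (of_real (radius k) * cis y))
          \<le> cmod (?w x k - ?w y k) * ((cauchy_sq \<nu> (?w x k) + cauchy_sq \<nu> (?w y k)) / 2)"
          unfolding map_props(3)[OF z] by (rule n.cauchy_int_diff_le[OF map_props(2)[OF z] map_props(2)[OF z]])
        also have "\<dots> \<le> cmod (?w x k - ?w y k) * ((gap_bound x / 4 + gap_bound y / 4) / 2)"
          using cauchy_sq_map_radial[OF x radius(1,2)] cauchy_sq_map_radial[OF y radius(1,2)]
          by (intro mult_left_mono divide_right_mono add_mono) auto
        finally show "norm (cauchy_int \<mu> (of_real (radius k) * cis x) - cauchy_int \<mu> (of_real (radius k) * cis y))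
          \<le> cmod (?w x k - ?w y k) * ((gap_bound x / 4 + gap_bound y / 4) / 2)" .
      qed
    qed
    moreover have "(\<lambda>k. cauchy_int \<mu> (of_real (radius k) * cis x) - cauchy_int \<mu> (of_real (radius k) * cis y))
      \<longlonglongrightarrow> cauchy_int \<mu> (cis x) - cauchy_int \<mu> (cis y)"
      by (intro tendsto_intros cauchy_int_boundary_limit x y)
    ultimately have "cauchy_int \<mu> (cis x) - cauchy_int \<mu> (cis y) = 0" using LIMSEQ_unique by blast
    then show False using cauchy_int_boundary_inj[OF x y xy] by simp
  qed
  then show ?thesis by (intro linorder_inj_onI) auto
qed

text \<open>
  If the ends agreed, the boundary values would fill the circle up to one point, and \<open>\<nu>\<close> is flat at all of
  their conjugates.
\<close>

lemma distinct_ends: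
  assumes np: "\<not> point_mass \<nu>"
  shows "\<exists>v v'. cmod v = 1 \<and> cmod v' = 1 \<and> v \<noteq> v' \<and>
    (bd_value \<longlongrightarrow> v) (at_right (- b)) \<and> (bd_value \<longlongrightarrow> v') (at_left (- a))"
proof -
  have "- b < - a" using ab by simp
  from injective_circle_arc_ends[OF this, of bd_value] bd_value_continuous bd_value_inj bd_value_circle
  obtain v v' where v: "cmod v = 1" "cmod v' = 1" "(bd_value \<longlongrightarrow> v) (at_right (- b))" "(bd_value \<longlongrightarrow> v') (at_left (- a))"
    and full: "v = v' \<Longrightarrow> \<exists>l. v = cis l \<and> cis ` {l<..<l + 2 * pi} \<subseteq> bd_value ` gap"
    unfolding gap_def by blast
  have "v \<noteq> v'"
  proof
    assume "v = v'"
    then obtain l where l: "cis ` {l<..<l + 2 * pi} \<subseteq> bd_value ` gap" using full by blast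
    have "point_mass \<nu>"
    proof (rule n.flat_off_point)
      fix y assume "l < y" "y < l + 2 * pi"
      then have "cis y \<in> bd_value ` gap" using l by auto
      then obtain x where "x \<in> gap" "cis y = bd_value x" by blast
      then show "\<exists>C. \<forall>e>0. measure \<nu> {t \<in> circle. cmod (1 - cis y * t) \<le> e} \<le> C * e\<^sup>2"
        using bd_value_flat by auto
    qed
    with np show False by blast
  qed
  with v show ?thesis by blast
qed

end

section \<open>Atoms at the end points\<close>

context circle_measure
begin

lemma cauchy_int_le_cauchy_sq:
  assumes w: "cmod w < 1"
  shows "(cmod (cauchy_int \<nu> w))\<^sup>2 \<le> cauchy_sq \<nu> w"
  using Cauchy_Schwarz_integral[of "\<lambda>t. 1 / (1 - w * t)" "\<lambda>_. 1"] prob_space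
    integrable_cont[OF cont_denominators(1)[OF w]] integrable_cont[OF cont_denominators(3)[OF w]]
  by (simp add: cauchy_int_def cauchy_sq_def norm_divide power_divide)

text \<open>
  Split the integral at the set \<open>S\<close> where \<open>t\<close> is close to the conjugate of \<open>v\<close>. By Cauchy-Schwarz the part
  over \<open>S\<close> has square at most \<open>\<nu>(S)\<close> times the square integral, while the other part stays bounded by
  \<open>2 / e\<close>; the parameter \<open>k\<close> comes from \<open>(A + B)\<^sup>2 \<le> (1 + k) A\<^sup>2 + (1 + 1/k) B\<^sup>2\<close>.
\<close>

lemma cauchy_int_ratio_le:
  assumes w: "cmod w < 1" and k: "k > 0" and e: "e > 0" and v: "cmod (w - v) \<le> e / 2"
  shows "(cmod (cauchy_int \<nu> w))\<^sup>2 / cauchy_sq \<nu> w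
    \<le> (1 + k) * measure \<nu> {t \<in> circle. cmod (1 - v * t) \<le> e} + (1 + 1 / k) * (4 / e\<^sup>2) * (1 / cauchy_sq \<nu> w)"
proof -
  define S where "S = {t \<in> circle. cmod (1 - v * t) \<le> e}"
  define g where "g = (\<lambda>t. 1 / (1 - w * t))"
  have S: "S \<in> sets \<nu>" unfolding S_def by (rule flat_set)
  have Sc: "S \<inter> circle = S" by (auto simp: S_def)
  have g: "integrable \<nu> g" unfolding g_def by (intro integrable_cont cont_denominators w)
  have g2: "integrable \<nu> (\<lambda>t. (cmod (g t))\<^sup>2)"
    using integrable_cont[OF cont_denominators(3)[OF w]] by (simp add: g_def norm_divide power_divide)
  have Q: "(LINT t|\<nu>. (cmod (g t))\<^sup>2) = cauchy_sq \<nu> w" by (simp add: g_def cauchy_sq_def norm_divide power_divide)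
  define A B where "A = (LINT t|\<nu>. g t * indicator S t)" and "B = (LINT t|\<nu>. g t * indicator (circle - S) t)"
  have S': "circle - S \<in> sets \<nu>" using sets.compl_sets[OF S] by simp
  have iA: "integrable \<nu> (\<lambda>t. g t * indicator S t)" and iB: "integrable \<nu> (\<lambda>t. g t * indicator (circle - S) t)"
    using integrable_mult_indicator[OF S g] integrable_mult_indicator[OF S' g]
    by (simp_all add: scaleR_conv_of_real mult.commute of_real_indicator)
  have "cauchy_int \<nu> w = (LINT t|\<nu>. g t * indicator S t + g t * indicator (circle - S) t)"
    unfolding cauchy_int_def g_def
    by (rule Bochner_Integration.integral_cong) (auto simp: indicator_def)
  then have gAB: "cauchy_int \<nu> w = A + B" using iA iB by (simp add: A_def B_def)
  have iS: "integrable \<nu> (\<lambda>t. (cmod (indicator S t))\<^sup>2)"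
  proof -
    have "(\<lambda>t. (cmod (indicator S t))\<^sup>2) = (\<lambda>t. indicator S t :: real)" by (auto simp: indicator_def)
    then show ?thesis using S Sc by (simp add: integrable_indicator_iff emeasure_eq_measure)
  qed
  have "(cmod A)\<^sup>2 \<le> (LINT t|\<nu>. (cmod (g t))\<^sup>2) * (LINT t|\<nu>. (cmod (indicator S t))\<^sup>2)"
  proof -
    have "cnj (indicator S t) = indicator S t" for t by (simp add: indicator_def)
    then show ?thesis using Cauchy_Schwarz_integral[of g "indicator S"] iA g2 iS by (simp add: A_def)
  qed
  also have "(LINT t|\<nu>. (cmod (indicator S t))\<^sup>2) = measure \<nu> S"
  proof -
    have "(\<lambda>t. (cmod (indicator S t))\<^sup>2) = (\<lambda>t. indicator S t :: real)" by (auto simp: indicator_def)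
    then show ?thesis using Sc by simp
  qed
  finally have A: "(cmod A)\<^sup>2 \<le> cauchy_sq \<nu> w * measure \<nu> S" by (simp add: Q)
  have "cmod B \<le> (LINT t|\<nu>. 2 / e)"
    unfolding B_def
  proof (rule Bochner_Integration.integral_norm_bound_integral[OF iB])
    fix t assume "t \<in> space \<nu>"
    then have t: "cmod t = 1" by simp
    show "cmod (g t * indicator (circle - S) t) \<le> 2 / e"
    proof (cases "t \<in> S")
      case False
      then have far: "e < cmod (1 - v * t)" using t by (auto simp: S_def)
      have "1 - v * t = (1 - w * t) + (w - v) * t" by (simp add: algebra_simps)
      then have "cmod (1 - v * t) \<le> cmod (1 - w * t) + cmod ((w - v) * t)"
        using norm_triangle_ineq by metis
      then have "e / 2 \<le> cmod (1 - w * t)" using far v t by (simp add: norm_mult)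
      then have "1 / cmod (1 - w * t) \<le> 1 / (e / 2)"
        using e by (intro divide_left_mono mult_pos_pos) auto
      then show ?thesis using False e by (simp add: g_def norm_divide indicator_def)
    qed (use e in simp)
  qed simp
  then have "cmod B \<le> 2 / e" using prob_space by simp
  then have "(cmod B)\<^sup>2 \<le> (2 / e)\<^sup>2" by (intro power_mono) auto
  then have B: "(cmod B)\<^sup>2 \<le> 4 / e\<^sup>2" by (simp add: power_divide)
  have "(cmod (cauchy_int \<nu> w))\<^sup>2 \<le> (cmod A + cmod B)\<^sup>2"
    unfolding gAB by (intro power_mono norm_triangle_ineq) auto
  also have "\<dots> \<le> (1 + k) * (cmod A)\<^sup>2 + (1 + 1 / k) * (cmod B)\<^sup>2"
  proof -
    have "0 \<le> (k * cmod A - cmod B)\<^sup>2 / k" using k by simp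
    also have "\<dots> = (1 + k) * (cmod A)\<^sup>2 + (1 + 1 / k) * (cmod B)\<^sup>2 - (cmod A + cmod B)\<^sup>2"
      using k by (simp add: power2_eq_square field_simps)
    finally show ?thesis by simp
  qed
  also have "\<dots> \<le> (1 + k) * (cauchy_sq \<nu> w * measure \<nu> S) + (1 + 1 / k) * (4 / e\<^sup>2)"
    using A B k by (intro add_mono mult_left_mono) auto
  finally have "(cmod (cauchy_int \<nu> w))\<^sup>2 \<le> (1 + k) * (cauchy_sq \<nu> w * measure \<nu> S) + (1 + 1 / k) * (4 / e\<^sup>2)" .
  moreover have Q0: "cauchy_sq \<nu> w > 0" using cauchy_sq_ge[OF w] by simp
  then have "((1 + k) * measure \<nu> S + c * (1 / cauchy_sq \<nu> w)) * cauchy_sq \<nu> w = (1 + k) * (cauchy_sq \<nu> w * measure \<nu> S) + c"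
    for c by (simp add: distrib_right)
  ultimately show ?thesis
    unfolding S_def[symmetric] by (simp only: pos_divide_le_eq[OF Q0])
qed

lemma measure_flat_limit:
  assumes v: "cmod v = 1"
  shows "(\<lambda>k. measure \<nu> {t \<in> circle. cmod (1 - v * t) \<le> inverse (real (Suc k))}) \<longlonglongrightarrow> measure \<nu> {cnj v}"
proof -
  define A where "A = (\<lambda>k. {t \<in> circle. cmod (1 - v * t) \<le> inverse (real (Suc k))})"
  have "(\<lambda>k. measure \<nu> (A k)) \<longlonglongrightarrow> measure \<nu> (\<Inter>k. A k)"
  proof (rule finite_Lim_measure_decseq)
    show "range A \<subseteq> sets \<nu>" unfolding A_def using flat_set by blast
    show "decseq A"
    proof (rule decseq_SucI)
      fix k
      have le: "inverse (real (Suc (Suc k))) \<le> inverse (real (Suc k))" by (simp add: field_simps)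
      show "A (Suc k) \<subseteq> A k" unfolding A_def using order_trans[OF _ le] by blast
    qed
  qed
  moreover have "(\<Inter>k. A k) = {cnj v}"
  proof -
    have vv: "v * cnj v = 1" using v by (simp flip: complex_norm_square)
    have "t = cnj v" if t: "\<And>k. t \<in> A k" for t
    proof -
      have "cmod (1 - v * t) \<le> 0"
        by (rule LIMSEQ_le_const[OF LIMSEQ_inverse_real_of_nat]) (use t in \<open>auto simp: A_def\<close>)
      then have "v * t = 1" by simp
      then have "cnj v * (v * t) = cnj v" by simp
      then show ?thesis using vv by (simp add: mult.assoc[symmetric] mult.commute[of "cnj v"])
    qed
    moreover have "cnj v \<in> A k" for k using v vv by (simp add: A_def)
    ultimately show ?thesis by blast
  qed
  ultimately show ?thesis by (simp add: A_def)
qed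

end

text \<open>
  In \<open>cauchy_int_ratio_le\<close> the last term disappears in the limit, since the square integral is at least
  \<open>\<bar>g n\<bar>\<^sup>2\<close>. It remains to let \<open>k\<close> and \<open>e\<close> tend to \<open>0\<close>.
\<close>

lemma end_point_masses:
  assumes "circle_prob \<nu>1" "circle_prob \<nu>2"
    and w: "\<And>n. cmod (w1 n) < 1" "\<And>n. cmod (w2 n) < 1"
    and g: "\<And>n. g n = cauchy_int \<nu>1 (w1 n)" "\<And>n. g n = cauchy_int \<nu>2 (w2 n)"
    and sum: "\<And>n. (r n)\<^sup>2 \<le> (cmod (g n))\<^sup>2 / cauchy_sq \<nu>1 (w1 n) + (cmod (g n))\<^sup>2 / cauchy_sq \<nu>2 (w2 n)"
    and r: "r \<longlonglongrightarrow> 1" and blowup: "(\<lambda>n. 1 / g n) \<longlonglongrightarrow> 0"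
    and lim: "w1 \<longlonglongrightarrow> v1" "w2 \<longlonglongrightarrow> v2" and v: "cmod v1 = 1" "cmod v2 = 1"
  shows "1 \<le> measure \<nu>1 {cnj v1} + measure \<nu>2 {cnj v2}"
proof -
  interpret n1: circle_measure \<nu>1 by (rule circle_measure.intro) fact
  interpret n2: circle_measure \<nu>2 by (rule circle_measure.intro) fact
  define m1 m2 where "m1 = (\<lambda>e. measure \<nu>1 {t \<in> circle. cmod (1 - v1 * t) \<le> e})"
    and "m2 = (\<lambda>e. measure \<nu>2 {t \<in> circle. cmod (1 - v2 * t) \<le> e})"
  have inv: "(\<lambda>n. (cmod (1 / g n))\<^sup>2) \<longlonglongrightarrow> 0"
  proof -
    have "(\<lambda>n. (cmod (1 / g n))\<^sup>2) \<longlonglongrightarrow> (cmod 0)\<^sup>2" by (intro tendsto_intros blowup)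
    then show ?thesis by simp
  qed
  have Qinv: "1 / cauchy_sq \<nu>1 (w1 n) \<le> (cmod (1 / g n))\<^sup>2" "1 / cauchy_sq \<nu>2 (w2 n) \<le> (cmod (1 / g n))\<^sup>2" for n
  proof -
    have p: "0 < (cmod (g n))\<^sup>2" using n1.Re_cauchy_int(2)[OF w(1)] by (simp add: g(1))
    show "1 / cauchy_sq \<nu>1 (w1 n) \<le> (cmod (1 / g n))\<^sup>2"
      using n1.cauchy_int_le_cauchy_sq[OF w(1), of n] p by (simp add: norm_divide power_divide frac_le flip: g(1))
    show "1 / cauchy_sq \<nu>2 (w2 n) \<le> (cmod (1 / g n))\<^sup>2"
      using n2.cauchy_int_le_cauchy_sq[OF w(2), of n] p by (simp add: norm_divide power_divide frac_le flip: g(2))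
  qed
  have main: "1 \<le> (1 + k) * (m1 e + m2 e)" if k: "k > 0" and e: "e > 0" for k e
  proof -
    define c where "c = (1 + 1 / k) * (4 / e\<^sup>2)"
    have c: "c \<ge> 0" using k by (simp add: c_def)
    have ev: "\<forall>\<^sub>F n in sequentially. (r n)\<^sup>2 \<le> (1 + k) * (m1 e + m2 e) + c * (2 * (cmod (1 / g n))\<^sup>2)"
    proof -
      have "\<forall>\<^sub>F n in sequentially. dist (w1 n) v1 < e / 2" "\<forall>\<^sub>F n in sequentially. dist (w2 n) v2 < e / 2"
        using tendstoD[OF lim(1), of "e / 2"] tendstoD[OF lim(2), of "e / 2"] e by simp_all
      then show ?thesis
      proof eventually_elim
        case (elim n)
        have "(cmod (g n))\<^sup>2 / cauchy_sq \<nu>1 (w1 n) \<le> (1 + k) * m1 e + c * (1 / cauchy_sq \<nu>1 (w1 n))"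
          unfolding g(1) m1_def c_def
          by (rule n1.cauchy_int_ratio_le[OF w(1) k e]) (use elim(1) in \<open>simp add: dist_norm\<close>)
        moreover have "(cmod (g n))\<^sup>2 / cauchy_sq \<nu>2 (w2 n) \<le> (1 + k) * m2 e + c * (1 / cauchy_sq \<nu>2 (w2 n))"
          unfolding g(2) m2_def c_def
          by (rule n2.cauchy_int_ratio_le[OF w(2) k e]) (use elim(2) in \<open>simp add: dist_norm\<close>)
        moreover have "c * (1 / cauchy_sq \<nu>1 (w1 n)) \<le> c * (cmod (1 / g n))\<^sup>2"
          "c * (1 / cauchy_sq \<nu>2 (w2 n)) \<le> c * (cmod (1 / g n))\<^sup>2"
          by (rule mult_left_mono[OF Qinv(1) c], rule mult_left_mono[OF Qinv(2) c])
        ultimately show ?case using sum[of n] by (simp only: distrib_left)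
      qed
    qed
    have "(\<lambda>n. (r n)\<^sup>2) \<longlonglongrightarrow> 1\<^sup>2" by (intro tendsto_intros r)
    moreover have "(\<lambda>n. (1 + k) * (m1 e + m2 e) + c * (2 * (cmod (1 / g n))\<^sup>2))
      \<longlonglongrightarrow> (1 + k) * (m1 e + m2 e) + c * (2 * 0)"
      by (intro tendsto_intros inv)
    ultimately have "1\<^sup>2 \<le> (1 + k) * (m1 e + m2 e) + c * (2 * 0)"
      by (rule tendsto_le[OF sequentially_bot _ _ ev, rotated])
    then show ?thesis by simp
  qed
  have "(\<lambda>j. (1 + inverse (real (Suc j))) * (m1 (inverse (real (Suc j))) + m2 (inverse (real (Suc j)))))
    \<longlonglongrightarrow> (1 + 0) * (measure \<nu>1 {cnj v1} + measure \<nu>2 {cnj v2})"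
    unfolding m1_def m2_def
    by (intro tendsto_mult tendsto_add tendsto_const LIMSEQ_inverse_real_of_nat
        n1.measure_flat_limit n2.measure_flat_limit v)
  then have "1 \<le> (1 + 0) * (measure \<nu>1 {cnj v1} + measure \<nu>2 {cnj v2})"
    by (rule LIMSEQ_le_const) (auto intro!: exI[of _ 0] main)
  then show ?thesis by simp
qed

lemma (in circle_measure) two_atoms:
  assumes v: "cmod v = 1" "cmod v' = 1" "v \<noteq> v'"
  shows "measure \<nu> {v} + measure \<nu> {v'} \<le> 1"
    and "measure \<nu> {v} + measure \<nu> {v'} = 1 \<Longrightarrow> circle_support \<nu> \<subseteq> {v, v'}"
proof -
  have s: "{v} \<in> sets \<nu>" "{v'} \<in> sets \<nu>" using v by (auto intro: closed_sets)
  have u: "measure \<nu> {v, v'} = measure \<nu> {v} + measure \<nu> {v'}"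
    using finite_measure_Union[OF s] v(3) by (simp add: insert_commute)
  show "measure \<nu> {v} + measure \<nu> {v'} \<le> 1" unfolding u[symmetric] by (rule prob_le_1)
  assume eq: "measure \<nu> {v} + measure \<nu> {v'} = 1"
  show "circle_support \<nu> \<subseteq> {v, v'}"
  proof (rule ccontr)
    assume "\<not> ?thesis"
    then obtain t where t: "t \<in> circle_support \<nu>" "t \<notin> {v, v'}" by blast
    have "open (- {v, v'})" by (intro open_Compl finite_imp_closed) simp
    then have "measure \<nu> (- {v, v'} \<inter> circle) > 0"
      using t unfolding circle_support_def by blast
    moreover have "{v, v'} \<in> sets \<nu>" using sets.Un[OF s] by (simp add: insert_commute)
    then have "measure \<nu> (space \<nu> - {v, v'}) = 0" using prob_compl u eq by simp
    moreover have "space \<nu> - {v, v'} = - {v, v'} \<inter> circle" by auto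
    ultimately show False by simp
  qed
qed

section \<open>The mass of the arc\<close>

theorem theorem4p1:
  fixes \<mu>\<^sub>1 \<mu>\<^sub>2 \<mu> :: "complex measure" and a b :: real and J :: "complex set"
  assumes "circle_prob \<mu>\<^sub>1" and "circle_prob \<mu>\<^sub>2"
    and "\<not> point_mass \<mu>\<^sub>1" and "\<not> point_mass \<mu>\<^sub>2"
    and "is_free_mult_conv TYPE('a::cstar_algebra) \<mu>\<^sub>1 \<mu>\<^sub>2 \<mu>"
    and "a < b" and "b \<le> a + 2 * pi" and "J = cis ` {a<..<b}"
    and "\<And>\<alpha>. \<alpha> \<in> {cis a, cis b} \<Longrightarrow>
           (eta_transform \<mu> \<longlongrightarrow> 1) (at (1 / \<alpha>) within ball 0 1)"
    and "(infinite (circle_support \<mu>\<^sub>1) \<or> card (circle_support \<mu>\<^sub>1) > 2) \<or>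
         (infinite (circle_support \<mu>\<^sub>2) \<or> card (circle_support \<mu>\<^sub>2) > 2)"
  shows "measure \<mu> J > 0"
proof (rule ccontr)
  assume "\<not> measure \<mu> J > 0"
  then have null: "measure \<mu> (cis ` {a<..<b}) = 0"
    using measure_nonneg[of \<mu> J] unfolding assms(8) by linarith
  have "circle_prob \<mu>" using assms(5) by (simp add: is_free_mult_conv_def)
  then interpret subordination \<mu>\<^sub>1 \<mu>\<^sub>2 \<mu>
    by unfold_locales (use assms free_convolution_subordination[OF assms(5,1,2)] in auto)
  obtain \<omega>1 \<omega>2 where \<omega>: "subordination_map \<mu> \<mu>\<^sub>1 \<omega>1" "subordination_map \<mu> \<mu>\<^sub>2 \<omega>2"
    and sum: "\<And>z. 0 < cmod z \<Longrightarrow> cmod z < 1 \<Longrightarrow>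
      (cmod z)\<^sup>2 \<le> (cmod (cauchy_int \<mu> z))\<^sup>2 / cauchy_sq \<mu>\<^sub>1 (\<omega>1 z) + (cmod (cauchy_int \<mu> z))\<^sup>2 / cauchy_sq \<mu>\<^sub>2 (\<omega>2 z)"
    using subordination_maps_exist by blast
  interpret A: null_arc \<mu> \<mu>\<^sub>1 \<omega>1 a b by unfold_locales (fact \<omega> assms null)+
  interpret B: null_arc \<mu> \<mu>\<^sub>2 \<omega>2 a b by unfold_locales (fact \<omega> assms null)+
  have masses: "1 \<le> measure \<mu>\<^sub>1 {cnj v1} + measure \<mu>\<^sub>2 {cnj v2}"
    if x: "\<And>n. x n \<in> A.gap" "x \<longlonglongrightarrow> e" and eta: "(eta_transform \<mu> \<longlongrightarrow> 1) (at (cis e) within ball 0 1)"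
      and lim: "(\<lambda>n. A.bd_value (x n)) \<longlonglongrightarrow> v1" "(\<lambda>n. B.bd_value (x n)) \<longlonglongrightarrow> v2" and v: "cmod v1 = 1" "cmod v2 = 1"
    for x e v1 v2
  proof -
    \<comment> \<open>Each boundary point \<open>cis (x n)\<close> is replaced by a point of its radius so close to it that both
      \<open>\<omega>\<^sub>1\<close> and \<open>\<omega>\<^sub>2\<close> are within \<open>1 / (n + 2)\<close> of their boundary values.\<close>
    define h where "h = (\<lambda>n. inverse (real (Suc (Suc n))) / (1 + A.gap_bound (x n)))"
    have Kp: "A.gap_bound (x n) > 0" for n by (rule A.gap_bound_pos[OF x(1)])
    have h: "0 < h n" "h n < 1" "A.gap_bound (x n) * h n \<le> inverse (real (Suc (Suc n)))"
      "h n \<le> inverse (real (Suc (Suc n)))" for n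
    proof -
      show hp: "0 < h n" unfolding h_def using Kp[of n] by simp
      have "h n * (1 + A.gap_bound (x n)) = inverse (real (Suc (Suc n)))" unfolding h_def using Kp[of n] by simp
      then have s: "h n + A.gap_bound (x n) * h n = inverse (real (Suc (Suc n)))" by (simp add: algebra_simps)
      then show "A.gap_bound (x n) * h n \<le> inverse (real (Suc (Suc n)))" "h n \<le> inverse (real (Suc (Suc n)))"
        using hp mult_pos_pos[OF Kp[of n] hp] by linarith+
      moreover have "inverse (real (Suc (Suc n))) < 1" by (simp add: field_simps)
      ultimately show "h n < 1" by linarith
    qed
    have i0: "(\<lambda>n. inverse (real (Suc (Suc n)))) \<longlonglongrightarrow> 0"
      by (rule LIMSEQ_Suc[OF LIMSEQ_inverse_real_of_nat])
    have h0: "h \<longlonglongrightarrow> 0"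
      by (rule Lim_null_comparison[OF _ i0]) (use h(1,4) in \<open>auto simp: less_imp_le\<close>)
    define r where "r = (\<lambda>n. 1 - h n)"
    have r: "0 < r n" "r n < 1" for n using h(1,2)[of n] by (auto simp: r_def)
    have r1: "r \<longlonglongrightarrow> 1" unfolding r_def using tendsto_diff[OF tendsto_const h0, of 1] by simp
    define z where "z = (\<lambda>n. of_real (r n) * cis (x n))"
    have nz: "cmod (z n) = r n" for n using r[of n] by (simp add: z_def norm_mult)
    have z: "0 < cmod (z n)" "cmod (z n) < 1" for n using r by (auto simp: nz)
    have zlim: "z \<longlonglongrightarrow> cis e"
    proof -
      have "z \<longlonglongrightarrow> of_real 1 * cis e" unfolding z_def by (intro tendsto_intros r1 x(2))
      then show ?thesis by simp
    qed
    have "filterlim z (at (cis e) within ball 0 1) sequentially"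
      unfolding filterlim_at using zlim z by (auto intro!: always_eventually) (metis norm_cis less_irrefl)
    from filterlim_compose[OF eta this] have "(\<lambda>n. eta_transform \<mu> (z n)) \<longlonglongrightarrow> 1" .
    then have "(\<lambda>n. 1 - eta_transform \<mu> (z n)) \<longlonglongrightarrow> 1 - 1" by (intro tendsto_intros)
    then have blow: "(\<lambda>n. 1 / cauchy_int \<mu> (z n)) \<longlonglongrightarrow> 0" using m.eta_eq(2)[OF z(2)] by simp
    have close: "(\<lambda>n. f (z n)) \<longlonglongrightarrow> v"
      if f: "\<And>n. cmod (f (z n) - g (x n)) \<le> A.gap_bound (x n) * (1 - r n)"
        and g: "(\<lambda>n. g (x n)) \<longlonglongrightarrow> v" for f g v
    proof -
      have "(\<lambda>n. f (z n) - g (x n)) \<longlonglongrightarrow> 0"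
      proof (rule Lim_null_comparison[OF _ i0], rule always_eventually, rule allI)
        fix n show "norm (f (z n) - g (x n)) \<le> inverse (real (Suc (Suc n)))"
          using f[of n] h(3)[of n] by (simp add: r_def)
      qed
      from tendsto_add[OF this g] show ?thesis by simp
    qed
    have close1: "(\<lambda>n. \<omega>1 (z n)) \<longlonglongrightarrow> v1"
      by (rule close[OF _ lim(1)]) (use A.bd_value_radial[OF x(1) r] in \<open>simp add: z_def\<close>)
    have close2: "(\<lambda>n. \<omega>2 (z n)) \<longlonglongrightarrow> v2"
      by (rule close[OF _ lim(2)]) (use B.bd_value_radial[OF x(1) r] in \<open>simp add: z_def\<close>)
    show ?thesis
      by (rule end_point_masses[OF assms(1,2) A.map_props(2)[OF z] B.map_props(2)[OF z]
            A.map_props(3)[OF z] B.map_props(3)[OF z] _ r1 blow close1 close2 v])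
        (use sum[OF z] nz in simp)
  qed
  obtain v1 v1' where v1: "cmod v1 = 1" "cmod v1' = 1" "v1 \<noteq> v1'"
    "(A.bd_value \<longlongrightarrow> v1) (at_right (- b))" "(A.bd_value \<longlongrightarrow> v1') (at_left (- a))"
    using A.distinct_ends[OF assms(3)] by blast
  obtain v2 v2' where v2: "cmod v2 = 1" "cmod v2' = 1" "v2 \<noteq> v2'"
    "(B.bd_value \<longlongrightarrow> v2) (at_right (- b))" "(B.bd_value \<longlongrightarrow> v2') (at_left (- a))"
    using B.distinct_ends[OF assms(4)] by blast
  define \<delta> where "\<delta> = (\<lambda>n. (b - a) * inverse (real (Suc (Suc n))))"
  have \<delta>: "0 < \<delta> n" "\<delta> n < b - a" for n
  proof -
    have "inverse (real (Suc (Suc n))) < 1" by (simp add: field_simps)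
    then have "(b - a) * inverse (real (Suc (Suc n))) < (b - a) * 1"
      using assms(6) by (intro mult_strict_left_mono) auto
    then show "\<delta> n < b - a" by (simp add: \<delta>_def)
    show "0 < \<delta> n" using assms(6) by (simp add: \<delta>_def)
  qed
  have \<delta>0: "\<delta> \<longlonglongrightarrow> 0"
    unfolding \<delta>_def using tendsto_mult[OF tendsto_const LIMSEQ_Suc[OF LIMSEQ_inverse_real_of_nat], of "b - a"] by simp
  have R: "(\<lambda>n. - b + \<delta> n) \<longlonglongrightarrow> - b" using tendsto_add[OF tendsto_const \<delta>0, of "- b"] by simp
  have L: "(\<lambda>n. - a - \<delta> n) \<longlonglongrightarrow> - a" using tendsto_diff[OF tendsto_const \<delta>0, of "- a"] by simp
  have RX: "- b + \<delta> n \<in> A.gap" and LX: "- a - \<delta> n \<in> A.gap" for n using \<delta>[of n] by (auto simp: A.gap_def)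
  have Rf: "filterlim (\<lambda>n. - b + \<delta> n) (at_right (- b)) sequentially"
    unfolding filterlim_at using R \<delta> by (auto intro!: always_eventually simp: less_imp_neq[symmetric])
  have Lf: "filterlim (\<lambda>n. - a - \<delta> n) (at_left (- a)) sequentially"
    unfolding filterlim_at using L \<delta> by (auto intro!: always_eventually simp: less_imp_neq[symmetric])
  have inv_cis: "1 / cis s = cis (- s)" for s by (simp add: divide_inverse)
  have right: "1 \<le> measure \<mu>\<^sub>1 {cnj v1} + measure \<mu>\<^sub>2 {cnj v2}"
    using masses[OF RX R _ filterlim_compose[OF v1(4) Rf] filterlim_compose[OF v2(4) Rf] v1(1) v2(1)]
      assms(9)[of "cis b"] inv_cis[of b] by simp
  have left: "1 \<le> measure \<mu>\<^sub>1 {cnj v1'} + measure \<mu>\<^sub>2 {cnj v2'}"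
    using masses[OF LX L _ filterlim_compose[OF v1(5) Lf] filterlim_compose[OF v2(5) Lf] v1(2) v2(2)]
      assms(9)[of "cis a"] inv_cis[of a] by simp
  have c1: "cmod (cnj v1) = 1" "cmod (cnj v1') = 1" "cnj v1 \<noteq> cnj v1'"
    and c2: "cmod (cnj v2) = 1" "cmod (cnj v2') = 1" "cnj v2 \<noteq> cnj v2'"
    using v1 v2 by auto
  note le = m1.two_atoms(1)[OF c1] m2.two_atoms(1)[OF c2]
  have "circle_support \<mu>\<^sub>1 \<subseteq> {cnj v1, cnj v1'}" "circle_support \<mu>\<^sub>2 \<subseteq> {cnj v2, cnj v2'}"
    using m1.two_atoms(2)[OF c1] m2.two_atoms(2)[OF c2] le left right by auto
  moreover have "finite S \<and> card S \<le> 2" if "S \<subseteq> {p, q}" for S :: "complex set" and p q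
    using that card_mono[of "{p, q}" S] card_2_iff'[of "{p, q}"] finite_subset[of S "{p, q}"]
      card_insert_le_m1[of 2 "{q}" p] by fastforce
  ultimately show False using assms(10) by (metis not_less)
qed

end
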